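(* Let $\mathbb{B}$ be a separable (real) Banach space. Let $\mu\ge 0$ be a finite Borel measure on $\mathbb{B}$. (i) Let $p\in[1,\infty)$ and $f\in W^{1,p}(\mathbb{B},\mu)$ be given. Then there exists a sequence $(f_n)_{n}\subseteq\mathrm{Cyl}(\mathbb{B})$ such that $f_n\to f$ and $\|\mathrm{d}_\cdot f_n\|_{\mathbb{B}^*}\to|\mathrm{D}f|$ in $L^p(\mu)$. (ii) Let $f\in BV(\mathbb{B},\mu)$ be given. Then there exists a sequence $(f_n)_n\subseteq\mathrm{Cyl}(\mathbb{B})$ such that $f_n\to f$ in $L^1(\mu)$ and $\int_{\mathbb{B}}\|\mathrm{d}_\cdot f_n\|_{\mathbb{B}^*}\,\mathrm{d}\mu\to|\mathbf{D}f|(\mathbb{B})$. In particular, it holds that $\|\mathrm{d}_\cdot f_n\|_{\mathbb{B}^*}\,\mu\rightharpoonup|\mathbf{D}f|$ weakly, i.e. in duality with the space of real-valued bounded continuous functions on $\mathbb{B}$.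
   Context: For a metric space $(X,d)$, $\mathrm{LIP}_b(X)$ denotes the space of all bounded real-valued Lipschitz functions on $X$. For a real-valued function $f$ on $X$ and $A\subseteq X$, $\mathrm{Lip}(f;A)$ denotes the Lipschitz constant of $f$ on $A$. The asymptotic slope is $\mathrm{lip}_a(f)(x):=\inf_{r>0}\mathrm{Lip}(f;B_r(x))$, where $B_r(x)$ is the open ball of center $x$ and radius $r$; for a locally Lipschitz function on an open set $\Omega$ the same formula is used at points of $\Omega$. For a Banach space $\mathbb{B}$, $\mathbb{B}^*$ is its dual, $C^\infty(\mathbb{B})$ is the space of smooth (i.e. infinitely Fréchet differentiable) functions $f:\mathbb{B}\to\mathbb{R}$, and $\mathrm{d}_x f\in\mathbb{B}^*$ is the Fréchet differential of $f$ at $x$; $\|\mathrm{d}_\cdot f\|_{\mathbb{B}^*}$ denotes the function $x\mapsto\|\mathrm{d}_x f\|_{\mathbb{B}^*}$. The space of smooth cylindrical functions $\mathrm{Cyl}(\mathbb{B})$ is the set of all functions of the form $g\circ p:\mathbb{B}\to\mathbb{R}$, where $\mathbb{V}$ is a finite-dimensional Banach space, $p:\mathbb{B}\to\mathbb{V}$ is a bounded linear operator, and $g\in C^\infty(\mathbb{V})\cap\mathrm{LIP}_b(\mathbb{V})$. Sobolev space. Given $p\in[1,\infty)$, a function $f\in L^p(\mu)$ belongs to $W^{1,p}(\mathbb{B},\mu)$ if there exist $(f_n)_n\subseteq\mathrm{LIP}_b(\mathbb{B})$ and a non-negative function $G\in L^p(\mu)$ such that $f_n\to f$ and $\mathrm{lip}_a(f_n)\to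 G$ in $L^p(\mu)$. For $f\in W^{1,p}(\mathbb{B},\mu)$, the unique $\mu$-a.e. minimal such function $G$ (which exists) is called the minimal relaxed slope of $f$ and is denoted by $|\mathrm{D}f|$. BV space. A function $f\in L^1(\mu)$ belongs to $BV(\mathbb{B},\mu)$ if there exists $(f_n)_n\subseteq\mathrm{LIP}_b(\mathbb{B})$ such that $f_n\to f$ in $L^1(\mu)$ and $\liminf_n\int_{\mathbb{B}}\mathrm{lip}_a(f_n)\,\mathrm{d}\mu<+\infty$. Given $f\in BV(\mathbb{B},\mu)$, $|\mathbf{D}f|$ denotes the unique finite Borel measure on $\mathbb{B}$ (which exists) such that for every open set $\Omega\subseteq\mathbb{B}$ $$|\mathbf{D}f|(\Omega)=\inf\Big\{\liminf_n\int_\Omega\mathrm{lip}_a(f_n)\,\mathrm{d}\mu\;\Big|\;(f_n)_n\subseteq\mathrm{LIP}_{loc}(\Omega)\cap L^1(\mu|_\Omega),\ f_n\to f|_\Omega\text{ in }L^1(\mu|_\Omega)\Big\},$$ where $\mathrm{LIP}_{loc}(\Omega)$ is the space of all real-valued locally Lipschitz functions on $\Omega$. Moreover (known fact, part of the standing background on $BV$), $|\mathbf{D}f|(\mathbb{B})=\inf_{(f_n)_n}\liminf_n\int_{\mathbb{B}}\mathrm{lip}_a(f_n)\,\mathrm{d}\mu$, where the infimum is over all sequences $(f_n)_n\subseteq\mathrm{LIP}_b(\mathbb{B})$ with $f_n\to f$ in $L^1(\mu)$. *)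

theory Defs
  imports "HOL-Analysis.Analysis"
begin

section \<open>Lipschitz functions and asymptotic slope\<close>

definition LIPb :: "'a::metric_space set \<Rightarrow> ('a \<Rightarrow> real) set" where
  "LIPb X = {f. bounded (f ` X) \<and> (\<exists>L. L-lipschitz_on X f)}"

definition LIPloc :: "'a::metric_space set \<Rightarrow> ('a \<Rightarrow> real) set" where
  "LIPloc X = {f. \<forall>x\<in>X. \<exists>r>0. \<exists>L. L-lipschitz_on (ball x r \<inter> X) f}"

text \<open>The diagonal contributes \<open>0 / 0 = 0\<close>.\<close>

definition Lip :: "('a::metric_space \<Rightarrow> real) \<Rightarrow> 'a set \<Rightarrow> ennreal" where
  "Lip f A = (SUP x\<in>A. SUP y\<in>A. ennreal (\<bar>f x - f y\<bar> / dist x y))"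

text \<open>\<open>lip_a X f\<close> only looks at the values of \<open>f\<close> on \<open>X\<close>: the balls are those of the metric
  space \<open>X\<close>.\<close>

definition lip_a :: "'a::metric_space set \<Rightarrow> ('a \<Rightarrow> real) \<Rightarrow> 'a \<Rightarrow> ennreal" where
  "lip_a X f x = (INF r\<in>{0<..}. Lip f (ball x r \<inter> X))"

section \<open>Convergence in \<open>L\<^sup>p\<close>\<close>

definition Lp :: "real \<Rightarrow> 'a measure \<Rightarrow> ('a \<Rightarrow> real) set" where
  "Lp p M = {f \<in> borel_measurable M. integrable M (\<lambda>x. \<bar>f x\<bar> powr p)}"

definition Lp_tendsto :: "real \<Rightarrow> 'a measure \<Rightarrow> (nat \<Rightarrow> 'a \<Rightarrow> real) \<Rightarrow> ('a \<Rightarrow> real) \<Rightarrow> bool" where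
  "Lp_tendsto p M fs f \<longleftrightarrow>
     (\<forall>n. fs n \<in> Lp p M) \<and> f \<in> Lp p M \<and>
     (\<lambda>n. \<integral>x. \<bar>fs n x - f x\<bar> powr p \<partial>M) \<longlonglongrightarrow> 0"

section \<open>Smooth cylindrical functions\<close>

definition tuples :: "'v set \<Rightarrow> nat \<Rightarrow> 'v list set" where
  "tuples V k = {vs \<in> lists V. length vs = k}"

definition bounded_multilinear_on ::
  "'v::real_normed_vector set \<Rightarrow> nat \<Rightarrow> ('v list \<Rightarrow> real) \<Rightarrow> bool" where
  "bounded_multilinear_on V k T \<longleftrightarrow>
     (\<forall>vs\<in>tuples V k. \<forall>i<k. \<forall>u\<in>V. \<forall>w\<in>V. \<forall>c.
        T (vs[i := u + w]) = T (vs[i := u]) + T (vs[i := w]) \<and>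
        T (vs[i := c *\<^sub>R u]) = c * T (vs[i := u])) \<and>
     (\<exists>C. \<forall>vs\<in>tuples V k. \<bar>T vs\<bar> \<le> C * prod_list (map norm vs))"

text \<open>\<open>g\<close> is infinitely Frechet differentiable on the normed space \<open>V\<close> (a linear subspace of the
  ambient type, with the induced norm). The witness \<open>D k x\<close> is the \<open>k\<close>-th differential of \<open>g\<close>
  at \<open>x\<close>, a bounded \<open>k\<close>-linear form on \<open>V\<close>, and the last clause says that \<open>D (Suc k) x\<close> is the
  Frechet differential at \<open>x\<close> of \<open>D k\<close> with respect to the norm of \<open>k\<close>-linear forms,
  a linear map from \<open>V\<close> to \<open>k\<close>-linear forms being read as a \<open>(k + 1)\<close>-linear form.\<close>

definition Cinfty :: "'v::real_normed_vector set \<Rightarrow> ('v \<Rightarrow> real) set" where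
  "Cinfty V = {g. \<exists>D :: nat \<Rightarrow> 'v \<Rightarrow> 'v list \<Rightarrow> real.
     (\<forall>x\<in>V. D 0 x [] = g x) \<and>
     (\<forall>k. \<forall>x\<in>V. bounded_multilinear_on V k (D k x)) \<and>
     (\<forall>k. \<forall>x\<in>V. \<forall>e>0. \<exists>d>0. \<forall>h\<in>V. norm h < d \<longrightarrow>
        (\<forall>vs\<in>tuples V k.
           \<bar>D k (x + h) vs - D k x vs - D (Suc k) x (h # vs)\<bar>
             \<le> e * norm h * prod_list (map norm vs)))}"

text \<open>The finite-dimensional Banach space \<open>V\<close> in the definition of a cylindrical function has
  varying dimension and norm, so it cannot be a type. It ranges over the finite-dimensional
  subspaces of the space of bounded real sequences with the supremum norm, here the type
  \<^typ>\<open>nat \<Rightarrow>\<^sub>C real\<close> (\<open>nat\<close> is discrete). Every finite-dimensional normed space is isometric to such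
  a subspace, via \<open>v \<mapsto> (\<xi>\<^sub>i v)\<^sub>i\<close> for a dense sequence \<open>(\<xi>\<^sub>i)\<^sub>i\<close> in its dual unit ball. See also
  \<open>Cyl_euclidean\<close> below.\<close>

definition Cyl :: "('a::real_normed_vector \<Rightarrow> real) set" where
  "Cyl = {g \<circ> P | g P (V :: (nat \<Rightarrow>\<^sub>C real) set).
     (\<exists>S. finite S \<and> V = span S) \<and> bounded_linear P \<and> range P \<subseteq> V \<and> g \<in> Cinfty V \<inter> LIPb V}"

section \<open>Sobolev and BV functions\<close>

text \<open>\<open>relaxed_slope p M f G\<close>: \<open>G\<close> is one of the functions admitted in the definition of
  the Sobolev space.\<close>

definition relaxed_slope ::
  "real \<Rightarrow> 'a::real_normed_vector measure \<Rightarrow> ('a \<Rightarrow> real) \<Rightarrow> ('a \<Rightarrow> real) \<Rightarrow> bool" where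
  "relaxed_slope p M f G \<longleftrightarrow>
     G \<in> Lp p M \<and> (AE x in M. 0 \<le> G x) \<and>
     (\<exists>fs. (\<forall>n. fs n \<in> LIPb UNIV) \<and> Lp_tendsto p M fs f \<and>
           Lp_tendsto p M (\<lambda>n x. enn2real (lip_a UNIV (fs n) x)) G)"

definition Sobolev :: "real \<Rightarrow> 'a::real_normed_vector measure \<Rightarrow> ('a \<Rightarrow> real) set" where
  "Sobolev p M = {f \<in> Lp p M. \<exists>G. relaxed_slope p M f G}"

text \<open>\<open>G\<close> is a representative of the minimal relaxed slope of \<open>f\<close>.\<close>

definition minimal_relaxed_slope ::
  "real \<Rightarrow> 'a::real_normed_vector measure \<Rightarrow> ('a \<Rightarrow> real) \<Rightarrow> ('a \<Rightarrow> real) \<Rightarrow> bool" where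
  "minimal_relaxed_slope p M f G \<longleftrightarrow>
     relaxed_slope p M f G \<and> (\<forall>G'. relaxed_slope p M f G' \<longrightarrow> (AE x in M. G x \<le> G' x))"

definition BV :: "'a::real_normed_vector measure \<Rightarrow> ('a \<Rightarrow> real) set" where
  "BV M = {f \<in> Lp 1 M. \<exists>fs. (\<forall>n. fs n \<in> LIPb UNIV) \<and> Lp_tendsto 1 M fs f \<and>
     liminf (\<lambda>n. \<integral>\<^sup>+x. lip_a UNIV (fs n) x \<partial>M) < \<infinity>}"

definition BV_energy_loc ::
  "'a::real_normed_vector measure \<Rightarrow> ('a \<Rightarrow> real) \<Rightarrow> 'a set \<Rightarrow> ennreal" where
  "BV_energy_loc M f \<Omega> =
     (INF fs\<in>{fs. (\<forall>n. fs n \<in> LIPloc \<Omega>) \<and> Lp_tendsto 1 (restrict_space M \<Omega>) fs f}.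
        liminf (\<lambda>n. \<integral>\<^sup>+x. lip_a \<Omega> (fs n) x \<partial>restrict_space M \<Omega>))"

definition BV_energy :: "'a::real_normed_vector measure \<Rightarrow> ('a \<Rightarrow> real) \<Rightarrow> ennreal" where
  "BV_energy M f =
     (INF fs\<in>{fs. (\<forall>n. fs n \<in> LIPb UNIV) \<and> Lp_tendsto 1 M fs f}.
        liminf (\<lambda>n. \<integral>\<^sup>+x. lip_a UNIV (fs n) x \<partial>M))"

text \<open>\<open>\<nu>\<close> is the total variation measure of \<open>f\<close>. The second clause determines \<open>\<nu>\<close>. The last clause
  is the known theorem that on the whole space globally Lipschitz competitors give the same value
  as locally Lipschitz ones; it is recorded here as part of the background on \<open>\<nu>\<close> and excludes
  no measure satisfying the first two clauses when \<open>f \<in> BV M\<close>.\<close>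

definition total_variation_measure ::
  "'a::real_normed_vector measure \<Rightarrow> ('a \<Rightarrow> real) \<Rightarrow> 'a measure \<Rightarrow> bool" where
  "total_variation_measure M f \<nu> \<longleftrightarrow>
     sets \<nu> = sets borel \<and> finite_measure \<nu> \<and>
     (\<forall>\<Omega>. open \<Omega> \<longrightarrow> emeasure \<nu> \<Omega> = BV_energy_loc M f \<Omega>) \<and>
     emeasure \<nu> UNIV = BV_energy M f"

text \<open>\<open>dual_norm_diff f x\<close> is the dual norm of the Frechet differential of \<open>f\<close> at \<open>x\<close>.\<close>

definition dual_norm_diff :: "('a::real_normed_vector \<Rightarrow> real) \<Rightarrow> 'a \<Rightarrow> real" where
  "dual_norm_diff f x = onorm (frechet_derivative f (at x))"

section \<open>Cylindrical functions through Euclidean spaces of arbitrary dimension\<close>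

lemma Cinfty_bounded_linear:
  fixes T :: "'v::real_normed_vector \<Rightarrow> 'w::real_normed_vector"
  assumes T: "bounded_linear T" and g: "g \<in> Cinfty W" and V: "T ` V \<subseteq> W"
  shows "g \<circ> T \<in> Cinfty V"
proof -
  interpret T: bounded_linear T by (rule T)
  obtain K where K: "K > 0" "\<And>v. norm (T v) \<le> norm v * K"
    using T.pos_bounded by blast
  have prod: "prod_list (map norm (map T vs)) \<le> K ^ length vs * prod_list (map norm vs)"
    "0 \<le> prod_list (map norm (map T vs))" "0 \<le> prod_list (map norm vs)" for vs
  proof -
    have *: "0 \<le> prod_list (map norm (us :: 'z::real_normed_vector list))" for us
      by (induction us) auto
    show "0 \<le> prod_list (map norm (map T vs))" "0 \<le> prod_list (map norm vs)" by (fact *)+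
    show "prod_list (map norm (map T vs)) \<le> K ^ length vs * prod_list (map norm vs)"
    proof (induction vs)
      case (Cons a vs)
      have "norm (T a) * prod_list (map norm (map T vs))
          \<le> (norm a * K) * (K ^ length vs * prod_list (map norm vs))"
        using K *[of "map T vs"] by (intro mult_mono Cons) auto
      then show ?case by (simp add: ac_simps)
    qed simp
  qed
  have tup: "map T vs \<in> tuples W k" if "vs \<in> tuples V k" for vs k
    using that V by (fastforce simp: tuples_def)
  obtain D where D0: "\<forall>x\<in>W. D 0 x [] = g x"
    and Dm: "\<forall>k. \<forall>x\<in>W. bounded_multilinear_on W k (D k x)"
    and Dd: "\<forall>k. \<forall>x\<in>W. \<forall>e>0. \<exists>d>0. \<forall>h\<in>W. norm h < d \<longrightarrow>
        (\<forall>vs\<in>tuples W k. \<bar>D k (x + h) vs - D k x vs - D (Suc k) x (h # vs)\<bar>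
             \<le> e * norm h * prod_list (map norm vs))"
    using g by (auto simp: Cinfty_def)
  define E where "E = (\<lambda>k x vs. D k (T x) (map T vs))"
  have "\<forall>x\<in>V. E 0 x [] = (g \<circ> T) x"
    using D0 V by (auto simp: E_def)
  moreover have "bounded_multilinear_on V k (E k x)" if "x \<in> V" for k x
  proof -
    have m: "bounded_multilinear_on W k (D k (T x))" using Dm V that by auto
    then obtain C where C: "\<forall>vs\<in>tuples W k. \<bar>D k (T x) vs\<bar> \<le> C * prod_list (map norm vs)"
      by (auto simp: bounded_multilinear_on_def)
    have "\<bar>E k x vs\<bar> \<le> (\<bar>C\<bar> * K ^ k) * prod_list (map norm vs)" if "vs \<in> tuples V k" for vs
    proof -
      have "\<bar>E k x vs\<bar> \<le> C * prod_list (map norm (map T vs))"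
        using C tup[OF that] by (auto simp: E_def)
      also have "\<dots> \<le> \<bar>C\<bar> * (K ^ k * prod_list (map norm vs))"
        using prod[of vs] that by (intro mult_mono) (auto simp: tuples_def)
      finally show ?thesis by (simp add: ac_simps)
    qed
    moreover have "E k x (vs[i := u + w]) = E k x (vs[i := u]) + E k x (vs[i := w]) \<and>
        E k x (vs[i := c *\<^sub>R u]) = c * E k x (vs[i := u])"
      if "vs \<in> tuples V k" "i < k" "u \<in> V" "w \<in> V" for vs i u w c
    proof -
      have "T u \<in> W" "T w \<in> W" using that V by auto
      moreover have "\<forall>vs\<in>tuples W k. \<forall>i<k. \<forall>u\<in>W. \<forall>w\<in>W. \<forall>c.
          D k (T x) (vs[i := u + w]) = D k (T x) (vs[i := u]) + D k (T x) (vs[i := w]) \<and>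
          D k (T x) (vs[i := c *\<^sub>R u]) = c * D k (T x) (vs[i := u])"
        using m unfolding bounded_multilinear_on_def by (rule conjunct1)
      ultimately show ?thesis
        using tup[OF that(1)] that(2) by (simp add: E_def map_update T.add T.scaleR)
    qed
    ultimately show ?thesis unfolding bounded_multilinear_on_def by blast
  qed
  moreover have "\<exists>d>0. \<forall>h\<in>V. norm h < d \<longrightarrow>
        (\<forall>vs\<in>tuples V k. \<bar>E k (x + h) vs - E k x vs - E (Suc k) x (h # vs)\<bar>
             \<le> e * norm h * prod_list (map norm vs))" if x: "x \<in> V" and e: "e > 0" for k x e
  proof -
    define e' where "e' = e / (K * K ^ k)"
    have e': "e' > 0" using K e by (auto simp: e'_def)
    have "T x \<in> W" using V x by auto
    from Dd[rule_format, OF this e', of k] obtain d where d: "d > 0" "\<forall>h\<in>W. norm h < d \<longrightarrow>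
        (\<forall>vs\<in>tuples W k. \<bar>D k (T x + h) vs - D k (T x) vs - D (Suc k) (T x) (h # vs)\<bar>
             \<le> e' * norm h * prod_list (map norm vs))"
      by blast
    have "\<bar>E k (x + h) vs - E k x vs - E (Suc k) x (h # vs)\<bar>
             \<le> e * norm h * prod_list (map norm vs)"
      if h: "h \<in> V" "norm h < d / K" and vs: "vs \<in> tuples V k" for h vs
    proof -
      have "norm (T h) \<le> norm h * K" by (rule K)
      also have "\<dots> < d" using h K by (simp add: field_simps)
      finally have "norm (T h) < d" .
      moreover have "T h \<in> W" using h V by auto
      ultimately have "\<bar>E k (x + h) vs - E k x vs - E (Suc k) x (h # vs)\<bar>
          \<le> e' * norm (T h) * prod_list (map norm (map T vs))"
        using d(2)[rule_format, OF _ _ tup[OF vs], of "T h"] by (simp add: E_def T.add)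
      also have "\<dots> \<le> e' * (norm h * K) * (K ^ k * prod_list (map norm vs))"
        using prod[of vs] vs e' K by (intro mult_mono) (auto simp: tuples_def)
      also have "\<dots> = e * norm h * prod_list (map norm vs)"
        using K by (simp add: e'_def field_simps)
      finally show ?thesis .
    qed
    then show ?thesis using d K by (intro exI[of _ "d / K"]) auto
  qed
  ultimately show ?thesis unfolding Cinfty_def by blast
qed

lemma Cyl_euclidean:
  fixes P :: "'a::real_normed_vector \<Rightarrow> 'v::euclidean_space"
  assumes P: "bounded_linear P" and g: "g \<in> Cinfty UNIV \<inter> LIPb UNIV"
  shows "g \<circ> P \<in> Cyl"
proof -
  obtain b :: "nat \<Rightarrow> 'v" where b: "bij_betw b {..<DIM('v)} Basis"
    using ex_bij_betw_nat_finite[OF finite_Basis] by (auto simp: atLeast0LessThan)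
  define j :: "'v \<Rightarrow> nat \<Rightarrow> real" where "j = (\<lambda>v i. if i < DIM('v) then v \<bullet> b i else 0)"
  define J :: "'v \<Rightarrow> (nat \<Rightarrow>\<^sub>C real)" where "J = (\<lambda>v. Bcontfun (j v))"
  define T :: "(nat \<Rightarrow>\<^sub>C real) \<Rightarrow> 'v" where "T = (\<lambda>s. \<Sum>i<DIM('v). s i *\<^sub>R b i)"
  have bB: "b i \<in> Basis" if "i < DIM('v)" for i using b that by (auto simp: bij_betw_def)
  have jle: "\<bar>j v i\<bar> \<le> norm v" for v i
    using bB Basis_le_norm by (auto simp: j_def)
  have jb: "j v \<in> bcontfun" for v
    by (rule bcontfun_normI[where b = "norm v"]) (use jle in auto)
  have Ja: "apply_bcontfun (J v) = j v" for v
    unfolding J_def by (rule Bcontfun_inverse[OF jb])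
  have J: "bounded_linear J"
  proof (rule bounded_linear_intro[where K = 1])
    show "J (x + y) = J x + J y" for x y
      by (rule bcontfun_eqI) (simp add: Ja j_def inner_add_left)
    show "J (r *\<^sub>R x) = r *\<^sub>R J x" for r x
      by (rule bcontfun_eqI) (simp add: Ja j_def)
    show "norm (J x) \<le> norm x * 1" for x
      using norm_bound[of "J x" "norm x"] jle by (simp add: Ja)
  qed
  have T: "bounded_linear T"
    unfolding T_def
  proof (intro bounded_linear_sum bounded_linear_compose[OF bounded_linear_scaleR_left])
    show "bounded_linear (\<lambda>s :: nat \<Rightarrow>\<^sub>C real. s i)" for i
      by (rule bounded_linear_intro[where K = 1])
        (simp, simp, unfold mult_1_right, rule norm_bounded)
  qed
  have TJ: "T (J v) = v" for v
  proof -
    have "T (J v) = (\<Sum>i<DIM('v). (v \<bullet> b i) *\<^sub>R b i)"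
      by (simp add: T_def Ja j_def)
    also have "\<dots> = (\<Sum>u\<in>Basis. (v \<bullet> u) *\<^sub>R u)"
      by (rule sum.reindex_bij_betw[OF b])
    finally show ?thesis by (simp add: euclidean_representation)
  qed
  define V where "V = span (J ` Basis)"
  have "J v \<in> V" for v
    using linear_span_image[OF bounded_linear.linear[OF J], of Basis]
    by (auto simp: V_def span_Basis)
  moreover have "g \<circ> T \<in> LIPb V"
  proof -
    obtain L where L: "L-lipschitz_on UNIV g" using g by (auto simp: LIPb_def)
    obtain K where K: "K-lipschitz_on V T" using bounded_linear.lipschitz_boundE[OF T] by blast
    have "(L * K)-lipschitz_on V (g \<circ> T)"
      using lipschitz_on_compose[OF K lipschitz_on_subset[OF L]] by simp
    moreover have "bounded ((g \<circ> T) ` V)"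
      by (rule bounded_subset[of "range g"]) (use g in \<open>auto simp: LIPb_def\<close>)
    ultimately show ?thesis by (auto simp: LIPb_def)
  qed
  moreover have "g \<circ> T \<in> Cinfty V"
    using Cinfty_bounded_linear[OF T, of g UNIV V] g by simp
  moreover have "g \<circ> P = (g \<circ> T) \<circ> (J \<circ> P)" by (auto simp: TJ)
  moreover have "bounded_linear (J \<circ> P)"
    using bounded_linear_compose[OF J P] by (simp add: o_def)
  moreover have "\<exists>S. finite S \<and> V = span S" unfolding V_def using finite_Basis by blast
  ultimately show ?thesis
    unfolding Cyl_def mem_Collect_eq
    by (intro exI[of _ "g \<circ> T"] exI[of _ "J \<circ> P"] exI[of _ V]) auto
qed

end

theory Submission
  imports Defs
begin

text \<open>
  Let \<open>f\<close> be bounded and Lipschitz and fix a scale \<open>r\<close>. Over a finite net \<open>Y\<close> that is fine compared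
  with \<open>r\<close> and covers all but little of \<open>M\<close>, consider the minimum over \<open>y \<in> Y\<close> of
  \<open>f y + \<psi>\<^sub>y (q (x - y))\<close>. Here \<open>q\<close> is a finite maximum of functionals norming the differences of
  points of \<open>Y\<close>, and \<open>\<psi>\<^sub>y\<close> has slope slightly above the Lipschitz constant of \<open>f\<close> on \<open>ball y (2 * r)\<close>
  near \<open>0\<close> and a steep slope at distances above \<open>r\<close>. At points close to the net only nearby \<open>y\<close>
  compete, so this function is close to \<open>f\<close> and its slope at \<open>x\<close> hardly exceeds the Lipschitz constant
  of \<open>f\<close> on \<open>ball x (3 * r)\<close>. Replacing minimum and maximum by log-sum-exp at low temperature makes it
  smooth and cylindrical. Letting \<open>r\<close> tend to \<open>0\<close>, every such \<open>f\<close> is approximated by cylindrical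
  functions whose slopes asymptotically do not exceed that of \<open>f\<close>.

  In the Sobolev case one obtains cylindrical \<open>u\<^sub>n\<close> converging to \<open>f\<close> with slopes asymptotically below
  the minimal relaxed slope \<open>G\<close>. Among all Lipschitz functions with these two properties, consider
  the integral of \<open>s + exp (- s)\<close> over the slope \<open>s\<close>: its convexity gap makes \<open>exp (- s / 2)\<close> Cauchy in
  \<open>L\<^sup>2\<close> along asymptotically minimizing sequences, so their slopes converge strongly, by minimality
  to \<open>G\<close>. Hence the minimal value is that of \<open>G\<close>, the \<open>u\<^sub>n\<close> are minimizing themselves, and
  their slopes converge to \<open>G\<close>. In the BV case lower semicontinuity on open sets and convergence of
  the total masses give weak convergence.
\<close>

section \<open>Norming functionals\<close>

definition sublinear :: "('a::real_vector \<Rightarrow> real) \<Rightarrow> bool" where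
  "sublinear p \<longleftrightarrow> (\<forall>x y. p (x + y) \<le> p x + p y) \<and> (\<forall>c x. 0 < c \<longrightarrow> p (c *\<^sub>R x) = c * p x)"

lemma sublinear_0:
  assumes "sublinear p"
  shows "p 0 = 0"
proof -
  have "p (2 *\<^sub>R 0) = 2 * p 0"
    using assms unfolding sublinear_def by (metis zero_less_numeral)
  then show ?thesis by simp
qed

lemma sublinear_minus:
  assumes "sublinear p"
  shows "- p (- x) \<le> p x"
proof -
  have "p (x + - x) \<le> p x + p (- x)" using assms unfolding sublinear_def by blast
  then show ?thesis using sublinear_0[OF assms] by simp
qed

lemma sublinear_scale_nonneg:
  assumes "sublinear p" "0 \<le> c"
  shows "p (c *\<^sub>R x) = c * p x"
  using assms sublinear_0[OF assms(1)] by (cases "c = 0") (auto simp: sublinear_def)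

definition directional_inf :: "('a::real_vector \<Rightarrow> real) \<Rightarrow> 'a \<Rightarrow> 'a \<Rightarrow> real" where
  "directional_inf p y x = (INF t\<in>{0..}. p (x + t *\<^sub>R y) - t * p y)"

lemma directional_inf:
  assumes p: "sublinear p"
  shows directional_inf_le: "0 \<le> t \<Longrightarrow> directional_inf p y x \<le> p (x + t *\<^sub>R y) - t * p y"
    and sublinear_directional_inf: "sublinear (directional_inf p y)"
proof -
  have add: "p (u + v) \<le> p u + p v" for u v using p by (auto simp: sublinear_def)
  have lower: "- p (- x) \<le> p (x + t *\<^sub>R y) - t * p y" if "0 \<le> t" for x t
    using add[of "x + t *\<^sub>R y" "- x"] sublinear_scale_nonneg[OF p that, of y] by simp
  have bdd: "bdd_below ((\<lambda>t. p (x + t *\<^sub>R y) - t * p y) ` {0..})" for x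
    using lower[of _ x] by (intro bdd_belowI[where m = "- p (- x)"]) auto
  show le: "directional_inf p y x \<le> p (x + t *\<^sub>R y) - t * p y" if "0 \<le> t" for x t
    unfolding directional_inf_def using bdd that by (intro cINF_lower) auto
  have gr: "c \<le> directional_inf p y x" if "\<And>t. 0 \<le> t \<Longrightarrow> c \<le> p (x + t *\<^sub>R y) - t * p y" for c x
    unfolding directional_inf_def using that by (intro cINF_greatest) auto
  have "directional_inf p y (u + v) \<le> directional_inf p y u + directional_inf p y v" for u v
  proof -
    have "directional_inf p y (u + v) - (p (v + t *\<^sub>R y) - t * p y) \<le> p (u + s *\<^sub>R y) - s * p y"
      if "0 \<le> s" "0 \<le> t" for s t
      using le[of "s + t" "u + v"] add[of "u + s *\<^sub>R y" "v + t *\<^sub>R y"] that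
      by (simp add: algebra_simps)
    then have "directional_inf p y (u + v) - (p (v + t *\<^sub>R y) - t * p y) \<le> directional_inf p y u"
      if "0 \<le> t" for t
      using that by (intro gr) auto
    then have "directional_inf p y (u + v) - directional_inf p y u \<le> directional_inf p y v"
      by (intro gr) (simp add: algebra_simps)
    then show ?thesis by simp
  qed
  moreover have *: "c * directional_inf p y x \<le> directional_inf p y (c *\<^sub>R x)" if "0 < c" for c x
  proof (rule gr)
    fix t :: real assume "0 \<le> t"
    have "p (c *\<^sub>R x + t *\<^sub>R y) = p (c *\<^sub>R (x + (t / c) *\<^sub>R y))"
      using that by (simp add: scaleR_add_right)
    also have "\<dots> = c * p (x + (t / c) *\<^sub>R y)" using p that by (auto simp: sublinear_def)
    finally show "c * directional_inf p y x \<le> p (c *\<^sub>R x + t *\<^sub>R y) - t * p y"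
      using mult_left_mono[OF le[of "t / c" x], of c] that \<open>0 \<le> t\<close> by (simp add: algebra_simps)
  qed
  moreover have "directional_inf p y (c *\<^sub>R x) = c * directional_inf p y x" if "0 < c" for c x
    using *[OF that, of x] *[of "1 / c" "c *\<^sub>R x"] that by (simp add: field_simps)
  ultimately show "sublinear (directional_inf p y)" unfolding sublinear_def by blast
qed

lemma minimal_sublinear_below:
  fixes q :: "'a::real_vector \<Rightarrow> real"
  assumes q: "sublinear q"
  obtains p where "sublinear p" "p \<le> q" "\<And>r. sublinear r \<Longrightarrow> r \<le> p \<Longrightarrow> r = p"
proof -
  define A where "A = {p. sublinear p \<and> p \<le> q}"
  have "\<exists>m\<in>A. \<forall>a\<in>A. a \<le> m \<longrightarrow> a = m"
  proof (rule predicate_Zorn[where P = "\<lambda>a b. b \<le> a"])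
    show "partial_order_on A (relation_of (\<lambda>a b. b \<le> a) A)"
      by (rule partial_order_on_relation_ofI) auto
  next
    fix C assume "C \<in> Chains (relation_of (\<lambda>a b. b \<le> a) A)"
    then have CA: "C \<subseteq> A" and ch: "\<And>a b. a \<in> C \<Longrightarrow> b \<in> C \<Longrightarrow> a \<le> b \<or> b \<le> a"
      by (auto simp: Chains_def relation_of_def)
    show "\<exists>u\<in>A. \<forall>a\<in>C. u \<le> a"
    proof (cases "C = {}")
      case True
      then show ?thesis using q by (auto simp: A_def)
    next
      case False
      define u where "u = (\<lambda>x. INF a\<in>C. a x)"
      have sub: "sublinear a" "a \<le> q" if "a \<in> C" for a using CA that by (auto simp: A_def)
      have bdd: "bdd_below ((\<lambda>a. a x) ` C)" for x
      proof (rule bdd_belowI2)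
        fix a assume "a \<in> C"
        then show "- q (- x) \<le> a x"
          using sublinear_minus[OF sub(1), of a x] le_funD[OF sub(2), of a "- x"] by force
      qed
      have le: "u x \<le> a x" if "a \<in> C" for a x
        unfolding u_def using bdd that by (rule cINF_lower)
      have gr: "c \<le> u x" if "\<And>a. a \<in> C \<Longrightarrow> c \<le> a x" for c x
        unfolding u_def using False that by (rule cINF_greatest)
      have "u (x + y) \<le> u x + u y" for x y
      proof -
        have "u (x + y) - b y \<le> a x" if ab: "a \<in> C" "b \<in> C" for a b
        proof -
          obtain c where "c \<in> C" "c \<le> a" "c \<le> b"
            using ch[OF \<open>a \<in> C\<close> \<open>b \<in> C\<close>] ab order_refl by metis
          then have "c (x + y) \<le> c x + c y" "c x \<le> a x" "c y \<le> b y"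
            using sub by (auto simp: sublinear_def le_fun_def)
          then show ?thesis using le[OF \<open>c \<in> C\<close>, of "x + y"] by linarith
        qed
        then have "u (x + y) - b y \<le> u x" if "b \<in> C" for b using that by (intro gr) auto
        then have "u (x + y) - u x \<le> u y" by (intro gr) (simp add: algebra_simps)
        then show ?thesis by simp
      qed
      moreover have *: "c * u x \<le> u (c *\<^sub>R x)" if "0 < c" for c x
      proof (rule gr)
        fix a assume "a \<in> C"
        then show "c * u x \<le> a (c *\<^sub>R x)"
          using le[of a x] sub(1)[of a] that by (simp add: sublinear_def)
      qed
      moreover have "u (c *\<^sub>R x) = c * u x" if "0 < c" for c x
        using *[OF that, of x] *[of "1 / c" "c *\<^sub>R x"] that by (simp add: field_simps)
      ultimately have "sublinear u" unfolding sublinear_def by blast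
      moreover have "u \<le> q"
      proof -
        obtain a where "a \<in> C" using False by blast
        then show ?thesis using le[of a] sub(2)[of a] by (auto simp: le_fun_def intro: order_trans)
      qed
      ultimately show ?thesis using le by (auto simp: A_def le_fun_def)
    qed
  qed
  then obtain p where "p \<in> A" "\<And>a. a \<in> A \<Longrightarrow> a \<le> p \<Longrightarrow> a = p" by blast
  then show ?thesis by (intro that[of p]) (auto simp: A_def)
qed

text \<open>A minimal sublinear functional \<open>p\<close> coincides with each \<open>directional_inf p y\<close>, hence is
  linear.\<close>

lemma norming_functional:
  fixes a :: "'a::real_normed_vector"
  obtains \<xi> where "bounded_linear \<xi>" "\<And>x. \<bar>\<xi> x\<bar> \<le> norm x" "\<xi> a = norm a"
proof -
  have N: "sublinear (norm :: 'a \<Rightarrow> real)"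
    by (auto simp: sublinear_def norm_triangle_ineq)
  obtain p where p: "sublinear p" "p \<le> directional_inf norm a"
    and min: "\<And>r. sublinear r \<Longrightarrow> r \<le> p \<Longrightarrow> r = p"
    using minimal_sublinear_below[OF sublinear_directional_inf[OF N]] by blast
  have fix_p: "directional_inf p y = p" for y
    by (rule min[OF sublinear_directional_inf[OF p(1)]])
      (use directional_inf_le[OF p(1), of 0] in \<open>auto simp: le_fun_def\<close>)
  have add: "p (x + y) = p x + p y" for x y
  proof (rule antisym)
    show "p (x + y) \<le> p x + p y" using p(1) by (simp add: sublinear_def)
    show "p x + p y \<le> p (x + y)" using directional_inf_le[OF p(1), of 1 y x] by (simp add: fix_p)
  qed
  have le: "p x \<le> norm x" for x
    using le_funD[OF p(2), of x] directional_inf_le[OF N, of 0 a x] by simp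
  have neg: "p (- x) = - p x" for x
    using add[of x "- x"] sublinear_0[OF p(1)] by simp
  have abs: "\<bar>p x\<bar> \<le> norm x" for x
    using le[of x] le[of "- x"] by (simp add: neg)
  have scale: "p (c *\<^sub>R x) = c * p x" for c x
  proof (cases "0 \<le> c")
    case False
    then show ?thesis
      using sublinear_scale_nonneg[OF p(1), of "- c" x] neg[of "c *\<^sub>R x"] by simp
  qed (rule sublinear_scale_nonneg[OF p(1)])
  have "bounded_linear p"
    by (rule bounded_linear_intro[where K = 1]) (auto simp: add scale abs)
  moreover have "p (- a) \<le> - norm a"
    using le_funD[OF p(2), of "- a"] directional_inf_le[OF N, of 1 a "- a"] by simp
  then have "p a = norm a" using le[of a] by (simp add: neg)
  ultimately show ?thesis using abs that by blast
qed

section \<open>Smooth functions of finitely many linear functionals\<close>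

inductive_set smooth_algebra :: "('a::real_normed_vector \<Rightarrow> real) set \<Rightarrow> ('a \<Rightarrow> real) set"
  for L where
  const: "(\<lambda>x. c) \<in> smooth_algebra L"
| functional: "l \<in> L \<Longrightarrow> l \<in> smooth_algebra L"
| add: "u \<in> smooth_algebra L \<Longrightarrow> v \<in> smooth_algebra L \<Longrightarrow> (\<lambda>x. u x + v x) \<in> smooth_algebra L"
| mult: "u \<in> smooth_algebra L \<Longrightarrow> v \<in> smooth_algebra L \<Longrightarrow> (\<lambda>x. u x * v x) \<in> smooth_algebra L"
| exp: "u \<in> smooth_algebra L \<Longrightarrow> (\<lambda>x. exp (u x)) \<in> smooth_algebra L"
| inverse: "u \<in> smooth_algebra L \<Longrightarrow> (\<And>x. 0 < u x) \<Longrightarrow> (\<lambda>x. inverse (u x)) \<in> smooth_algebra L"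
| ln: "u \<in> smooth_algebra L \<Longrightarrow> (\<And>x. 0 < u x) \<Longrightarrow> (\<lambda>x. ln (u x)) \<in> smooth_algebra L"

lemma smooth_algebra_sum:
  assumes "\<And>i. i \<in> I \<Longrightarrow> u i \<in> smooth_algebra L"
  shows "(\<lambda>x. \<Sum>i\<in>I. u i x) \<in> smooth_algebra L"
  using assms
  by (induction I rule: infinite_finite_induct) (auto intro: smooth_algebra.intros)

lemma smooth_algebra_derivative:
  assumes "finite L" and L: "\<And>l. l \<in> L \<Longrightarrow> bounded_linear l" and "u \<in> smooth_algebra L"
  shows "\<exists>d. (\<forall>l\<in>L. d l \<in> smooth_algebra L) \<and>
    (\<forall>x. (u has_derivative (\<lambda>h. \<Sum>l\<in>L. l h * d l x)) (at x))"
  using assms(3)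
proof (induction u rule: smooth_algebra.induct)
  case (const c)
  show ?case by (rule exI[of _ "\<lambda>l x. 0"]) (auto intro: smooth_algebra.intros)
next
  case (functional l)
  have "(\<Sum>k\<in>L. k h * (if k = l then 1 else 0)) = l h" for h
    using functional assms(1) by (simp add: sum.delta if_distrib cong: if_cong)
  then show ?case
    using L[OF functional]
    by (intro exI[of _ "\<lambda>k x. if k = l then 1 else 0"])
      (auto intro: smooth_algebra.intros bounded_linear_imp_has_derivative)
next
  case (add u v)
  from add.IH obtain d e where IH:
    "\<forall>l\<in>L. d l \<in> smooth_algebra L" "\<And>x. (u has_derivative (\<lambda>h. \<Sum>l\<in>L. l h * d l x)) (at x)"
    "\<forall>l\<in>L. e l \<in> smooth_algebra L" "\<And>x. (v has_derivative (\<lambda>h. \<Sum>l\<in>L. l h * e l x)) (at x)"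
    by blast
  show ?case
    by (rule exI[of _ "\<lambda>l x. d l x + e l x"])
      (use IH in \<open>auto intro!: smooth_algebra.add derivative_eq_intros
        simp: sum.distrib algebra_simps\<close>)
next
  case (mult u v)
  from mult.IH obtain d e where IH:
    "\<forall>l\<in>L. d l \<in> smooth_algebra L" "\<And>x. (u has_derivative (\<lambda>h. \<Sum>l\<in>L. l h * d l x)) (at x)"
    "\<forall>l\<in>L. e l \<in> smooth_algebra L" "\<And>x. (v has_derivative (\<lambda>h. \<Sum>l\<in>L. l h * e l x)) (at x)"
    by blast
  show ?case
    by (rule exI[of _ "\<lambda>l x. u x * e l x + d l x * v x"])
      (use IH mult.hyps in \<open>auto intro!: smooth_algebra.add smooth_algebra.mult derivative_eq_intros
        simp: sum.distrib sum_distrib_left algebra_simps\<close>)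
next
  case (exp u)
  from exp.IH obtain d where IH:
    "\<forall>l\<in>L. d l \<in> smooth_algebra L" "\<And>x. (u has_derivative (\<lambda>h. \<Sum>l\<in>L. l h * d l x)) (at x)"
    by blast
  show ?case
    by (rule exI[of _ "\<lambda>l x. exp (u x) * d l x"])
      (use IH exp.hyps in \<open>auto intro!: smooth_algebra.exp smooth_algebra.mult derivative_eq_intros
        simp: sum_distrib_left algebra_simps\<close>)
next
  case (inverse u)
  from inverse.IH obtain d where IH:
    "\<forall>l\<in>L. d l \<in> smooth_algebra L" "\<And>x. (u has_derivative (\<lambda>h. \<Sum>l\<in>L. l h * d l x)) (at x)"
    by blast
  have nz: "u x \<noteq> 0" for x using inverse.hyps(2)[of x] by simp
  show ?case
  proof (intro exI[of _ "\<lambda>l x. (-1) * (inverse (u x) * inverse (u x)) * d l x"] conjI ballI allI)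
    show "(\<lambda>x. (-1) * (inverse (u x) * inverse (u x)) * d l x) \<in> smooth_algebra L" if "l \<in> L" for l
      by (intro smooth_algebra.mult smooth_algebra.const smooth_algebra.inverse inverse.hyps)
        (use IH that in auto)
    show "((\<lambda>x. inverse (u x)) has_derivative
      (\<lambda>h. \<Sum>l\<in>L. l h * ((-1) * (inverse (u x) * inverse (u x)) * d l x))) (at x)" for x
      using DERIV_compose_FDERIV[OF DERIV_inverse[OF nz] IH(2), of x]
      by (simp add: sum_distrib_left sum_negf power2_eq_square algebra_simps)
  qed
next
  case (ln u)
  from ln.IH obtain d where IH:
    "\<forall>l\<in>L. d l \<in> smooth_algebra L" "\<And>x. (u has_derivative (\<lambda>h. \<Sum>l\<in>L. l h * d l x)) (at x)"
    by blast
  show ?case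
  proof (intro exI[of _ "\<lambda>l x. inverse (u x) * d l x"] conjI ballI allI)
    show "(\<lambda>x. inverse (u x) * d l x) \<in> smooth_algebra L" if "l \<in> L" for l
      by (intro smooth_algebra.mult smooth_algebra.inverse ln.hyps) (use IH that in auto)
    show "((\<lambda>x. ln (u x)) has_derivative (\<lambda>h. \<Sum>l\<in>L. l h * (inverse (u x) * d l x))) (at x)" for x
      using DERIV_compose_FDERIV[OF DERIV_ln[OF ln.hyps(2)] IH(2), of x]
      by (simp add: sum_distrib_left algebra_simps)
  qed
qed

text \<open>\<open>iterated_diff L d u [v\<^sub>1, \<dots>, v\<^sub>k]\<close> differentiates \<open>u\<close> first in direction \<open>v\<^sub>1\<close> and last in
  direction \<open>v\<^sub>k\<close>, where \<open>d w l\<close> is the partial derivative of \<open>w\<close> along \<open>l\<close>; the \<open>D k x\<close> of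
  \<^const>\<open>Cinfty\<close> lists the directions in the opposite order.\<close>

fun iterated_diff :: "('a::real_normed_vector \<Rightarrow> real) set \<Rightarrow>
    (('a \<Rightarrow> real) \<Rightarrow> ('a \<Rightarrow> real) \<Rightarrow> 'a \<Rightarrow> real) \<Rightarrow> ('a \<Rightarrow> real) \<Rightarrow> 'a list \<Rightarrow> 'a \<Rightarrow> real" where
  "iterated_diff L d u [] x = u x"
| "iterated_diff L d u (v # vs) x = (\<Sum>l\<in>L. l v * iterated_diff L d (d u l) vs x)"

lemma prod_list_norm_nonneg: "0 \<le> prod_list (map norm (vs :: 'a::real_normed_vector list))"
  by (induction vs) auto

lemma prod_list_norm_rev:
  "prod_list (map norm (rev vs)) = prod_list (map norm (vs :: 'a::real_normed_vector list))"
  by (induction vs) (auto simp: ac_simps)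

lemma smooth_algebra_Cinfty:
  fixes u :: "'a::real_normed_vector \<Rightarrow> real"
  assumes fin: "finite L" and L: "\<And>l. l \<in> L \<Longrightarrow> bounded_linear l" and u: "u \<in> smooth_algebra L"
  shows "u \<in> Cinfty UNIV"
proof -
  obtain d where d: "\<And>w l. w \<in> smooth_algebra L \<Longrightarrow> l \<in> L \<Longrightarrow> d w l \<in> smooth_algebra L"
    "\<And>w x. w \<in> smooth_algebra L \<Longrightarrow> (w has_derivative (\<lambda>h. \<Sum>l\<in>L. l h * d w l x)) (at x)"
  proof -
    have "\<forall>w. \<exists>d. w \<in> smooth_algebra L \<longrightarrow> (\<forall>l\<in>L. d l \<in> smooth_algebra L) \<and>
        (\<forall>x. (w has_derivative (\<lambda>h. \<Sum>l\<in>L. l h * d l x)) (at x))"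
      using smooth_algebra_derivative[OF fin L] by blast
    from choice[OF this] show ?thesis using that by blast
  qed
  let ?E = "iterated_diff L d"
  have "\<exists>K. \<forall>l\<in>L. \<forall>x. \<bar>l x\<bar> \<le> K * norm x"
  proof -
    have "\<exists>K. \<forall>x. \<bar>l x\<bar> \<le> K * norm x" if "l \<in> L" for l
      using bounded_linear.bounded[OF L[OF that]] by (auto simp: mult.commute)
    then obtain K where K: "\<bar>l x\<bar> \<le> K l * norm x" if "l \<in> L" for l x by metis
    have "\<bar>l x\<bar> \<le> (\<Sum>k\<in>L. \<bar>K k\<bar>) * norm x" if "l \<in> L" for l x
    proof -
      have "K l \<le> (\<Sum>k\<in>L. \<bar>K k\<bar>)"
        using member_le_sum[OF that, of "\<lambda>k. \<bar>K k\<bar>"] fin by simp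
      then show ?thesis using K[OF that, of x] by (meson mult_right_mono norm_ge_zero order_trans)
    qed
    then show ?thesis by blast
  qed
  then obtain K0 where K0: "\<And>l x. l \<in> L \<Longrightarrow> \<bar>l x\<bar> \<le> K0 * norm x" by blast
  define K where "K = \<bar>K0\<bar>"
  have K: "0 \<le> K" and lK: "\<And>l x. l \<in> L \<Longrightarrow> \<bar>l x\<bar> \<le> K * norm x"
    using K0 by (auto simp: K_def) (meson abs_ge_self mult_right_mono norm_ge_zero order_trans)
  have bound: "\<exists>C\<ge>0. \<forall>vs. length vs = k \<longrightarrow> \<bar>?E w vs x\<bar> \<le> C * prod_list (map norm vs)" for k w x
  proof (induction k arbitrary: w)
    case 0
    show ?case by (intro exI[of _ "\<bar>w x\<bar>"]) auto
  next
    case (Suc k)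
    then obtain C where C: "\<And>w. 0 \<le> C w"
      "\<And>w vs. length vs = k \<Longrightarrow> \<bar>?E w vs x\<bar> \<le> C w * prod_list (map norm vs)"
      by metis
    have "\<bar>?E w vs x\<bar> \<le> (\<Sum>l\<in>L. K * C (d w l)) * prod_list (map norm vs)"
      if len: "length vs = Suc k" for vs
    proof -
      obtain v vs' where vs: "vs = v # vs'" "length vs' = k" using len by (cases vs) auto
      have "\<bar>?E w vs x\<bar> \<le> (\<Sum>l\<in>L. \<bar>l v * ?E (d w l) vs' x\<bar>)"
        unfolding vs iterated_diff.simps by (rule sum_abs)
      also have "\<dots> \<le> (\<Sum>l\<in>L. (K * norm v) * (C (d w l) * prod_list (map norm vs')))"
        unfolding abs_mult using lK C(1) C(2)[OF vs(2)] K
        by (intro sum_mono mult_mono) auto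
      finally show ?thesis by (simp add: vs sum_distrib_right sum_distrib_left algebra_simps)
    qed
    then show ?case using K C(1) by (intro exI[of _ "\<Sum>l\<in>L. K * C (d w l)"]) (auto intro!: sum_nonneg)
  qed
  have multilinear: "?E w (vs[i := a + b]) x = ?E w (vs[i := a]) x + ?E w (vs[i := b]) x \<and>
      ?E w (vs[i := c *\<^sub>R a]) x = c * ?E w (vs[i := a]) x" if "i < length vs" for w vs i a b c x
    using that
  proof (induction vs arbitrary: w i)
    case (Cons v vs)
    show ?case
    proof (cases i)
      case 0
      have lin: "l (a + b) = l a + l b" "l (c *\<^sub>R a) = c * l a" if "l \<in> L" for l
        using L[OF that] by (auto simp: bounded_linear.linear linear_add linear_scale)
      have "(\<Sum>l\<in>L. l (a + b) * F l) = (\<Sum>l\<in>L. l a * F l) + (\<Sum>l\<in>L. l b * F l)" for F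
        unfolding sum.distrib[symmetric] by (intro sum.cong refl) (metis distrib_right lin(1))
      moreover have "(\<Sum>l\<in>L. l (c *\<^sub>R a) * F l) = c * (\<Sum>l\<in>L. l a * F l)" for F
        unfolding sum_distrib_left by (intro sum.cong refl) (metis mult.assoc lin(2))
      ultimately show ?thesis using 0 by simp
    next
      case (Suc j)
      then have "j < length vs" using Cons.prems by simp
      from Cons.IH[OF this] show ?thesis using Suc
        by (auto simp: sum.distrib[symmetric] sum_distrib_left algebra_simps intro!: sum.cong)
    qed
  qed auto
  have deriv: "\<exists>\<delta>>0. \<forall>h. norm h < \<delta> \<longrightarrow> (\<forall>vs. length vs = k \<longrightarrow>
      \<bar>?E w vs (x + h) - ?E w vs x - ?E w (vs @ [h]) x\<bar> \<le> e * norm h * prod_list (map norm vs))"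
    if "w \<in> smooth_algebra L" "0 < e" for k w x e
    using that
  proof (induction k arbitrary: w e)
    case 0
    have "(w has_derivative (\<lambda>h. \<Sum>l\<in>L. l h * d w l x)) (at x within UNIV)"
      using d(2)[OF 0(1), of x] by simp
    then obtain \<delta> where \<delta>: "0 < \<delta>"
      "\<And>y. norm (y - x) < \<delta> \<Longrightarrow>
        norm (w y - w x - (\<Sum>l\<in>L. l (y - x) * d w l x)) \<le> e * norm (y - x)"
      unfolding has_derivative_within_alt using 0(2) by blast
    show ?case using \<delta>(1) \<delta>(2)[of "x + _"] by (intro exI[of _ \<delta>]) auto
  next
    case (Suc k)
    define e' where "e' = e / (1 + real (card L) * K)"
    have pos: "0 < 1 + real (card L) * K" using K by (simp add: add_pos_nonneg)
    have e': "0 < e'" using pos Suc.prems by (simp add: e'_def)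
    have "\<forall>l\<in>L. \<exists>\<delta>>0. \<forall>h. norm h < \<delta> \<longrightarrow> (\<forall>vs. length vs = k \<longrightarrow>
      \<bar>?E (d w l) vs (x + h) - ?E (d w l) vs x - ?E (d w l) (vs @ [h]) x\<bar>
        \<le> e' * norm h * prod_list (map norm vs))"
      using Suc.IH d(1)[OF Suc.prems(1)] e' by blast
    then obtain \<delta> where \<delta>: "\<And>l. l \<in> L \<Longrightarrow> 0 < \<delta> l"
      "\<And>l h vs. l \<in> L \<Longrightarrow> norm h < \<delta> l \<Longrightarrow> length vs = k \<Longrightarrow>
      \<bar>?E (d w l) vs (x + h) - ?E (d w l) vs x - ?E (d w l) (vs @ [h]) x\<bar>
        \<le> e' * norm h * prod_list (map norm vs)"
      by metis
    define \<delta>0 where "\<delta>0 = Min (insert 1 (\<delta> ` L))"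
    have \<delta>0: "0 < \<delta>0" "\<And>l. l \<in> L \<Longrightarrow> \<delta>0 \<le> \<delta> l"
      using fin \<delta>(1) by (auto simp: \<delta>0_def)
    have "\<bar>?E w vs (x + h) - ?E w vs x - ?E w (vs @ [h]) x\<bar> \<le> e * norm h * prod_list (map norm vs)"
      if h: "norm h < \<delta>0" and len: "length vs = Suc k" for h vs
    proof -
      obtain v vs' where vs: "vs = v # vs'" "length vs' = k" using len by (cases vs) auto
      have "\<bar>?E w vs (x + h) - ?E w vs x - ?E w (vs @ [h]) x\<bar> =
        \<bar>\<Sum>l\<in>L. l v * (?E (d w l) vs' (x + h) - ?E (d w l) vs' x - ?E (d w l) (vs' @ [h]) x)\<bar>"
        by (simp add: vs sum_subtractf[symmetric] algebra_simps)
      also have "\<dots> \<le> (\<Sum>l\<in>L. \<bar>l v * (?E (d w l) vs' (x + h) - ?E (d w l) vs' x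
          - ?E (d w l) (vs' @ [h]) x)\<bar>)"
        by (rule sum_abs)
      also have "\<dots> \<le> (\<Sum>l\<in>L. (K * norm v) * (e' * norm h * prod_list (map norm vs')))"
        unfolding abs_mult using lK K \<delta>(2)[OF _ less_le_trans[OF h \<delta>0(2)] vs(2)]
        by (intro sum_mono mult_mono) auto
      also have "\<dots> = (real (card L) * K * e') * (norm h * prod_list (map norm vs))"
        by (simp add: vs)
      also have "\<dots> \<le> e * (norm h * prod_list (map norm vs))"
      proof (intro mult_right_mono mult_nonneg_nonneg prod_list_norm_nonneg norm_ge_zero)
        show "real (card L) * K * e' \<le> e"
          using pos Suc.prems K by (simp add: e'_def field_simps)
      qed
      finally show ?thesis by (simp add: mult.assoc)
    qed
    then show ?case using \<delta>0(1) by blast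
  qed
  show ?thesis
    unfolding Cinfty_def mem_Collect_eq
  proof (intro exI[of _ "\<lambda>k x vs. ?E u (rev vs) x"] conjI allI ballI impI)
    show "?E u (rev []) x = u x" for x by simp
  next
    fix k x
    have rev_upd: "rev (vs[i := a]) = (rev vs)[length vs - Suc i := a]" if "i < length vs" for vs i
      and a :: 'a
      using that by (simp add: rev_update)
    obtain C where "\<forall>vs. length vs = k \<longrightarrow> \<bar>?E u vs x\<bar> \<le> C * prod_list (map norm vs)"
      using bound by blast
    then have "\<bar>?E u (rev vs) x\<bar> \<le> C * prod_list (map norm vs)" if "vs \<in> tuples UNIV k" for vs
      using that prod_list_norm_rev[of vs] unfolding tuples_def
      by (metis (mono_tags, lifting) length_rev mem_Collect_eq)
    then show "bounded_multilinear_on UNIV k (\<lambda>vs. ?E u (rev vs) x)"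
      unfolding bounded_multilinear_on_def
      using multilinear by (auto simp: tuples_def rev_upd)
  next
    fix k x and e :: real
    assume "0 < e"
    from deriv[OF u this, of k x] obtain \<delta> where "0 < \<delta>"
      "\<And>h vs. norm h < \<delta> \<Longrightarrow> length vs = k \<Longrightarrow>
        \<bar>?E u vs (x + h) - ?E u vs x - ?E u (vs @ [h]) x\<bar> \<le> e * norm h * prod_list (map norm vs)"
      by blast
    then show "\<exists>\<delta>>0. \<forall>h\<in>UNIV. norm h < \<delta> \<longrightarrow> (\<forall>vs\<in>tuples UNIV k.
        \<bar>?E u (rev vs) (x + h) - ?E u (rev vs) x - ?E u (rev (h # vs)) x\<bar>
          \<le> e * norm h * prod_list (map norm vs))"
      by (intro exI[of _ \<delta>]) (auto simp: tuples_def, metis length_rev prod_list_norm_rev)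
  qed
qed

section \<open>Soft minima of soft maxima\<close>

text \<open>\<open>W\<close> is the soft minimum, at temperature \<open>\<tau>\<close>, of the constant \<open>C\<close> and of the functions
  \<open>\<tau> * ln (S y x)\<close>, which are the soft maxima of the constant \<open>b y\<close> and of the \<open>A y j\<close>.\<close>

locale soft_minmax =
  fixes \<tau> C :: real and Y :: "'y set" and J :: "'j set" and b :: "'y \<Rightarrow> real"
    and A :: "'y \<Rightarrow> 'j \<Rightarrow> 'x::real_normed_vector \<Rightarrow> real" and \<phi> :: "'y \<Rightarrow> 'j \<Rightarrow> 'x \<Rightarrow> real"
  assumes \<tau>: "0 < \<tau>" and finY: "finite Y" and finJ: "finite J"
    and A_deriv: "\<And>y j x. (A y j has_derivative \<phi> y j) (at x)"
begin

definition S :: "'y \<Rightarrow> 'x \<Rightarrow> real" where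
  "S y x = exp (b y / \<tau>) + (\<Sum>j\<in>J. exp (A y j x / \<tau>))"

definition Z :: "'x \<Rightarrow> real" where
  "Z x = exp (- C / \<tau>) + (\<Sum>y\<in>Y. inverse (S y x))"

definition W :: "'x \<Rightarrow> real" where
  "W x = - \<tau> * ln (Z x)"

definition wt :: "'y \<Rightarrow> 'j \<Rightarrow> 'x \<Rightarrow> real" where
  "wt y j x = exp (A y j x / \<tau>) * inverse (S y x) * (inverse (S y x) * inverse (Z x))"

lemma S_ge: "exp (b y / \<tau>) \<le> S y x"
  by (simp add: S_def sum_nonneg)

lemma S_ge_exp: "j \<in> J \<Longrightarrow> exp (A y j x / \<tau>) \<le> S y x"
  using member_le_sum[of j J "\<lambda>j. exp (A y j x / \<tau>)"] finJ
  by (simp add: S_def add_increasing)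

lemma S_pos: "0 < S y x"
  using S_ge[of y x] less_le_trans[OF exp_gt_zero] by blast

lemma S_le:
  assumes "b y \<le> U" "\<And>j. j \<in> J \<Longrightarrow> A y j x \<le> U"
  shows "\<tau> * ln (S y x) \<le> U + \<tau> * ln (1 + card J)"
proof -
  have "S y x \<le> exp (U / \<tau>) + (\<Sum>j\<in>J. exp (U / \<tau>))"
    unfolding S_def using assms \<tau> by (intro add_mono sum_mono) (auto simp: divide_right_mono)
  also have "\<dots> = (1 + card J) * exp (U / \<tau>)" by (simp add: algebra_simps)
  finally have "ln (S y x) \<le> ln ((1 + card J) * exp (U / \<tau>))"
    using S_pos by (subst ln_le_cancel_iff) (auto intro!: mult_pos_pos)
  also have "\<dots> = ln (1 + card J) + U / \<tau>" by (subst ln_mult) auto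
  finally have "\<tau> * ln (S y x) \<le> \<tau> * (ln (1 + card J) + U / \<tau>)" using \<tau> by simp
  then show ?thesis using \<tau> by (simp add: algebra_simps)
qed

lemma Z_ge: "exp (- C / \<tau>) \<le> Z x"
  using S_pos by (simp add: Z_def sum_nonneg less_imp_le)

lemma Z_ge_inverse: "y \<in> Y \<Longrightarrow> inverse (S y x) \<le> Z x"
  using member_le_sum[of y Y "\<lambda>y. inverse (S y x)"] finY S_pos
  by (simp add: Z_def add_increasing less_imp_le)

lemma Z_pos: "0 < Z x"
  using Z_ge[of x] less_le_trans[OF exp_gt_zero] by blast

lemma exp_W: "exp (W x / \<tau>) = inverse (Z x)"
  using \<tau> Z_pos[of x] by (simp add: W_def exp_minus)

lemma W_le_C: "W x \<le> C"
proof -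
  have "- C / \<tau> \<le> ln (Z x)" using Z_ge Z_pos by (simp add: ln_ge_iff)
  then show ?thesis using \<tau> by (simp add: W_def field_simps)
qed

lemma W_le:
  assumes "y \<in> Y"
  shows "W x \<le> \<tau> * ln (S y x)"
proof -
  have "ln (inverse (S y x)) \<le> ln (Z x)"
    using Z_ge_inverse[OF assms, of x] S_pos Z_pos by (subst ln_le_cancel_iff) auto
  then have "- ln (S y x) \<le> ln (Z x)" using S_pos by (simp add: ln_inverse)
  then have "\<tau> * - ln (S y x) \<le> \<tau> * ln (Z x)" using \<tau> by (intro mult_left_mono) auto
  then show ?thesis by (simp add: W_def)
qed

lemma W_ge:
  assumes "m \<le> C" "\<And>y. y \<in> Y \<Longrightarrow> exp (m / \<tau>) \<le> S y x"
  shows "m - \<tau> * ln (1 + card Y) \<le> W x"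
proof -
  have "Z x \<le> exp (- m / \<tau>) + (\<Sum>y\<in>Y. exp (- m / \<tau>))"
    unfolding Z_def
  proof (intro add_mono sum_mono)
    show "exp (- C / \<tau>) \<le> exp (- m / \<tau>)" using assms(1) \<tau> by (simp add: divide_right_mono)
    show "inverse (S y x) \<le> exp (- m / \<tau>)" if "y \<in> Y" for y
      using le_imp_inverse_le[OF assms(2)[OF that]] by (simp add: exp_minus)
  qed
  also have "\<dots> = (1 + card Y) * exp (- m / \<tau>)" by (simp add: algebra_simps)
  finally have "ln (Z x) \<le> ln ((1 + card Y) * exp (- m / \<tau>))"
    using Z_pos by (subst ln_le_cancel_iff) (auto intro!: mult_pos_pos)
  also have "\<dots> = ln (1 + card Y) - m / \<tau>" by (subst ln_mult) auto
  finally have "\<tau> * ln (Z x) \<le> \<tau> * (ln (1 + card Y) - m / \<tau>)" using \<tau> by simp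
  then show ?thesis using \<tau> by (simp add: W_def algebra_simps)
qed

lemma wt_nonneg: "0 \<le> wt y j x"
  using S_pos[of y x] Z_pos[of x] by (simp add: wt_def less_imp_le)

lemma inverse_S_Z_le_1: "y \<in> Y \<Longrightarrow> inverse (S y x) * inverse (Z x) \<le> 1"
  using mult_right_mono[OF Z_ge_inverse[of y x], of "inverse (Z x)"] Z_pos[of x] by simp

lemma wt_le_exp_A:
  assumes "y \<in> Y"
  shows "wt y j x \<le> exp ((A y j x - b y) / \<tau>)"
proof -
  have "exp (A y j x / \<tau>) * inverse (S y x) \<le> exp (A y j x / \<tau>) * inverse (exp (b y / \<tau>))"
    using le_imp_inverse_le[OF S_ge] by (intro mult_left_mono) auto
  also have "\<dots> = exp ((A y j x - b y) / \<tau>)"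
    by (simp add: exp_minus[symmetric] exp_add[symmetric] diff_divide_distrib)
  finally have "wt y j x \<le> exp ((A y j x - b y) / \<tau>) * 1"
    unfolding wt_def using inverse_S_Z_le_1[OF assms, of x] S_pos[of y x] Z_pos[of x]
    by (intro mult_mono) (auto simp: less_imp_le)
  then show ?thesis by simp
qed

lemma wt_le_exp_W:
  assumes "j \<in> J" "exp (M / \<tau>) \<le> S y x"
  shows "wt y j x \<le> exp ((W x - M) / \<tau>)"
proof -
  have "inverse (S y x) * inverse (Z x) \<le> exp (- M / \<tau>) * exp (W x / \<tau>)"
    unfolding exp_W using le_imp_inverse_le[OF assms(2)] Z_pos[of x]
    by (intro mult_right_mono) (auto simp: exp_minus less_imp_le)
  also have "\<dots> = exp ((W x - M) / \<tau>)" by (simp add: exp_add[symmetric] diff_divide_distrib)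
  finally have "wt y j x \<le> 1 * exp ((W x - M) / \<tau>)"
    unfolding wt_def using S_ge_exp[OF assms(1), of y x] S_pos[of y x] Z_pos[of x]
    by (intro mult_mono) (auto simp: field_simps)
  then show ?thesis by simp
qed

lemma sum_wt_le_1: "(\<Sum>y\<in>Y. \<Sum>j\<in>J. wt y j x) \<le> 1"
proof -
  have "(\<Sum>j\<in>J. wt y j x) \<le> inverse (S y x) * inverse (Z x)" for y
  proof -
    have "(\<Sum>j\<in>J. exp (A y j x / \<tau>)) * inverse (S y x) \<le> 1"
      using S_pos[of y x] by (simp add: S_def field_simps)
    then have "((\<Sum>j\<in>J. exp (A y j x / \<tau>)) * inverse (S y x)) * (inverse (S y x) * inverse (Z x))
        \<le> 1 * (inverse (S y x) * inverse (Z x))"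
      using S_pos[of y x] Z_pos[of x] by (intro mult_right_mono) (auto simp: less_imp_le)
    then show ?thesis by (simp add: wt_def sum_distrib_right)
  qed
  then have "(\<Sum>y\<in>Y. \<Sum>j\<in>J. wt y j x) \<le> (\<Sum>y\<in>Y. inverse (S y x) * inverse (Z x))"
    by (rule sum_mono)
  also have "\<dots> = (\<Sum>y\<in>Y. inverse (S y x)) * inverse (Z x)" by (simp add: sum_distrib_right)
  also have "\<dots> \<le> 1" using Z_pos[of x] by (simp add: Z_def field_simps)
  finally show ?thesis .
qed

definition W' :: "'x \<Rightarrow> 'x \<Rightarrow> real" where
  "W' x h = (\<Sum>y\<in>Y. \<Sum>j\<in>J. wt y j x * \<phi> y j h)"

lemma W_has_derivative: "(W has_derivative W' x) (at x)"
proof -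
  have E: "((\<lambda>x. exp (A y j x / \<tau>)) has_derivative (\<lambda>h. (\<phi> y j h / \<tau>) * exp (A y j x / \<tau>))) (at x)"
    for y j
    using DERIV_compose_FDERIV[OF DERIV_exp bounded_linear.has_derivative[OF
      bounded_linear_divide[of \<tau>] A_deriv]] .
  have "(S y has_derivative (\<lambda>h. \<Sum>j\<in>J. (\<phi> y j h / \<tau>) * exp (A y j x / \<tau>))) (at x)" for y
    unfolding S_def[abs_def] by (rule has_derivative_eq_rhs, (rule derivative_intros E)+) auto
  then have I: "((\<lambda>x. inverse (S y x)) has_derivative
      (\<lambda>h. (\<Sum>j\<in>J. (\<phi> y j h / \<tau>) * exp (A y j x / \<tau>)) * - (inverse (S y x) ^ Suc (Suc 0)))) (at x)"
    for y
    using DERIV_compose_FDERIV[where f = inverse and g = "S y" and x = x and s = UNIV, OF DERIV_inverse[of "S y x"]]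
      S_pos[of y x] by auto
  have "(Z has_derivative (\<lambda>h. \<Sum>y\<in>Y. (\<Sum>j\<in>J. (\<phi> y j h / \<tau>) * exp (A y j x / \<tau>)) *
      - (inverse (S y x) ^ Suc (Suc 0)))) (at x)"
    unfolding Z_def[abs_def] by (rule has_derivative_eq_rhs, (rule derivative_intros I)+) auto
  then have "((\<lambda>x. ln (Z x)) has_derivative (\<lambda>h. (\<Sum>y\<in>Y. (\<Sum>j\<in>J. (\<phi> y j h / \<tau>) * exp (A y j x / \<tau>)) *
      - (inverse (S y x) ^ Suc (Suc 0))) * inverse (Z x))) (at x)"
    using DERIV_compose_FDERIV[where f = ln and g = Z and x = x and s = UNIV, OF DERIV_ln[of "Z x"]]
      Z_pos[of x] by auto
  then have "(W has_derivative (\<lambda>h. - \<tau> * ((\<Sum>y\<in>Y. (\<Sum>j\<in>J. (\<phi> y j h / \<tau>) * exp (A y j x / \<tau>)) *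
      - (inverse (S y x) ^ Suc (Suc 0))) * inverse (Z x)))) (at x)"
    unfolding W_def[abs_def] by (rule has_derivative_mult_right)
  moreover have "- \<tau> * ((\<Sum>y\<in>Y. (\<Sum>j\<in>J. (\<phi> y j h / \<tau>) * exp (A y j x / \<tau>)) *
      - (inverse (S y x) ^ Suc (Suc 0))) * inverse (Z x)) = W' x h" for h
    using \<tau> by (simp add: W'_def wt_def sum_distrib_left sum_distrib_right sum_negf[symmetric] mult_ac)
  ultimately show ?thesis by simp
qed

lemma W'_le:
  assumes "\<And>y j h. y \<in> Y \<Longrightarrow> j \<in> J \<Longrightarrow> wt y j x * \<bar>\<phi> y j h\<bar> \<le> c y j * norm h"
    and "\<And>y j. y \<in> Y \<Longrightarrow> j \<in> J \<Longrightarrow> 0 \<le> c y j"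
  shows "onorm (W' x) \<le> (\<Sum>y\<in>Y. \<Sum>j\<in>J. c y j)"
proof (rule onorm_bound)
  show "0 \<le> (\<Sum>y\<in>Y. \<Sum>j\<in>J. c y j)" using assms(2) by (intro sum_nonneg)
  fix h
  have "\<bar>W' x h\<bar> \<le> (\<Sum>y\<in>Y. \<Sum>j\<in>J. \<bar>wt y j x * \<phi> y j h\<bar>)"
    unfolding W'_def by (intro order_trans[OF sum_abs] sum_mono sum_abs)
  also have "\<dots> \<le> (\<Sum>y\<in>Y. \<Sum>j\<in>J. c y j * norm h)"
    using assms wt_nonneg by (intro sum_mono) (auto simp: abs_mult)
  finally show "norm (W' x h) \<le> (\<Sum>y\<in>Y. \<Sum>j\<in>J. c y j) * norm h"
    by (simp add: sum_distrib_right)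
qed

lemma W'_bounded:
  assumes "\<And>y j h. y \<in> Y \<Longrightarrow> j \<in> J \<Longrightarrow> \<bar>\<phi> y j h\<bar> \<le> \<Lambda> * norm h" "0 \<le> \<Lambda>"
  shows "onorm (W' x) \<le> \<Lambda>"
proof -
  have "onorm (W' x) \<le> (\<Sum>y\<in>Y. \<Sum>j\<in>J. wt y j x * \<Lambda>)"
  proof (rule W'_le)
    show "wt y j x * \<bar>\<phi> y j h\<bar> \<le> wt y j x * \<Lambda> * norm h" if "y \<in> Y" "j \<in> J" for y j h
      using mult_left_mono[OF assms(1)[OF that, of h] wt_nonneg] by (simp add: mult.assoc)
  qed (use assms(2) wt_nonneg in auto)
  also have "\<dots> = (\<Sum>y\<in>Y. \<Sum>j\<in>J. wt y j x) * \<Lambda>" by (simp add: sum_distrib_right)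
  also have "\<dots> \<le> \<Lambda>" using mult_right_mono[OF sum_wt_le_1 assms(2)] by simp
  finally show ?thesis .
qed

lemma isCont_A: "isCont (A y j) x"
  by (rule has_derivative_continuous[OF A_deriv])

lemma isCont_wt: "isCont (wt y j) x"
proof -
  have "isCont (S y) x" for y
    unfolding S_def[abs_def] using \<tau> by (intro continuous_intros isCont_A) auto
  moreover from this have "isCont Z x"
    unfolding Z_def[abs_def] using S_pos by (intro continuous_intros) (auto simp: less_imp_neq[symmetric])
  ultimately show ?thesis
    unfolding wt_def[abs_def] using \<tau> S_pos Z_pos
    by (intro continuous_intros isCont_A) (auto simp: less_imp_neq[symmetric])
qed

lemma W'_upper_semicontinuous:
  assumes "0 < e"
  shows "\<exists>r>0. \<forall>z\<in>ball x r. onorm (W' z) \<le> onorm (W' x) + e"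
proof -
  have bl: "bounded_linear (\<phi> y j)" for y j using A_deriv has_derivative_bounded_linear by blast
  have blW: "bounded_linear (W' z)" for z using W_has_derivative has_derivative_bounded_linear by blast
  define q where "q z = (\<Sum>y\<in>Y. \<Sum>j\<in>J. \<bar>wt y j z - wt y j x\<bar> * onorm (\<phi> y j))" for z
  have "isCont q x" unfolding q_def by (intro continuous_intros isCont_wt)
  moreover have "q x = 0" by (simp add: q_def)
  ultimately obtain r where r: "0 < r" "\<And>z. dist z x < r \<Longrightarrow> \<bar>q z\<bar> < e"
    using assms unfolding continuous_at_eps_delta by (force simp: dist_real_def)
  have "onorm (W' z) \<le> onorm (W' x) + q z" for z
  proof (rule onorm_bound)
    show "0 \<le> onorm (W' x) + q z"
      unfolding q_def using bl blW
      by (intro add_nonneg_nonneg sum_nonneg mult_nonneg_nonneg onorm_pos_le) auto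
    fix h
    have "W' z h = W' x h + (\<Sum>y\<in>Y. \<Sum>j\<in>J. (wt y j z - wt y j x) * \<phi> y j h)"
      by (simp add: W'_def sum.distrib[symmetric] algebra_simps)
    moreover have "\<bar>W' x h\<bar> \<le> onorm (W' x) * norm h" using onorm[OF blW, of x h] by simp
    moreover have "\<bar>\<Sum>y\<in>Y. \<Sum>j\<in>J. (wt y j z - wt y j x) * \<phi> y j h\<bar> \<le>
        (\<Sum>y\<in>Y. \<Sum>j\<in>J. \<bar>(wt y j z - wt y j x) * \<phi> y j h\<bar>)"
      by (intro order_trans[OF sum_abs] sum_mono sum_abs)
    moreover have "\<dots> \<le> (\<Sum>y\<in>Y. \<Sum>j\<in>J. \<bar>wt y j z - wt y j x\<bar> * (onorm (\<phi> y j) * norm h))"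
      unfolding abs_mult using onorm[OF bl] by (intro sum_mono mult_left_mono) auto
    moreover have "\<dots> = q z * norm h" by (simp add: q_def sum_distrib_right mult.assoc)
    ultimately show "norm (W' z h) \<le> (onorm (W' x) + q z) * norm h"
      by (simp add: algebra_simps)
  qed
  moreover have "q z \<le> e" if "z \<in> ball x r" for z
    using r(2)[of z] that by (simp add: dist_commute)
  ultimately show ?thesis using r(1) by (meson add_left_mono order_trans)
qed

end

definition unit_seq :: "nat \<Rightarrow> (nat \<Rightarrow>\<^sub>C real)" where
  "unit_seq n = Bcontfun (\<lambda>i. if i = n then 1 else 0)"

lemma unit_seq_apply: "unit_seq n i = (if i = n then 1 else 0)"
proof -
  have "(\<lambda>i. if i = n then 1 else 0 :: real) \<in> bcontfun"
    by (rule bcontfun_normI[where b = 1]) auto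
  then show ?thesis unfolding unit_seq_def by (subst Bcontfun_inverse) auto
qed

lemma bounded_linear_bcontfun_apply: "bounded_linear (\<lambda>s :: 'x::topological_space \<Rightarrow>\<^sub>C real. s n)"
  by (rule bounded_linear_intro[where K = 1]) (simp, simp, unfold mult_1_right, rule norm_bounded)

lemma soft_minmax_affine:
  fixes \<eta> :: "'j \<Rightarrow> 'x::real_normed_vector \<Rightarrow> real"
  assumes "0 < \<tau>" "finite Y" "finite J" "\<And>j. bounded_linear (\<eta> j)"
  shows "soft_minmax \<tau> Y J (\<lambda>y j x. k y j * \<eta> j x + c y j) (\<lambda>y j h. k y j * \<eta> j h)"
  using assms bounded_linear_imp_has_derivative[OF assms(4)]
  by unfold_locales (auto intro!: derivative_eq_intros)

lemma Cyl_soft_minmax: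
  fixes \<eta> :: "'j \<Rightarrow> 'a::real_normed_vector \<Rightarrow> real"
  assumes \<tau>: "0 < \<tau>" and fin: "finite Y" "finite J" and \<eta>: "\<And>j. bounded_linear (\<eta> j)"
  shows "soft_minmax.W \<tau> C Y J b (\<lambda>y j x. k y j * \<eta> j x + c y j) \<in> Cyl"
proof -
  obtain i :: "'j \<Rightarrow> nat" where i: "inj_on i J" using finite_imp_inj_to_nat_seg[OF fin(2)] by blast
  interpret B: soft_minmax \<tau> C Y J b "\<lambda>y j x. k y j * \<eta> j x + c y j" "\<lambda>y j h. k y j * \<eta> j h"
    by (rule soft_minmax_affine[OF \<tau> fin \<eta>])
  interpret G: soft_minmax \<tau> C Y J b "\<lambda>y j (s :: nat \<Rightarrow>\<^sub>C real). k y j * s (i j) + c y j"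
    "\<lambda>y j h. k y j * h (i j)"
    by (rule soft_minmax_affine[OF \<tau> fin bounded_linear_bcontfun_apply])
  define P where "P x = (\<Sum>j\<in>J. \<eta> j x *\<^sub>R unit_seq (i j))" for x
  have P: "bounded_linear P"
    unfolding P_def
    by (intro bounded_linear_sum bounded_linear_compose[OF bounded_linear_scaleR_left] \<eta>)
  have "P x (i j) = \<eta> j x" if "j \<in> J" for x j
  proof -
    have "P x (i j) = (\<Sum>m\<in>J. (\<eta> m x *\<^sub>R unit_seq (i m)) (i j))"
      unfolding P_def
      by (rule linear_sum[OF bounded_linear.linear[OF bounded_linear_bcontfun_apply]])
    also have "\<dots> = (\<Sum>m\<in>J. if j = m then \<eta> m x else 0)"
      using i that by (intro sum.cong) (auto simp: unit_seq_apply inj_on_eq_iff)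
    finally show ?thesis using that fin by simp
  qed
  then have "B.S y x = G.S y (P x)" for y x
    unfolding B.S_def G.S_def by simp
  then have WP: "B.W = G.W \<circ> P"
    by (auto simp: B.W_def G.W_def B.Z_def G.Z_def)
  define V where "V = span (unit_seq ` i ` J)"
  have "range P \<subseteq> V"
    unfolding P_def V_def by (intro image_subsetI span_sum span_scale span_base) simp
  moreover have "G.W \<in> Cinfty V"
  proof -
    let ?L = "(\<lambda>n (s :: nat \<Rightarrow>\<^sub>C real). s n) ` i ` J"
    have "G.W \<in> smooth_algebra ?L"
    proof -
      have A: "(\<lambda>s :: nat \<Rightarrow>\<^sub>C real. exp ((k y j * s (i j) + c y j) / \<tau>)) \<in> smooth_algebra ?L" if "j \<in> J" for y j
        unfolding divide_inverse
        by (intro smooth_algebra.intros) (use that in auto)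
      have "(\<lambda>s :: nat \<Rightarrow>\<^sub>C real. ln (exp (- C / \<tau>) + (\<Sum>y\<in>Y. inverse (exp (b y / \<tau>)
          + (\<Sum>j\<in>J. exp ((k y j * s (i j) + c y j) / \<tau>)))))) \<in> smooth_algebra ?L"
        by (intro smooth_algebra.ln smooth_algebra.add smooth_algebra.inverse smooth_algebra.const
            smooth_algebra_sum A)
          (auto intro!: add_pos_nonneg add_nonneg_nonneg sum_nonneg)
      then show ?thesis
        unfolding G.W_def[abs_def] G.Z_def G.S_def by (intro smooth_algebra.mult smooth_algebra.const)
    qed
    then have "G.W \<in> Cinfty UNIV"
      by (rule smooth_algebra_Cinfty[rotated 2])
        (use fin bounded_linear_bcontfun_apply in auto)
    from Cinfty_bounded_linear[OF bounded_linear_ident this, of V] show ?thesis by (simp add: o_def)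
  qed
  moreover have "G.W \<in> LIPb V"
  proof -
    define m where "m = Min (insert C (b ` Y))"
    have m: "m \<le> C" "\<And>y. y \<in> Y \<Longrightarrow> m \<le> b y" using fin by (auto simp: m_def)
    have "exp (m / \<tau>) \<le> G.S y x" if "y \<in> Y" for y x
      using order_trans[OF _ G.S_ge[of y x]] m(2)[OF that] \<tau> by (simp add: divide_right_mono)
    then have "m - \<tau> * ln (1 + card Y) \<le> G.W s" for s by (rule G.W_ge[OF m(1)])
    then have "bounded (G.W ` V)"
      using G.W_le_C by (intro bounded_subset[OF bounded_closed_interval]) force
    moreover have "\<exists>\<Lambda>. \<Lambda>-lipschitz_on V G.W"
    proof -
      define \<Lambda> where "\<Lambda> = (\<Sum>y\<in>Y. \<Sum>j\<in>J. \<bar>k y j\<bar>)"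
      have "\<bar>k y j\<bar> \<le> \<Lambda>" if "y \<in> Y" "j \<in> J" for y j
        using member_le_sum[OF that(1), of "\<lambda>y. \<Sum>j\<in>J. \<bar>k y j\<bar>"]
          member_le_sum[OF that(2), of "\<lambda>j. \<bar>k y j\<bar>"] fin
        by (force simp: \<Lambda>_def sum_nonneg)
      moreover have "\<bar>s n\<bar> \<le> norm s" for s :: "nat \<Rightarrow>\<^sub>C real" and n
        using norm_bounded[of s n] by simp
      ultimately have le: "\<bar>k y j * h (i j)\<bar> \<le> \<Lambda> * norm h" if "y \<in> Y" "j \<in> J"
        for y j and h :: "nat \<Rightarrow>\<^sub>C real"
        using that unfolding abs_mult by (intro mult_mono) (auto intro: order_trans[OF abs_ge_zero])
      have "0 \<le> \<Lambda>" by (auto simp: \<Lambda>_def intro!: sum_nonneg)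
      then have "\<Lambda>-lipschitz_on UNIV G.W"
        by (intro bounded_derivative_imp_lipschitz[where f' = G.W'] G.W'_bounded)
          (use G.W_has_derivative le in auto)
      then show ?thesis using lipschitz_on_subset by blast
    qed
    ultimately show ?thesis by (simp add: LIPb_def)
  qed
  moreover have "\<exists>T. finite T \<and> V = span T" using fin by (intro exI[of _ "unit_seq ` i ` J"]) (simp add: V_def)
  ultimately show ?thesis
    unfolding Cyl_def mem_Collect_eq using P WP
    by (intro exI[of _ G.W] exI[of _ P] exI[of _ V]) auto
qed

lemma lip_a_eq_onorm:
  fixes u :: "'a::real_normed_vector \<Rightarrow> real"
  assumes u': "\<And>z. (u has_derivative u' z) (at z)"
    and semicont: "\<And>e. 0 < e \<Longrightarrow> \<exists>r>0. \<forall>z\<in>ball x r. onorm (u' z) \<le> onorm (u' x) + e"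
  shows "lip_a UNIV u x = ennreal (onorm (u' x))"
proof (rule antisym)
  have bl: "bounded_linear (u' z)" for z using u' has_derivative_bounded_linear by blast
  show "lip_a UNIV u x \<le> ennreal (onorm (u' x))"
  proof (rule ennreal_le_epsilon)
    fix e :: real assume "0 < e"
    then obtain r where r: "0 < r" "\<And>z. z \<in> ball x r \<Longrightarrow> onorm (u' z) \<le> onorm (u' x) + e"
      using semicont by blast
    have "\<bar>u y - u z\<bar> / dist y z \<le> onorm (u' x) + e" if "y \<in> ball x r" "z \<in> ball x r" for y z
    proof -
      have "norm (u y - u z) \<le> (onorm (u' x) + e) * norm (y - z)"
        by (rule differentiable_bound[where S = "ball x r" and f' = u'])
          (use that r u' in \<open>auto intro: has_derivative_at_withinI\<close>)
      moreover have "0 \<le> onorm (u' x) + e" using \<open>0 < e\<close> onorm_pos_le[OF bl] by (simp add: add_nonneg_pos less_imp_le)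
      ultimately show ?thesis by (cases "y = z") (auto simp: dist_norm field_simps)
    qed
    then have "Lip u (ball x r) \<le> ennreal (onorm (u' x) + e)"
      unfolding Lip_def by (intro SUP_least) (auto intro: ennreal_leI)
    also have "\<dots> = ennreal (onorm (u' x)) + ennreal e"
      using \<open>0 < e\<close> onorm_pos_le[OF bl] by (simp add: ennreal_plus)
    finally have "Lip u (ball x r \<inter> UNIV) \<le> ennreal (onorm (u' x)) + ennreal e" by simp
    then show "lip_a UNIV u x \<le> ennreal (onorm (u' x)) + ennreal e"
      unfolding lip_a_def using r(1) by (intro INF_lower2) auto
  qed
  show "ennreal (onorm (u' x)) \<le> lip_a UNIV u x"
    unfolding lip_a_def
  proof (rule INF_greatest)
    fix r :: real assume "r \<in> {0<..}"
    then have r: "0 < r" by simp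
    show "ennreal (onorm (u' x)) \<le> Lip u (ball x r \<inter> UNIV)"
    proof (cases "Lip u (ball x r \<inter> UNIV)")
      case (real l)
      have lip: "\<bar>u y - u x\<bar> \<le> l * norm (y - x)" if "y \<in> ball x r" for y
      proof -
        have "ennreal (\<bar>u y - u x\<bar> / dist y x) \<le> ennreal l"
          unfolding real(2)[symmetric] Lip_def using that r
          by (intro SUP_upper2[of y] SUP_upper2[of x]) auto
        then show ?thesis using real(1)
          by (cases "y = x") (auto simp: dist_norm field_simps)
      qed
      have "onorm (u' x) \<le> l"
      proof (rule onorm_bound[OF real(1)])
        fix h
        show "norm (u' x h) \<le> l * norm h"
        proof (rule field_le_epsilon)
          fix e :: real assume "0 < e"
          define e' where "e' = e / (norm h + 1)"
          have e': "0 < e'" "e' * norm h \<le> e"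
            using \<open>0 < e\<close> by (auto simp: e'_def field_simps add_pos_nonneg)
          obtain d where d: "0 < d"
            "\<And>y. norm (y - x) < d \<Longrightarrow> norm (u y - u x - u' x (y - x)) \<le> e' * norm (y - x)"
            using u'[of x] e'(1) unfolding has_derivative_at_alt by blast
          define t where "t = min r d / (2 * (norm h + 1))"
          have t: "0 < t" using r d by (auto simp: t_def intro!: divide_pos_pos add_nonneg_pos)
          have "t * norm h < min r d"
          proof -
            have "t * norm h \<le> t * (norm h + 1)" using t by simp
            also have "\<dots> = min r d / 2" by (simp add: t_def add_nonneg_eq_0_iff field_simps)
            finally show ?thesis using r d by linarith
          qed
          then have th: "norm (t *\<^sub>R h) < r" "norm (t *\<^sub>R h) < d" using t by auto
          have "\<bar>u (x + t *\<^sub>R h) - u x\<bar> \<le> l * (t * norm h)"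
            using lip[of "x + t *\<^sub>R h"] th(1) t by (simp add: dist_norm)
          moreover have "\<bar>u (x + t *\<^sub>R h) - u x - t * u' x h\<bar> \<le> e' * (t * norm h)"
            using d(2)[of "x + t *\<^sub>R h"] th(2) t linear_scale[OF bounded_linear.linear[OF bl]]
            by simp
          ultimately have "\<bar>t * u' x h\<bar> \<le> t * (l * norm h + e' * norm h)"
            by (simp add: algebra_simps)
          then have "t * \<bar>u' x h\<bar> \<le> t * (l * norm h + e' * norm h)" using t by (simp add: abs_mult)
          then show "norm (u' x h) \<le> l * norm h + e" using t e'(2) by simp
        qed
      qed
      then show ?thesis using real by (simp add: ennreal_leI)
    qed simp
  qed
qed

lemma dual_norm_diff_eq:
  assumes "(u has_derivative u') (at x)"
  shows "dual_norm_diff u x = onorm u'"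
  using frechet_derivative_at[OF assms] by (simp add: dual_norm_diff_def)

section \<open>Cylindrical approximation of a Lipschitz function\<close>

lemma Lip_mono: "A \<subseteq> B \<Longrightarrow> Lip f A \<le> Lip f B"
  unfolding Lip_def by (intro SUP_subset_mono SUP_mono) auto

lemma Lip_le:
  assumes "L-lipschitz_on UNIV f"
  shows "Lip f A \<le> ennreal L"
  unfolding Lip_def
proof (intro SUP_least)
  fix x y
  have "\<bar>f x - f y\<bar> \<le> L * dist x y" using lipschitz_onD[OF assms, of x y] by (simp add: dist_real_def)
  then have "\<bar>f x - f y\<bar> / dist x y \<le> L"
    using lipschitz_on_nonneg[OF assms] by (cases "x = y") (auto simp: field_simps)
  then show "ennreal (\<bar>f x - f y\<bar> / dist x y) \<le> ennreal L" by (rule ennreal_leI)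
qed

lemma Lip_bound:
  assumes "x \<in> A" "y \<in> A" "Lip f A < \<infinity>"
  shows "\<bar>f x - f y\<bar> \<le> enn2real (Lip f A) * dist x y"
proof -
  have "ennreal (\<bar>f x - f y\<bar> / dist x y) \<le> Lip f A"
    unfolding Lip_def using assms by (intro SUP_upper2[of x] SUP_upper2[of y]) auto
  then have "\<bar>f x - f y\<bar> / dist x y \<le> enn2real (Lip f A)"
    using assms(3) by (cases "Lip f A") (auto simp: top_unique)
  then show ?thesis by (cases "x = y") (auto simp: field_simps)
qed

lemma finite_net:
  fixes M :: "'a::{metric_space, second_countable_topology} measure"
  assumes sets: "sets M = sets borel" and "finite_measure M" and "0 < \<delta>" "0 < e"
  obtains Y where "finite Y" "measure M (- (\<Union>y\<in>Y. ball y \<delta>)) < e"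
proof -
  interpret finite_measure M by fact
  have space: "space M = UNIV" using sets_eq_imp_space_eq[OF sets] by simp
  obtain D :: "'a set" where D: "countable D" "\<And>X. open X \<Longrightarrow> X \<noteq> {} \<Longrightarrow> \<exists>d\<in>D. d \<in> X"
    using countable_dense_exists by blast
  have "D \<noteq> {}" using D(2)[of UNIV] by auto
  define A where "A n = (\<Union>y\<in>from_nat_into D ` {..<n}. ball y \<delta>)" for n
  have "(\<Union>n. A n) = UNIV"
  proof -
    have "\<exists>n. x \<in> A n" for x
    proof -
      obtain d where "d \<in> D" "d \<in> ball x \<delta>" using D(2)[of "ball x \<delta>"] \<open>0 < \<delta>\<close> by auto
      moreover obtain n where "d = from_nat_into D n"
        using from_nat_into_surj[OF D(1) \<open>d \<in> D\<close>] by metis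
      ultimately have "x \<in> A (Suc n)" by (auto simp: A_def dist_commute)
      then show ?thesis by blast
    qed
    then show ?thesis by auto
  qed
  moreover have "A n \<in> sets M" for n unfolding sets A_def by (intro borel_open) auto
  moreover have "incseq A"
    unfolding incseq_def A_def by (intro allI impI UN_mono image_mono) auto
  ultimately have "(\<lambda>n. measure M (A n)) \<longlonglongrightarrow> measure M UNIV"
    using finite_Lim_measure_incseq[of A] by auto
  then have "eventually (\<lambda>n. measure M UNIV - e < measure M (A n)) sequentially"
    using \<open>0 < e\<close> by (intro order_tendstoD(1)) auto
  then obtain n where "measure M UNIV - e < measure M (A n)"
    using eventually_happens'[OF sequentially_bot] by blast
  then have "measure M (- A n) < e"
    using finite_measure_compl[OF \<open>A n \<in> sets M\<close>] by (simp add: space Compl_eq_Diff_UNIV)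
  then show ?thesis by (intro that[of "from_nat_into D ` {..<n}"]) (auto simp: A_def)
qed

lemma small_temperature:
  fixes a b c \<kappa> e :: real
  assumes "0 \<le> a" "0 \<le> b" "0 \<le> c" "0 < \<kappa>" "0 < e"
  obtains \<tau> where "0 < \<tau>" "\<tau> * a \<le> e" "\<tau> * b \<le> e" "c * exp (- \<kappa> / \<tau>) \<le> e"
proof -
  define s where "s = 1 + a + b + c / \<kappa>"
  have s: "0 < s" "a \<le> s" "b \<le> s" "c / \<kappa> \<le> s"
    using assms by (auto simp: s_def add_nonneg_nonneg add_pos_nonneg)
  define \<tau> where "\<tau> = e / s"
  have \<tau>: "0 < \<tau>" "\<tau> * s = e" using s assms by (auto simp: \<tau>_def)
  have le: "\<tau> * x \<le> e" if "x \<le> s" for x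
    using mult_left_mono[OF that, of \<tau>] \<tau> by simp
  have "\<kappa> / \<tau> \<le> exp (\<kappa> / \<tau>)" using exp_ge_add_one_self[of "\<kappa> / \<tau>"] by linarith
  then have "exp (- \<kappa> / \<tau>) \<le> \<tau> / \<kappa>"
    using assms \<tau> by (simp add: exp_minus field_simps)
  then have "c * exp (- \<kappa> / \<tau>) \<le> c * (\<tau> / \<kappa>)" using assms by (intro mult_left_mono) auto
  also have "\<dots> \<le> e" using le[OF s(4)] by (simp add: mult.commute)
  finally show ?thesis using that[of \<tau>] \<tau> le s by auto
qed

lemma cylindrical_approx_slope:
  fixes f :: "'a::{real_normed_vector, second_countable_topology} \<Rightarrow> real"
  assumes M: "sets M = sets borel" "finite_measure M"
    and L: "L-lipschitz_on UNIV f" and C: "\<And>x. \<bar>f x\<bar> \<le> C"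
    and e: "0 < e" "e \<le> 1" and r: "0 < r" "r \<le> 1"
  obtains u K where "u \<in> Cyl" "K \<in> sets borel" "measure M (- K) \<le> e" "\<And>x. \<bar>u x\<bar> \<le> C + 1"
    "\<And>x. lip_a UNIV u x = ennreal (dual_norm_diff u x)"
    "\<And>x. 0 \<le> dual_norm_diff u x" "\<And>x. dual_norm_diff u x \<le> 2 * (L + 1)"
    "\<And>x. x \<in> K \<Longrightarrow> \<bar>u x - f x\<bar> \<le> e"
    "\<And>x. x \<in> K \<Longrightarrow> dual_norm_diff u x \<le> enn2real (Lip f (ball x (3 * r))) + 2 * e"
proof -
  have L0: "0 \<le> L" using lipschitz_on_nonneg[OF L] .
  have fL: "f x \<le> f y + L * dist x y" for x y
    using lipschitz_onD[OF L, of x y] by (simp add: dist_real_def)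
  have Lip_fin: "Lip f A < \<infinity>" for A using le_less_trans[OF Lip_le[OF L, of A]] by (simp add: ennreal_less_top)
  have Lip_real: "enn2real (Lip f A) \<le> L" for A
    using enn2real_mono[OF Lip_le[OF L, of A]] L0 by simp
  define \<delta> where "\<delta> = min (r / 2) (e * r / (32 * (L + e)))"
  have \<delta>: "0 < \<delta>" "2 * \<delta> \<le> r" "4 * (L + e) * \<delta> \<le> e * r / 8"
  proof -
    show "0 < \<delta>" "2 * \<delta> \<le> r" using e r L0 by (auto simp: \<delta>_def)
    have "(L + e) * \<delta> \<le> (L + e) * (e * r / (32 * (L + e)))"
      using L0 e by (intro mult_left_mono) (auto simp: \<delta>_def)
    also have "\<dots> = e * r / 32" using L0 e by (simp add: field_simps)
    finally show "4 * (L + e) * \<delta> \<le> e * r / 8" unfolding mult.assoc by linarith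
  qed
  obtain Y where Y: "finite Y" "measure M (- (\<Union>y\<in>Y. ball y \<delta>)) < e"
    using finite_net[OF M \<delta>(1) e(1)] by blast
  define K where "K = (\<Union>y\<in>Y. ball y \<delta>)"
  have "\<forall>p::'a\<times>'a. \<exists>\<xi>. bounded_linear \<xi> \<and> (\<forall>x. \<bar>\<xi> x\<bar> \<le> norm x) \<and> \<xi> (fst p - snd p) = norm (fst p - snd p)"
    using norming_functional by metis
  then obtain \<xi> :: "'a \<times> 'a \<Rightarrow> 'a \<Rightarrow> real" where \<xi>: "\<And>p. bounded_linear (\<xi> p)"
    "\<And>p x. \<bar>\<xi> p x\<bar> \<le> norm x" "\<And>x y. \<xi> (x, y) (x - y) = norm (x - y)"
    by (metis fst_conv snd_conv)
  have \<xi>_diff: "\<xi> p (x - y) = \<xi> p x - \<xi> p y" for p x y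
    by (rule linear_diff[OF bounded_linear.linear[OF \<xi>(1)]])
  define J where "J = (Y \<times> Y) \<times> (UNIV :: bool set)"
  have finJ: "finite J" using Y by (simp add: J_def)
  define l where "l y = enn2real (Lip f (ball y (2 * r))) + e" for y
  have l: "0 \<le> l y" "l y \<le> L + e" for y using e Lip_real by (auto simp: l_def)
  define k where "k y j = (if snd j then l y else 2 * (L + e))" for y and j :: "('a \<times> 'a) \<times> bool"
  define c where "c y j = (if snd j then f y - l y * \<xi> (fst j) y
      else f y - 2 * (L + e) * (\<xi> (fst j) y + r))" for y j
  define \<eta> where "\<eta> j = \<xi> (fst j)" for j :: "('a \<times> 'a) \<times> bool"
  define A where "A y j x = k y j * \<eta> j x + c y j" for y j x
  have A_near: "A y (p, True) x = f y + l y * \<xi> p (x - y)"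
    and A_far: "A y (p, False) x = f y + 2 * (L + e) * (\<xi> p (x - y) - r)" for y p x
    by (auto simp: A_def k_def c_def \<eta>_def \<xi>_diff algebra_simps)
  obtain \<tau> where \<tau>_small: "0 < \<tau>" "\<tau> * ln (1 + card J) \<le> e * r / 8" "\<tau> * ln (1 + card Y) \<le> e * r / 8"
    "(card Y * card J * (2 * (L + e))) * exp (- (e * r / 8) / \<tau>) \<le> e * r / 8"
    by (rule small_temperature[of "ln (1 + card J)" "ln (1 + card Y)"
          "card Y * card J * (2 * (L + e))" "e * r / 8" "e * r / 8"])
      (use L0 e r in auto)
  interpret soft_minmax \<tau> C Y J f A "\<lambda>y j h. k y j * \<eta> j h"
    unfolding A_def[abs_def] \<eta>_def by (rule soft_minmax_affine[OF \<tau>_small(1) Y(1) finJ \<xi>(1)])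
  have er: "e * r \<le> e" "e * r \<le> 1" "0 < e * r" using e r mult_le_one[of e r] by (auto simp: mult_left_le)
  have "W \<in> Cyl"
    unfolding A_def[abs_def] \<eta>_def by (rule Cyl_soft_minmax[OF \<tau>_small(1) Y(1) finJ \<xi>(1)])
  moreover have dual: "dual_norm_diff W x = onorm (W' x)" for x
    by (rule dual_norm_diff_eq[OF W_has_derivative])
  moreover have "lip_a UNIV W x = ennreal (onorm (W' x))" for x
    by (rule lip_a_eq_onorm[OF W_has_derivative W'_upper_semicontinuous])
  moreover have "0 \<le> onorm (W' x)" for x
    using W_has_derivative has_derivative_bounded_linear onorm_pos_le by blast
  moreover have \<phi>_le: "\<bar>k y j * \<eta> j h\<bar> \<le> 2 * (L + e) * norm h" for y j h
  proof -
    have "0 \<le> k y j" "k y j \<le> 2 * (L + e)" using l[of y] L0 e by (auto simp: k_def)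
    then show ?thesis unfolding abs_mult \<eta>_def using \<xi>(2) L0 e by (intro mult_mono) auto
  qed
  moreover have "onorm (W' x) \<le> 2 * (L + e)" for x
    by (rule W'_bounded) (use \<phi>_le L0 e in auto)
  then have "onorm (W' x) \<le> 2 * (L + 1)" for x
    by (rule order_trans) (use e in simp)
  moreover have "\<bar>W x\<bar> \<le> C + 1" for x
  proof -
    have C0: "0 \<le> C" using C[of x] by linarith
    have "exp (- C / \<tau>) \<le> S y x" for y
    proof -
      have "- C \<le> f y" using C[of y] by linarith
      then show ?thesis
        using \<tau>_small(1)
        by (intro order_trans[OF _ S_ge] iffD2[OF exp_le_cancel_iff] divide_right_mono) auto
    qed
    from W_ge[of "- C", OF _ this] have "- C - e * r / 8 \<le> W x" using C0 \<tau>_small(3) by force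
    then show ?thesis using W_le_C[of x] er by linarith
  qed
  moreover have "\<bar>W x - f x\<bar> \<le> e \<and> onorm (W' x) \<le> enn2real (Lip f (ball x (3 * r))) + 2 * e"
    if xK: "x \<in> K" for x
  proof -
    obtain y0 where y0: "y0 \<in> Y" "dist x y0 < \<delta>" 
    proof -
      obtain y0 where "y0 \<in> Y" "x \<in> ball y0 \<delta>" using xK unfolding K_def by blast
      then show thesis by (intro that) (simp_all add: dist_commute)
    qed
    have \<xi>_le: "\<xi> p (x - y) \<le> dist x y" for p y using \<xi>(2)[of p "x - y"] by (simp add: dist_norm)
    have W_upper: "W x \<le> f x + e * r / 4"
    proof -
      have "A y0 j x \<le> f y0 + (L + e) * \<delta>" for j
      proof -
        obtain p t where j: "j = (p, t)" by (cases j)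
        have "l y0 * \<xi> p (x - y0) \<le> (L + e) * \<delta>"
        proof (cases "0 \<le> \<xi> p (x - y0)")
          case True
          then show ?thesis using l[of y0] \<xi>_le[of p y0] y0(2) by (intro mult_mono) auto
        next
          case False
          then have "l y0 * \<xi> p (x - y0) \<le> 0" using l[of y0] by (intro mult_nonneg_nonpos) auto
          moreover have "0 \<le> (L + e) * \<delta>" using L0 e \<delta> by simp
          ultimately show ?thesis by linarith
        qed
        moreover have "2 * (L + e) * (\<xi> p (x - y0) - r) \<le> 0"
          using \<xi>_le[of p y0] y0(2) \<delta> L0 e by (intro mult_nonneg_nonpos) auto
        moreover have "0 \<le> (L + e) * \<delta>" using L0 e \<delta> by simp
        ultimately show ?thesis by (cases t) (auto simp: j A_near A_far)
      qed
      moreover have "0 \<le> (L + e) * \<delta>" using L0 e \<delta> by simp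
      ultimately have "W x \<le> f y0 + (L + e) * \<delta> + \<tau> * ln (1 + card J)"
        using S_le[of y0 "f y0 + (L + e) * \<delta>" x] W_le[OF y0(1), of x] by force
      moreover have "f y0 \<le> f x + L * \<delta>"
        using fL[of y0 x] y0(2) mult_left_mono[of "dist x y0" \<delta> L] L0 by (simp add: dist_commute)
      moreover have "L * \<delta> + (L + e) * \<delta> \<le> 4 * (L + e) * \<delta>"
        using L0 e \<delta>(1) by (simp add: algebra_simps)
      ultimately show ?thesis using \<delta>(3) \<tau>_small(2) by linarith
    qed
    have S_lower: "exp ((f x + e * min (dist x y) r - e * r / 8) / \<tau>) \<le> S y x" if y: "y \<in> Y" for y
    proof -
      define p where "p = (y0, y)"
      have p: "p \<in> Y \<times> Y" using y y0 by (simp add: p_def)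
      have \<xi>p: "dist x y - 2 * \<delta> \<le> \<xi> p (x - y)"
      proof -
        have "norm (y0 - y) \<le> \<xi> p (x - y) + dist x y0"
          using \<xi>(2)[of p "x - y0"] \<xi>(3)[of y0 y]
          by (simp add: p_def \<xi>_diff dist_norm)
        then show ?thesis using y0(2) dist_triangle[of x y y0] by (simp add: dist_norm)
      qed
      have "\<exists>j\<in>J. f x + e * min (dist x y) r - e * r / 8 \<le> A y j x"
      proof (cases "dist x y < 2 * r")
        case True
        then have "\<bar>f x - f y\<bar> \<le> (l y - e) * dist x y"
          using Lip_bound[of x "ball y (2 * r)" y f] Lip_fin r by (simp add: l_def dist_commute)
        then have "f x \<le> f y + l y * dist x y - e * dist x y" by (simp add: algebra_simps)
        moreover have "l y * dist x y - l y * (2 * \<delta>) \<le> l y * \<xi> p (x - y)"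
          using mult_left_mono[OF \<xi>p l(1)[of y]] by (simp add: algebra_simps)
        moreover have "l y * (2 * \<delta>) \<le> (L + e) * (2 * \<delta>)"
          using l[of y] \<delta> by (intro mult_right_mono) auto
        moreover have "(L + e) * (2 * \<delta>) \<le> e * r / 8" 
        proof -
          have "0 \<le> (L + e) * \<delta>" using L0 e \<delta> by simp
          then show ?thesis using \<delta>(3) by (simp add: algebra_simps)
        qed
        moreover have "e * min (dist x y) r \<le> e * dist x y" using e by (intro mult_left_mono) auto
        ultimately show ?thesis
          using p by (intro bexI[of _ "(p, True)"]) (auto simp: A_near J_def)
      next
        case False
        have "2 * (L + e) * (dist x y - 2 * \<delta> - r) \<le> 2 * (L + e) * (\<xi> p (x - y) - r)"
          using \<xi>p L0 e by (intro mult_left_mono) auto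
        moreover have "0 \<le> (L + 2 * e) * (dist x y - 2 * r)" using False L0 e by simp
        moreover have "e * min (dist x y) r \<le> e * r" using e by (intro mult_left_mono) auto
        moreover have "2 * (L + e) * (dist x y - 2 * \<delta> - r) = (L + 2 * e) * (dist x y - 2 * r)
            + L * dist x y + 2 * (e * r) - 4 * (L + e) * \<delta>"
          by (simp add: algebra_simps)
        ultimately have "f x + e * min (dist x y) r - e * r / 8 \<le> A y (p, False) x"
          unfolding A_far using fL[of x y] \<delta>(3) er by linarith
        then show ?thesis using p by (intro bexI[of _ "(p, False)"]) (auto simp: J_def)
      qed
      then obtain j where "j \<in> J" "f x + e * min (dist x y) r - e * r / 8 \<le> A y j x" by blast
      then show ?thesis
        using \<tau>_small(1)
        by (intro order_trans[OF _ S_ge_exp] iffD2[OF exp_le_cancel_iff] divide_right_mono) auto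
    qed
    have W_lower: "f x - e * r / 4 \<le> W x"
    proof -
      have "exp ((f x - e * r / 8) / \<tau>) \<le> S y x" if "y \<in> Y" for y
      proof (rule order_trans[OF _ S_lower[OF that]])
        have "0 \<le> e * min (dist x y) r" using e r by simp
        then show "exp ((f x - e * r / 8) / \<tau>) \<le> exp ((f x + e * min (dist x y) r - e * r / 8) / \<tau>)"
          using \<tau>_small(1) by (intro iffD2[OF exp_le_cancel_iff] divide_right_mono) auto
      qed
      moreover have "f x - e * r / 8 \<le> C" using C[of x] er by linarith
      ultimately show ?thesis using W_ge[of "f x - e * r / 8" x] \<tau>_small(3) by force
    qed
    define B where "B = enn2real (Lip f (ball x (3 * r))) + e"
    define q where "q = exp (- (e * r / 8) / \<tau>)"
    have B0: "0 \<le> B" using e by (simp add: B_def)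
    have "wt y j x * \<bar>k y j * \<eta> j h\<bar> \<le> (wt y j x * B + q * (2 * (L + e))) * norm h"
      if y: "y \<in> Y" and j: "j \<in> J" for y j h
    proof -
      obtain p t where jp: "j = (p, t)" by (cases j)
      consider (good) "dist x y < r / 2" "t" | (small) "wt y j x \<le> q"
      proof (cases "dist x y < r / 2")
        case True
        show ?thesis
        proof (cases t)
          case False
          have "2 * (L + e) * (\<xi> p (x - y) - r) \<le> 2 * (L + e) * (- r / 2)"
            using \<xi>_le[of p y] True L0 e by (intro mult_left_mono) auto
          also have "\<dots> \<le> - (e * r / 8)" using mult_nonneg_nonneg[OF L0 less_imp_le[OF r(1)]] er(3) by (simp add: algebra_simps)
          finally have "A y j x - f y \<le> - (e * r / 8)" using False by (simp add: jp A_far)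
          then have "exp ((A y j x - f y) / \<tau>) \<le> q"
            unfolding q_def using less_imp_le[OF \<tau>_small(1)]
            by (intro iffD2[OF exp_le_cancel_iff] divide_right_mono)
          then show ?thesis using small wt_le_exp_A[OF y, of j x] by linarith
        qed (use True good in blast)
      next
        case False
        then have "e * (r / 2) \<le> e * min (dist x y) r" using e r by (intro mult_left_mono) auto
        then have "W x - (f x + e * min (dist x y) r - e * r / 8) \<le> - (e * r / 8)"
          using W_upper by linarith
        then have "exp ((W x - (f x + e * min (dist x y) r - e * r / 8)) / \<tau>) \<le> q"
          unfolding q_def using less_imp_le[OF \<tau>_small(1)]
            by (intro iffD2[OF exp_le_cancel_iff] divide_right_mono)
        then show ?thesis using small wt_le_exp_W[OF j S_lower[OF y]] by linarith
      qed
      then show ?thesis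
      proof cases
        case good
        have "Lip f (ball y (2 * r)) \<le> Lip f (ball x (3 * r))"
        proof (rule Lip_mono)
          show "ball y (2 * r) \<subseteq> ball x (3 * r)"
          proof
            fix z assume "z \<in> ball y (2 * r)"
            then show "z \<in> ball x (3 * r)" using dist_triangle[of x z y] good(1) r by simp
          qed
        qed
        then have "l y \<le> B"
          unfolding l_def B_def using Lip_fin by (simp add: enn2real_mono)
        then have "\<bar>k y j * \<eta> j h\<bar> \<le> B * norm h"
          unfolding abs_mult using good(2) l[of y] \<xi>(2)[of p h] B0
          by (intro mult_mono) (auto simp: k_def \<eta>_def jp)
        then have "wt y j x * \<bar>k y j * \<eta> j h\<bar> \<le> wt y j x * (B * norm h)"
          by (rule mult_left_mono[OF _ wt_nonneg])
        moreover have "0 \<le> q * (2 * (L + e)) * norm h" using L0 e by (simp add: q_def)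
        ultimately show ?thesis by (simp add: algebra_simps)
      next
        case small
        have "wt y j x * \<bar>k y j * \<eta> j h\<bar> \<le> q * (2 * (L + e) * norm h)"
          using \<phi>_le[of y j h] small by (intro mult_mono) (auto simp: q_def)
        moreover have "0 \<le> wt y j x * B * norm h" using wt_nonneg B0 by simp
        ultimately show ?thesis by (simp add: algebra_simps)
      qed
    qed
    then have "onorm (W' x) \<le> (\<Sum>y\<in>Y. \<Sum>j\<in>J. wt y j x * B + q * (2 * (L + e)))"
      by (rule W'_le) (use wt_nonneg B0 L0 e in \<open>auto simp: q_def\<close>)
    also have "\<dots> = (\<Sum>y\<in>Y. \<Sum>j\<in>J. wt y j x) * B + card Y * card J * (2 * (L + e)) * q"
      by (simp add: sum.distrib sum_distrib_left mult_ac)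
    also have "\<dots> \<le> 1 * B + e * r / 8"
      using sum_wt_le_1 B0 \<tau>_small(4) by (intro add_mono mult_right_mono) (auto simp: q_def)
    finally have "onorm (W' x) \<le> enn2real (Lip f (ball x (3 * r))) + 2 * e"
      using er by (simp add: B_def)
    moreover have "\<bar>W x - f x\<bar> \<le> e" using W_lower W_upper er(1,3) by linarith
    ultimately show ?thesis by blast
  qed
  ultimately show ?thesis
    using Y(2) by (intro that[of W K]) (auto simp: K_def intro!: less_imp_le borel_open)
qed

section \<open>Asymptotic slope and convergence of powers\<close>

lemma LIPb_comp_bounded_linear:
  assumes P: "bounded_linear P" "range P \<subseteq> V" and g: "g \<in> LIPb V"
  shows "g \<circ> P \<in> LIPb UNIV"
proof -
  obtain L where L: "L-lipschitz_on V g" using g by (auto simp: LIPb_def)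
  obtain K where K: "K-lipschitz_on UNIV P" using bounded_linear.lipschitz_boundE[OF P(1)] by blast
  have "(L * K)-lipschitz_on UNIV (g \<circ> P)"
    using lipschitz_on_compose[OF K lipschitz_on_subset[OF L P(2)]] .
  moreover have "bounded (range (g \<circ> P))"
    by (rule bounded_subset[of "g ` V"]) (use g P(2) in \<open>auto simp: LIPb_def\<close>)
  ultimately show ?thesis by (auto simp: LIPb_def)
qed

lemma Cyl_subset_LIPb: "Cyl \<subseteq> LIPb UNIV"
  unfolding Cyl_def by (auto intro: LIPb_comp_bounded_linear)

definition slope :: "('a::metric_space \<Rightarrow> real) \<Rightarrow> 'a \<Rightarrow> real" where
  "slope f x = enn2real (lip_a UNIV f x)"

lemma slope_nonneg: "0 \<le> slope f x"
  by (simp add: slope_def)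

lemma lip_a_le_Lip: "0 < r \<Longrightarrow> lip_a UNIV f x \<le> Lip f (ball x r)"
  unfolding lip_a_def by (intro INF_lower2) auto

lemma Lip_finite: "L-lipschitz_on UNIV f \<Longrightarrow> Lip f A < \<infinity>"
  using le_less_trans[OF Lip_le[of L f A]] by (simp add: ennreal_less_top)

lemma
  assumes "f \<in> LIPb UNIV"
  shows lip_a_finite: "lip_a UNIV f x < \<infinity>"
    and ennreal_slope: "ennreal (slope f x) = lip_a UNIV f x"
proof -
  obtain L where "L-lipschitz_on UNIV f" using assms by (auto simp: LIPb_def)
  then show "lip_a UNIV f x < \<infinity>"
    using lip_a_le_Lip[of 1 f x] Lip_finite by (auto intro: le_less_trans)
  then show "ennreal (slope f x) = lip_a UNIV f x" by (simp add: slope_def)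
qed

lemma slope_le:
  assumes "L-lipschitz_on UNIV f"
  shows "slope f x \<le> L"
  unfolding slope_def
  using enn2real_mono[OF order_trans[OF lip_a_le_Lip[of 1 f x] Lip_le[OF assms]]]
    lipschitz_on_nonneg[OF assms] by simp

lemma Lip_tendsto_slope:
  assumes f: "f \<in> LIPb UNIV" and r: "\<And>n. 0 < r n" "r \<longlonglongrightarrow> 0"
  shows "(\<lambda>n. enn2real (Lip f (ball x (r n)))) \<longlonglongrightarrow> slope f x"
  unfolding slope_def
proof (rule tendsto_enn2real)
  show "(\<lambda>n. Lip f (ball x (r n))) \<longlonglongrightarrow> ennreal (enn2real (lip_a UNIV f x))"
    unfolding slope_def[symmetric] ennreal_slope[OF f]
  proof (rule order_tendstoI)
    fix a assume "a < lip_a UNIV f x"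
    then show "\<forall>\<^sub>F n in sequentially. a < Lip f (ball x (r n))"
      by (intro always_eventually allI less_le_trans[OF _ lip_a_le_Lip[OF r(1)]])
  next
    fix a assume "lip_a UNIV f x < a"
    then obtain s where s: "0 < s" "Lip f (ball x s) < a"
      unfolding lip_a_def by (auto simp: INF_less_iff)
    have "\<forall>\<^sub>F n in sequentially. r n < s" using order_tendstoD(2)[OF r(2) s(1)] .
    then show "\<forall>\<^sub>F n in sequentially. Lip f (ball x (r n)) < a"
    proof eventually_elim
      case (elim n)
      then have "Lip f (ball x (r n)) \<le> Lip f (ball x s)" by (intro Lip_mono subset_ball) simp
      then show ?case using s(2) by simp
    qed
  qed
qed simp

lemma Lip_ball_measurable: "(\<lambda>x. Lip f (ball x r)) \<in> borel_measurable borel"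
proof (rule borel_measurableI_greater)
  fix a
  define q where "q y z = ennreal (\<bar>f y - f z\<bar> / dist y z)" for y z
  have *: "y \<in> ball x r \<longleftrightarrow> x \<in> ball y r" for x y by (simp add: dist_commute)
  have "{x. a < Lip f (ball x r)} = (\<Union>y. \<Union>z\<in>{z. a < q y z}. ball y r \<inter> ball z r)"
    unfolding Lip_def q_def[symmetric] less_SUP_iff
    by (rule set_eqI) (simp only: mem_Collect_eq UN_iff Int_iff Bex_def UNIV_I simp_thms *, blast)
  moreover have "open \<dots>" by (intro open_UN) auto
  ultimately show "{x \<in> space borel. a < Lip f (ball x r)} \<in> sets borel"
    by (simp add: borel_open)
qed

lemma slope_measurable:
  assumes "f \<in> LIPb UNIV"
  shows "slope f \<in> borel_measurable borel"
proof (rule borel_measurable_LIMSEQ_real)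
  show "(\<lambda>n. enn2real (Lip f (ball x (inverse (real (Suc n)))))) \<longlonglongrightarrow> slope f x" for x
    using assms LIMSEQ_inverse_real_of_nat by (intro Lip_tendsto_slope) auto
  show "(\<lambda>x. enn2real (Lip f (ball x (inverse (real (Suc n)))))) \<in> borel_measurable borel" for n
    by (intro borel_measurable_enn2real Lip_ball_measurable)
qed

lemma LIPb_measurable: "f \<in> LIPb UNIV \<Longrightarrow> f \<in> borel_measurable borel"
  unfolding LIPb_def using borel_measurable_continuous_onI lipschitz_on_continuous_on by blast

lemma LIPb_midpoint:
  assumes "f \<in> LIPb UNIV" "g \<in> LIPb UNIV"
  shows "(\<lambda>x. (f x + g x) / 2) \<in> LIPb UNIV"
proof -
  obtain L K where "L-lipschitz_on UNIV f" "K-lipschitz_on UNIV g"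
    using assms by (auto simp: LIPb_def)
  then have "(\<bar>1/2\<bar> * (L + K))-lipschitz_on UNIV (\<lambda>x. (1/2) *\<^sub>R (f x + g x))"
    by (intro lipschitz_on_cmult lipschitz_on_add)
  moreover have "bounded (range (\<lambda>x. (f x + g x) / 2))"
  proof -
    obtain B C where BC: "\<And>x. \<bar>f x\<bar> \<le> B" "\<And>x. \<bar>g x\<bar> \<le> C"
      using assms by (auto simp: LIPb_def bounded_iff)
    have "\<bar>f x + g x\<bar> \<le> B + C" for x
      using abs_triangle_ineq[of "f x" "g x"] BC(1)[of x] BC(2)[of x] by linarith
    then have "\<bar>(f x + g x) / 2\<bar> \<le> (B + C) / 2" for x by simp
    then show ?thesis 
      unfolding bounded_iff by (intro exI[of _ "(B + C) / 2"]) auto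
  qed
  ultimately show ?thesis unfolding LIPb_def by auto
qed

lemma slope_midpoint:
  assumes f: "f \<in> LIPb UNIV" and g: "g \<in> LIPb UNIV"
  shows "slope (\<lambda>x. (f x + g x) / 2) x \<le> (slope f x + slope g x) / 2"
proof -
  obtain L K where LK: "L-lipschitz_on UNIV f" "K-lipschitz_on UNIV g"
    using assms by (auto simp: LIPb_def)
  have le: "enn2real (Lip (\<lambda>x. (f x + g x) / 2) A) \<le> (enn2real (Lip f A) + enn2real (Lip g A)) / 2" for A
  proof -
    have "Lip (\<lambda>x. (f x + g x) / 2) A \<le> ennreal ((enn2real (Lip f A) + enn2real (Lip g A)) / 2)"
      unfolding Lip_def[of "\<lambda>x. (f x + g x) / 2"]
    proof (intro SUP_least ennreal_leI)
      fix y z assume yz: "y \<in> A" "z \<in> A"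
      have "\<bar>f y - f z\<bar> \<le> enn2real (Lip f A) * dist y z" "\<bar>g y - g z\<bar> \<le> enn2real (Lip g A) * dist y z"
        using yz Lip_finite LK by (auto intro!: Lip_bound)
      then have "\<bar>(f y + g y) / 2 - (f z + g z) / 2\<bar>
          \<le> (enn2real (Lip f A) + enn2real (Lip g A)) / 2 * dist y z"
        by (simp add: abs_le_iff field_simps)
      then show "\<bar>(f y + g y) / 2 - (f z + g z) / 2\<bar> / dist y z
          \<le> (enn2real (Lip f A) + enn2real (Lip g A)) / 2"
        by (cases "y = z") (auto simp: divide_le_eq)
    qed
    from enn2real_mono[OF this] show ?thesis by simp
  qed
  have r: "(\<lambda>n. inverse (real (Suc n))) \<longlonglongrightarrow> 0" by (rule LIMSEQ_inverse_real_of_nat)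
  show ?thesis
  proof (rule LIMSEQ_le)
    show "(\<lambda>n. enn2real (Lip (\<lambda>x. (f x + g x) / 2) (ball x (inverse (real (Suc n))))))
        \<longlonglongrightarrow> slope (\<lambda>x. (f x + g x) / 2) x"
      by (intro Lip_tendsto_slope LIPb_midpoint f g r) auto
    show "(\<lambda>n. (enn2real (Lip f (ball x (inverse (real (Suc n)))))
        + enn2real (Lip g (ball x (inverse (real (Suc n)))))) / 2) \<longlonglongrightarrow> (slope f x + slope g x) / 2"
      by (intro tendsto_intros Lip_tendsto_slope f g r) auto
  qed (intro exI[of _ 0] allI impI le)
qed

lemma powr_abs_add_le:
  fixes a b p :: real
  assumes "0 \<le> p"
  shows "\<bar>a + b\<bar> powr p \<le> 2 powr p * (\<bar>a\<bar> powr p + \<bar>b\<bar> powr p)"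
proof -
  have "\<bar>a + b\<bar> powr p \<le> (2 * max \<bar>a\<bar> \<bar>b\<bar>) powr p"
    using assms by (intro powr_mono2) auto
  also have "\<dots> = 2 powr p * max \<bar>a\<bar> \<bar>b\<bar> powr p" by (simp add: powr_mult)
  also have "\<dots> \<le> 2 powr p * (\<bar>a\<bar> powr p + \<bar>b\<bar> powr p)"
    by (intro mult_left_mono) (auto simp: max_def)
  finally show ?thesis .
qed

lemma powr_midpoint_le:
  fixes a b p :: real
  assumes "1 \<le> p" "0 \<le> a" "0 \<le> b"
  shows "((a + b) / 2) powr p \<le> (a powr p + b powr p) / 2"
proof -
  have half: "(c / 2) powr p \<le> c powr p / 2" if "0 \<le> c" for c
  proof -
    have "(1 / 2 :: real) powr p \<le> (1 / 2) powr 1" using assms(1) by (intro powr_mono') auto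
    then show ?thesis
      using mult_left_mono[of "(1 / 2) powr p" "1 / 2" "c powr p"] that
      by (simp add: powr_mult[of c "1 / 2", simplified])
  qed
  consider "a = 0" | "b = 0" | "0 < a" "0 < b" using assms by linarith
  then show ?thesis
  proof cases
    case 3
    have "convex_on {0<..} (\<lambda>x::real. x powr p)" using assms(1) by (rule powr_convex)
    from convex_onD[OF this, of "1 / 2" a b] 3 show ?thesis by (simp add: field_simps)
  qed (use half assms in auto)
qed

lemma Lp_add:
  assumes "f \<in> Lp p M" "g \<in> Lp p M" "0 \<le> p"
  shows "(\<lambda>x. f x + g x) \<in> Lp p M"
proof -
  have [measurable]: "f \<in> borel_measurable M" "g \<in> borel_measurable M" using assms by (auto simp: Lp_def)
  have "integrable M (\<lambda>x. 2 powr p * (\<bar>f x\<bar> powr p + \<bar>g x\<bar> powr p))"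
    using assms by (auto simp: Lp_def)
  then have "integrable M (\<lambda>x. \<bar>f x + g x\<bar> powr p)"
    by (rule Bochner_Integration.integrable_bound) (use powr_abs_add_le[OF assms(3)] in auto)
  then show ?thesis by (simp add: Lp_def)
qed

lemma Lp_minus: "f \<in> Lp p M \<Longrightarrow> (\<lambda>x. - f x) \<in> Lp p M"
  by (simp add: Lp_def)

lemma Lp_diff: "f \<in> Lp p M \<Longrightarrow> g \<in> Lp p M \<Longrightarrow> 0 \<le> p \<Longrightarrow> (\<lambda>x. f x - g x) \<in> Lp p M"
  using Lp_add[OF _ Lp_minus, of f p M g] by simp

lemma Lp_bound:
  assumes "g \<in> Lp p M" "f \<in> borel_measurable M" "AE x in M. \<bar>f x\<bar> \<le> \<bar>g x\<bar>" "0 \<le> p"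
  shows "f \<in> Lp p M"
proof -
  have "integrable M (\<lambda>x. \<bar>f x\<bar> powr p)"
    by (rule Bochner_Integration.integrable_bound[of _ "\<lambda>x. \<bar>g x\<bar> powr p"])
      (use assms in \<open>auto simp: Lp_def intro: powr_mono2 elim!: eventually_mono\<close>)
  then show ?thesis using assms(2) by (simp add: Lp_def)
qed

lemma (in finite_measure) Lp_bounded:
  assumes "f \<in> borel_measurable M" "\<And>x. \<bar>f x\<bar> \<le> B" "0 \<le> p"
  shows "f \<in> Lp p M"
proof -
  have "integrable M (\<lambda>x. \<bar>f x\<bar> powr p)"
    by (rule integrable_const_bound[where B = "B powr p"]) (use assms in \<open>auto intro!: powr_mono2\<close>)
  then show ?thesis using assms(1) by (simp add: Lp_def)
qed

lemma Lp_integrable_diff: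
  assumes "f \<in> Lp p M" "g \<in> Lp p M" "0 \<le> p"
  shows "integrable M (\<lambda>x. \<bar>f x - g x\<bar> powr p)"
  using Lp_diff[OF assms] by (simp add: Lp_def)

lemma Lp_tendsto_trans:
  assumes gf: "\<And>n. g n \<in> Lp p M" "(\<lambda>n. \<integral>x. \<bar>g n x - f n x\<bar> powr p \<partial>M) \<longlonglongrightarrow> 0"
    and f: "Lp_tendsto p M f h" and "0 \<le> p"
  shows "Lp_tendsto p M g h"
proof -
  have L: "f n \<in> Lp p M" "h \<in> Lp p M" for n using f by (auto simp: Lp_tendsto_def)
  have "(\<lambda>n. \<integral>x. \<bar>g n x - h x\<bar> powr p \<partial>M) \<longlonglongrightarrow> 0"
  proof (rule tendsto_sandwich[OF _ _ tendsto_const])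
    have "(\<lambda>n. 2 powr p * ((\<integral>x. \<bar>g n x - f n x\<bar> powr p \<partial>M) + (\<integral>x. \<bar>f n x - h x\<bar> powr p \<partial>M)))
      \<longlonglongrightarrow> 2 powr p * (0 + 0)"
      using f gf by (intro tendsto_intros) (auto simp: Lp_tendsto_def)
    then show "(\<lambda>n. 2 powr p * ((\<integral>x. \<bar>g n x - f n x\<bar> powr p \<partial>M) + (\<integral>x. \<bar>f n x - h x\<bar> powr p \<partial>M)))
      \<longlonglongrightarrow> 0" by simp
    show "\<forall>\<^sub>F n in sequentially. (\<integral>x. \<bar>g n x - h x\<bar> powr p \<partial>M) \<le>
        2 powr p * ((\<integral>x. \<bar>g n x - f n x\<bar> powr p \<partial>M) + (\<integral>x. \<bar>f n x - h x\<bar> powr p \<partial>M))"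
    proof (intro always_eventually allI)
      fix n
      have i: "integrable M (\<lambda>x. \<bar>g n x - f n x\<bar> powr p)" "integrable M (\<lambda>x. \<bar>f n x - h x\<bar> powr p)"
        using Lp_integrable_diff L gf(1) \<open>0 \<le> p\<close> by blast+
      have "(\<integral>x. \<bar>g n x - h x\<bar> powr p \<partial>M)
          \<le> (\<integral>x. 2 powr p * (\<bar>g n x - f n x\<bar> powr p + \<bar>f n x - h x\<bar> powr p) \<partial>M)"
      proof (rule integral_mono)
        show "integrable M (\<lambda>x. \<bar>g n x - h x\<bar> powr p)"
          using Lp_integrable_diff L gf(1) \<open>0 \<le> p\<close> by blast
        show "\<bar>g n x - h x\<bar> powr p \<le> 2 powr p * (\<bar>g n x - f n x\<bar> powr p + \<bar>f n x - h x\<bar> powr p)" for x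
          using powr_abs_add_le[OF \<open>0 \<le> p\<close>, of "g n x - f n x" "f n x - h x"] by simp
      qed (use i in auto)
      also have "\<dots> = 2 powr p * ((\<integral>x. \<bar>g n x - f n x\<bar> powr p \<partial>M) + (\<integral>x. \<bar>f n x - h x\<bar> powr p \<partial>M))"
        using i by simp
      finally show "(\<integral>x. \<bar>g n x - h x\<bar> powr p \<partial>M) \<le>
        2 powr p * ((\<integral>x. \<bar>g n x - f n x\<bar> powr p \<partial>M) + (\<integral>x. \<bar>f n x - h x\<bar> powr p \<partial>M))" .
    qed
  qed (auto intro!: always_eventually)
  then show ?thesis using gf(1) L by (simp add: Lp_tendsto_def)
qed

lemma integral_powr_tendsto_0:
  fixes g :: "nat \<Rightarrow> 'a \<Rightarrow> real"
  assumes "finite_measure M" "0 < p" and g: "\<And>n. g n \<in> borel_measurable M"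
    and B: "\<And>n x. \<bar>g n x\<bar> \<le> B" and lim: "AE x in M. (\<lambda>n. g n x) \<longlonglongrightarrow> 0"
  shows "(\<lambda>n. \<integral>x. \<bar>g n x\<bar> powr p \<partial>M) \<longlonglongrightarrow> 0"
proof -
  interpret finite_measure M by fact
  have "(\<lambda>n. \<integral>x. \<bar>g n x\<bar> powr p \<partial>M) \<longlonglongrightarrow> (\<integral>x. 0 \<partial>M)"
  proof (rule integral_dominated_convergence[where w = "\<lambda>x. B powr p"])
    show "AE x in M. (\<lambda>n. \<bar>g n x\<bar> powr p) \<longlonglongrightarrow> 0"
      using lim
    proof eventually_elim
      case (elim x)
      show ?case
        by (rule tendsto_zero_powrI[OF tendsto_rabs_zero[OF elim] tendsto_const])
          (use \<open>0 < p\<close> in auto)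
    qed
    show "AE x in M. norm (\<bar>g n x\<bar> powr p) \<le> B powr p" for n
      using B \<open>0 < p\<close> by (auto intro!: powr_mono2)
  qed (use g in auto)
  then show ?thesis by simp
qed

lemma Cyl_approx_Lp:
  fixes f :: "'a::{real_normed_vector, second_countable_topology} \<Rightarrow> real"
  assumes M: "sets M = sets borel" "finite_measure M" and f: "f \<in> LIPb UNIV" and "0 < p" "0 < e"
  obtains u where "u \<in> Cyl" "slope u = dual_norm_diff u"
    "(\<integral>x. \<bar>u x - f x\<bar> powr p \<partial>M) < e" "(\<integral>x. \<bar>max 0 (slope u x - slope f x)\<bar> powr p \<partial>M) < e"
proof -
  interpret finite_measure M by fact
  obtain L C where L: "L-lipschitz_on UNIV f" and C: "\<And>x. \<bar>f x\<bar> \<le> C"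
    using f by (auto simp: LIPb_def bounded_iff)
  have C0: "0 \<le> C" using order_trans[OF abs_ge_zero C] .
  define h where "h n = (1 / 2 :: real) ^ n" for n
  have h: "0 < h n" "h n \<le> 1" for n by (auto simp: h_def power_le_one)
  have h0: "h \<longlonglongrightarrow> 0" unfolding h_def[abs_def] by (rule LIMSEQ_realpow_zero) auto
  have "\<forall>n. \<exists>u K. u \<in> Cyl \<and> K \<in> sets borel \<and> measure M (- K) \<le> h n \<and> (\<forall>x. \<bar>u x\<bar> \<le> C + 1) \<and>
      (\<forall>x. lip_a UNIV u x = ennreal (dual_norm_diff u x)) \<and>
      (\<forall>x. 0 \<le> dual_norm_diff u x) \<and> (\<forall>x. dual_norm_diff u x \<le> 2 * (L + 1)) \<and>
      (\<forall>x\<in>K. \<bar>u x - f x\<bar> \<le> h n) \<and>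
      (\<forall>x\<in>K. dual_norm_diff u x \<le> enn2real (Lip f (ball x (3 * h n))) + 2 * h n)"
    using cylindrical_approx_slope[OF M L C h h] by metis
  then obtain u K where u: "\<And>n. u n \<in> Cyl" "\<And>n. K n \<in> sets borel" "\<And>n. measure M (- K n) \<le> h n"
    "\<And>n x. \<bar>u n x\<bar> \<le> C + 1" "\<And>n x. lip_a UNIV (u n) x = ennreal (dual_norm_diff (u n) x)"
    "\<And>n x. 0 \<le> dual_norm_diff (u n) x" "\<And>n x. dual_norm_diff (u n) x \<le> 2 * (L + 1)"
    "\<And>n x. x \<in> K n \<Longrightarrow> \<bar>u n x - f x\<bar> \<le> h n"
    "\<And>n x. x \<in> K n \<Longrightarrow> dual_norm_diff (u n) x \<le> enn2real (Lip f (ball x (3 * h n))) + 2 * h n"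
    unfolding choice_iff by blast
  have slope_u: "slope (u n) = dual_norm_diff (u n)" for n
    by (rule ext) (simp add: slope_def u(5) u(6))
  have uL: "u n \<in> LIPb UNIV" for n using u(1) Cyl_subset_LIPb by blast
  have meas: "u n \<in> borel_measurable M" "f \<in> borel_measurable M"
      "slope (u n) \<in> borel_measurable M" "slope f \<in> borel_measurable M" for n
    using uL f by (auto simp: measurable_cong_sets[OF M(1) refl] LIPb_measurable slope_measurable)
  have "AE x in M. eventually (\<lambda>n. x \<in> space M - (- K n)) sequentially"
  proof (rule borel_cantelli_AE1)
    show "- K n \<in> sets M" for n using u(2) by (simp add: M(1))
    show "emeasure M (- K n) < \<infinity>" for n using emeasure_finite[of "- K n"] by (simp add: less_top[symmetric])
    show "summable (\<lambda>n. measure M (- K n))"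
    proof (rule summable_comparison_test')
      show "summable h" unfolding h_def[abs_def] by (rule summable_geometric) simp
      show "norm (measure M (- K n)) \<le> h n" if "n \<ge> 0" for n using u(3) by simp
    qed
  qed
  then have AE: "AE x in M. eventually (\<lambda>n. x \<in> K n) sequentially" by simp
  have "(\<lambda>n. \<integral>x. \<bar>u n x - f x\<bar> powr p \<partial>M) \<longlonglongrightarrow> 0"
  proof (rule integral_powr_tendsto_0[OF M(2) \<open>0 < p\<close>])
    show "\<bar>u n x - f x\<bar> \<le> 2 * C + 1" for n x using u(4)[of n x] C[of x] by linarith
    show "AE x in M. (\<lambda>n. u n x - f x) \<longlonglongrightarrow> 0"
      using AE
    proof eventually_elim
      case (elim x)
      then have "\<forall>\<^sub>F n in sequentially. norm (u n x - f x) \<le> h n"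
        by eventually_elim (use u(8) in auto)
      then show ?case using h0 by (rule Lim_null_comparison)
    qed
  qed (use meas in auto)
  then have 1: "\<forall>\<^sub>F n in sequentially. (\<integral>x. \<bar>u n x - f x\<bar> powr p \<partial>M) < e"
    using \<open>0 < e\<close> by (rule order_tendstoD)
  have "(\<lambda>n. \<integral>x. \<bar>max 0 (slope (u n) x - slope f x)\<bar> powr p \<partial>M) \<longlonglongrightarrow> 0"
  proof (rule integral_powr_tendsto_0[OF M(2) \<open>0 < p\<close>])
    show "\<bar>max 0 (slope (u n) x - slope f x)\<bar> \<le> 2 * (L + 1)" for n x
      using u(7)[of n x] slope_nonneg[of f x] lipschitz_on_nonneg[OF L] by (simp add: slope_u)
    show "AE x in M. (\<lambda>n. max 0 (slope (u n) x - slope f x)) \<longlonglongrightarrow> 0"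
      using AE
    proof eventually_elim
      case (elim x)
      have "(\<lambda>n. 3 * h n) \<longlonglongrightarrow> 3 * 0" by (intro tendsto_intros h0)
      then have "(\<lambda>n. enn2real (Lip f (ball x (3 * h n)))) \<longlonglongrightarrow> slope f x"
        using h by (intro Lip_tendsto_slope[OF f]) auto
      then have "(\<lambda>n. \<bar>enn2real (Lip f (ball x (3 * h n))) - slope f x\<bar> + 2 * h n)
          \<longlonglongrightarrow> \<bar>slope f x - slope f x\<bar> + 2 * 0"
        by (intro tendsto_add tendsto_rabs tendsto_diff tendsto_mult tendsto_const h0)
      then have lim: "(\<lambda>n. \<bar>enn2real (Lip f (ball x (3 * h n))) - slope f x\<bar> + 2 * h n) \<longlonglongrightarrow> 0"
        by simp
      have "\<forall>\<^sub>F n in sequentially. norm (max 0 (slope (u n) x - slope f x))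
          \<le> \<bar>enn2real (Lip f (ball x (3 * h n))) - slope f x\<bar> + 2 * h n"
        using elim
      proof eventually_elim
        case (elim n)
        show ?case using u(9)[OF elim] h[of n] by (simp add: slope_u)
      qed
      then show ?case using lim by (rule Lim_null_comparison)
    qed
  qed (use meas in auto)
  then have "\<forall>\<^sub>F n in sequentially. (\<integral>x. \<bar>max 0 (slope (u n) x - slope f x)\<bar> powr p \<partial>M) < e"
    using \<open>0 < e\<close> by (rule order_tendstoD)
  with 1 have "\<forall>\<^sub>F n in sequentially. (\<integral>x. \<bar>u n x - f x\<bar> powr p \<partial>M) < e \<and>
      (\<integral>x. \<bar>max 0 (slope (u n) x - slope f x)\<bar> powr p \<partial>M) < e"
    by eventually_elim simp
  then obtain n where "(\<integral>x. \<bar>u n x - f x\<bar> powr p \<partial>M) < e"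
      "(\<integral>x. \<bar>max 0 (slope (u n) x - slope f x)\<bar> powr p \<partial>M) < e"
    using eventually_happens'[OF sequentially_bot] by blast
  then show ?thesis using that u(1) slope_u by blast
qed

section \<open>Convergence to the minimal relaxed slope\<close>

lemma powr_midpoint_abs_le:
  fixes a b c p :: real
  assumes "1 \<le> p" "\<bar>c\<bar> \<le> (\<bar>a\<bar> + \<bar>b\<bar>) / 2"
  shows "\<bar>c\<bar> powr p \<le> (\<bar>a\<bar> powr p + \<bar>b\<bar> powr p) / 2"
proof -
  have "\<bar>c\<bar> powr p \<le> ((\<bar>a\<bar> + \<bar>b\<bar>) / 2) powr p" using assms by (intro powr_mono2) auto
  also have "\<dots> \<le> (\<bar>a\<bar> powr p + \<bar>b\<bar> powr p) / 2" using assms(1) by (intro powr_midpoint_le) auto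
  finally show ?thesis .
qed

lemma integral_powr_midpoint_less:
  fixes a b c :: "'a \<Rightarrow> real"
  assumes "1 \<le> p" "a \<in> Lp p M" "b \<in> Lp p M" "c \<in> Lp p M" "\<And>x. \<bar>c x\<bar> \<le> (\<bar>a x\<bar> + \<bar>b x\<bar>) / 2"
    and "(\<integral>x. \<bar>a x\<bar> powr p \<partial>M) < e" "(\<integral>x. \<bar>b x\<bar> powr p \<partial>M) < e"
  shows "(\<integral>x. \<bar>c x\<bar> powr p \<partial>M) < e"
proof -
  have i: "integrable M (\<lambda>x. \<bar>a x\<bar> powr p)" "integrable M (\<lambda>x. \<bar>b x\<bar> powr p)"
    "integrable M (\<lambda>x. \<bar>c x\<bar> powr p)"
    using assms by (auto simp: Lp_def)
  have "(\<integral>x. \<bar>c x\<bar> powr p \<partial>M) \<le> (\<integral>x. (\<bar>a x\<bar> powr p + \<bar>b x\<bar> powr p) / 2 \<partial>M)"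
    using i assms by (intro integral_mono powr_midpoint_abs_le) auto
  also have "\<dots> = ((\<integral>x. \<bar>a x\<bar> powr p \<partial>M) + (\<integral>x. \<bar>b x\<bar> powr p \<partial>M)) / 2"
    using i by simp
  finally show ?thesis using assms(6,7) by simp
qed

lemma (in finite_measure) Lp_integrable:
  assumes "1 \<le> p" "g \<in> Lp p M"
  shows "integrable M g"
proof (rule Bochner_Integration.integrable_bound)
  show "integrable M (\<lambda>x. 1 + \<bar>g x\<bar> powr p)" using assms by (auto simp: Lp_def)
  have "\<bar>a\<bar> \<le> 1 + \<bar>a\<bar> powr p" for a :: real
  proof (cases "\<bar>a\<bar> \<le> 1")
    case False
    then have "\<bar>a\<bar> powr 1 \<le> \<bar>a\<bar> powr p" using assms(1) by (intro powr_mono) auto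
    then show ?thesis by simp
  qed (simp add: add_increasing2)
  then show "AE x in M. norm (g x) \<le> norm (1 + \<bar>g x\<bar> powr p)"
    by (intro AE_I2) (simp add: add_nonneg_nonneg)
qed (use assms in \<open>auto simp: Lp_def\<close>)

lemma (in finite_measure) integral_abs_tendsto_0:
  fixes g :: "nat \<Rightarrow> 'a \<Rightarrow> real"
  assumes p: "1 \<le> p" and g: "\<And>n. g n \<in> Lp p M" and lim: "(\<lambda>n. \<integral>x. \<bar>g n x\<bar> powr p \<partial>M) \<longlonglongrightarrow> 0"
  shows "(\<lambda>n. \<integral>x. \<bar>g n x\<bar> \<partial>M) \<longlonglongrightarrow> 0"
proof (rule LIMSEQ_I)
  fix e :: real assume "0 < e"
  define m where "m = measure M (space M)"
  define \<eta> where "\<eta> = e / (2 * (m + 1))"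
  have m: "0 \<le> m" by (simp add: m_def)
  have \<eta>: "0 < \<eta>" using \<open>0 < e\<close> m by (simp add: \<eta>_def)
  have \<eta>m: "\<eta> * m < e"
  proof -
    have "\<eta> * m < \<eta> * (2 * (m + 1))" using m \<eta> by (intro mult_strict_left_mono) auto
    also have "\<dots> = e" using m by (simp add: \<eta>_def)
    finally show ?thesis .
  qed
  have a_le: "\<bar>a\<bar> \<le> \<eta> + \<eta> powr (1 - p) * \<bar>a\<bar> powr p" for a :: real
  proof (cases "\<bar>a\<bar> \<le> \<eta>")
    case False
    then have "\<bar>a\<bar> powr (1 - p) \<le> \<eta> powr (1 - p)" using \<eta> p by (intro powr_mono2') auto
    then have "\<bar>a\<bar> powr (1 - p) * \<bar>a\<bar> powr p \<le> \<eta> powr (1 - p) * \<bar>a\<bar> powr p"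
      by (intro mult_right_mono) auto
    moreover have "\<bar>a\<bar> powr (1 - p) * \<bar>a\<bar> powr p = \<bar>a\<bar>"
      by (simp add: powr_add[symmetric])
    ultimately show ?thesis using \<eta> by linarith
  qed (simp add: add_increasing2)
  have le: "(\<integral>x. \<bar>g n x\<bar> \<partial>M) \<le> \<eta> * m + \<eta> powr (1 - p) * (\<integral>x. \<bar>g n x\<bar> powr p \<partial>M)" for n
  proof -
    have i: "integrable M (\<lambda>x. \<bar>g n x\<bar> powr p)" using g by (auto simp: Lp_def)
    have "(\<integral>x. \<bar>g n x\<bar> \<partial>M) \<le> (\<integral>x. \<eta> + \<eta> powr (1 - p) * \<bar>g n x\<bar> powr p \<partial>M)"
      using i a_le Lp_integrable[OF p g] by (intro integral_mono) auto
    also have "\<dots> = \<eta> * m + \<eta> powr (1 - p) * (\<integral>x. \<bar>g n x\<bar> powr p \<partial>M)"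
      using i by (simp add: m_def mult.commute)
    finally show ?thesis .
  qed
  have "(\<lambda>n. \<eta> * m + \<eta> powr (1 - p) * (\<integral>x. \<bar>g n x\<bar> powr p \<partial>M)) \<longlonglongrightarrow> \<eta> * m + \<eta> powr (1 - p) * 0"
    by (intro tendsto_intros lim)
  then have "\<forall>\<^sub>F n in sequentially. \<eta> * m + \<eta> powr (1 - p) * (\<integral>x. \<bar>g n x\<bar> powr p \<partial>M) < e"
    using \<eta>m by (intro order_tendstoD(2)) auto
  then have "\<forall>\<^sub>F n in sequentially. norm ((\<integral>x. \<bar>g n x\<bar> \<partial>M) - 0) < e"
  proof eventually_elim
    case (elim n)
    have "0 \<le> (\<integral>x. \<bar>g n x\<bar> \<partial>M)" by (rule integral_nonneg_AE) simp
    then show ?case using le[of n] elim by simp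
  qed
  then show "\<exists>N. \<forall>n\<ge>N. norm ((\<integral>x. \<bar>g n x\<bar> \<partial>M) - 0) < e" by (simp add: eventually_sequentially)
qed

text \<open>A nondecreasing convex function whose midpoint convexity gap at \<open>(s, t)\<close> is
  \<open>(exp (- s / 2) - exp (- t / 2))\<^sup>2 / 2\<close>.\<close>

definition cvx :: "real \<Rightarrow> real" where
  "cvx t = t + exp (- t)"

lemma cvx_mono:
  assumes "0 \<le> s" "s \<le> t"
  shows "cvx s \<le> cvx t" "cvx t \<le> cvx s + (t - s)"
proof -
  have "exp (- s) - exp (- t) = exp (- s) * (1 - exp (- (t - s)))"
    by (simp add: algebra_simps exp_add[symmetric])
  also have "\<dots> \<le> 1 * (t - s)"
  proof (rule mult_mono)
    show "1 - exp (- (t - s)) \<le> t - s" using exp_ge_add_one_self[of "- (t - s)"] by linarith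
  qed (use assms in auto)
  finally show "cvx s \<le> cvx t" by (simp add: cvx_def)
  show "cvx t \<le> cvx s + (t - s)" using assms by (simp add: cvx_def)
qed

lemma cvx_midpoint: "cvx ((s + t) / 2) = (cvx s + cvx t) / 2 - (exp (- s / 2) - exp (- t / 2))\<^sup>2 / 2"
proof -
  have "exp (- s) = exp (- s / 2) * exp (- s / 2)" "exp (- t) = exp (- t / 2) * exp (- t / 2)"
    "exp (- ((s + t) / 2)) = exp (- s / 2) * exp (- t / 2)"
    by (simp_all add: exp_add[symmetric] add_divide_distrib)
  then show ?thesis by (simp add: cvx_def power2_eq_square field_simps)
qed

lemma cvx_nonneg: "0 \<le> t \<Longrightarrow> 0 \<le> cvx t"
  by (simp add: cvx_def)

locale minimal_slope = finite_measure M
  for M :: "'a::{real_normed_vector, second_countable_topology} measure" +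
  fixes p :: real and f G :: "'a \<Rightarrow> real"
  assumes sets_M: "sets M = sets borel" and p: "1 \<le> p" and f: "f \<in> Lp p M"
    and minimal: "minimal_relaxed_slope p M f G"
begin

lemma G_Lp: "G \<in> Lp p M" and G_nonneg: "AE x in M. 0 \<le> G x"
  using minimal by (auto simp: minimal_relaxed_slope_def relaxed_slope_def)

lemma measurable_M: "g \<in> borel_measurable M \<longleftrightarrow> g \<in> borel_measurable borel"
  by (simp add: measurable_cong_sets[OF sets_M refl])

lemma G_measurable [measurable]: "G \<in> borel_measurable M" and f_measurable [measurable]: "f \<in> borel_measurable M"
  using G_Lp f by (auto simp: Lp_def)

lemma LIPb_Lp:
  assumes "h \<in> LIPb UNIV"
  shows "h \<in> Lp p M"
proof -
  obtain B where "\<And>x. \<bar>h x\<bar> \<le> B" using assms by (auto simp: LIPb_def bounded_iff)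
  then show ?thesis using LIPb_measurable[OF assms] p by (intro Lp_bounded[where B = B]) (simp_all add: measurable_M)
qed

lemma slope_Lp: "h \<in> LIPb UNIV \<Longrightarrow> slope h \<in> Lp p M"
proof -
  assume h: "h \<in> LIPb UNIV"
  then obtain L where "L-lipschitz_on UNIV h" by (auto simp: LIPb_def)
  then have "\<bar>slope h x\<bar> \<le> L" for x using slope_nonneg[of h x] slope_le[of L h x] by simp
  then show "slope h \<in> Lp p M"
    using slope_measurable[OF h] p by (intro Lp_bounded[where B = L]) (auto simp: measurable_M)
qed

lemma Lp_max_0:
  assumes "g \<in> Lp p M"
  shows "(\<lambda>x. max 0 (g x)) \<in> Lp p M"
proof (rule Lp_bound[OF assms])
  show "(\<lambda>x. max 0 (g x)) \<in> borel_measurable M" using assms by (auto simp: Lp_def)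
qed (use p in auto)

definition excess :: "('a \<Rightarrow> real) \<Rightarrow> 'a \<Rightarrow> real" where
  "excess h x = max 0 (slope h x - G x)"

lemma excess_Lp: "h \<in> LIPb UNIV \<Longrightarrow> excess h \<in> Lp p M"
  unfolding excess_def[abs_def] using Lp_max_0[OF Lp_diff[OF slope_Lp G_Lp]] p by simp

definition near :: "nat \<Rightarrow> ('a \<Rightarrow> real) set" where
  "near n = {h \<in> LIPb UNIV. (\<integral>x. \<bar>h x - f x\<bar> powr p \<partial>M) < 1 / Suc n \<and>
     (\<integral>x. \<bar>excess h x\<bar> powr p \<partial>M) < 1 / Suc n}"

lemma near_LIPb: "h \<in> near n \<Longrightarrow> h \<in> LIPb UNIV"
  by (simp add: near_def)

lemma near_antimono: "m \<le> n \<Longrightarrow> near n \<subseteq> near m"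
proof -
  assume "m \<le> n"
  then have "1 / real (Suc n) \<le> 1 / real (Suc m)" by (simp add: field_simps)
  then have "x < 1 / real (Suc n) \<Longrightarrow> x < 1 / real (Suc m)" for x by linarith
  then show "near n \<subseteq> near m" unfolding near_def by blast
qed

lemma near_midpoint:
  assumes "h \<in> near n" "k \<in> near n"
  shows "(\<lambda>x. (h x + k x) / 2) \<in> near n"
proof -
  have L: "h \<in> LIPb UNIV" "k \<in> LIPb UNIV" using assms near_LIPb by auto
  have mid: "(\<lambda>x. (h x + k x) / 2) \<in> LIPb UNIV" by (rule LIPb_midpoint[OF L])
  have "(\<integral>x. \<bar>(h x + k x) / 2 - f x\<bar> powr p \<partial>M) < 1 / Suc n"
  proof (rule integral_powr_midpoint_less[OF p])
    show "(\<lambda>x. h x - f x) \<in> Lp p M" "(\<lambda>x. k x - f x) \<in> Lp p M"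
      "(\<lambda>x. (h x + k x) / 2 - f x) \<in> Lp p M"
      using p by (auto intro!: Lp_diff LIPb_Lp[OF L(1)] LIPb_Lp[OF L(2)] LIPb_Lp[OF mid] f)
    show "\<bar>(h x + k x) / 2 - f x\<bar> \<le> (\<bar>h x - f x\<bar> + \<bar>k x - f x\<bar>) / 2" for x
    proof -
      have *: "(h x + k x) / 2 - f x = ((h x - f x) + (k x - f x)) / 2" by (simp add: field_simps)
      show ?thesis unfolding * abs_divide
        using divide_right_mono[OF abs_triangle_ineq[of "h x - f x" "k x - f x"], of 2] by simp
    qed
  qed (use assms in \<open>auto simp: near_def\<close>)
  moreover have "(\<integral>x. \<bar>excess (\<lambda>x. (h x + k x) / 2) x\<bar> powr p \<partial>M) < 1 / Suc n"
  proof (rule integral_powr_midpoint_less[OF p excess_Lp excess_Lp excess_Lp])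
    show "\<bar>excess (\<lambda>x. (h x + k x) / 2) x\<bar> \<le> (\<bar>excess h x\<bar> + \<bar>excess k x\<bar>) / 2" for x
    proof -
      have "max 0 (s - g) \<le> (max 0 (a - g) + max 0 (b - g)) / 2" if "s \<le> (a + b) / 2"
        for s a b g :: real
        using that by (auto simp: max_def field_simps)
      from this[OF slope_midpoint[OF L]] show ?thesis by (simp add: excess_def)
    qed
  qed (use assms L mid in \<open>auto simp: near_def\<close>)
  ultimately show ?thesis using mid by (simp add: near_def)
qed

definition energy :: "('a \<Rightarrow> real) \<Rightarrow> real" where
  "energy h = (\<integral>x. cvx (h x) \<partial>M)"

lemma cvx_integrable:
  assumes "g \<in> Lp p M" "AE x in M. 0 \<le> g x"
  shows "integrable M (\<lambda>x. cvx (g x))"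
proof (rule Bochner_Integration.integrable_bound)
  show "integrable M (\<lambda>x. \<bar>g x\<bar> + 1)" using Lp_integrable[OF p assms(1)] by simp
  show "AE x in M. norm (cvx (g x)) \<le> norm (\<bar>g x\<bar> + 1)"
    using assms(2) by eventually_elim (simp add: cvx_def add_nonneg_nonneg)
  show "(\<lambda>x. cvx (g x)) \<in> borel_measurable M" using assms(1) by (auto simp: Lp_def cvx_def[abs_def])
qed

lemma cvx_slope_integrable: "h \<in> LIPb UNIV \<Longrightarrow> integrable M (\<lambda>x. cvx (slope h x))"
  by (intro cvx_integrable slope_Lp) (auto simp: slope_nonneg)

lemma energy_gap:
  assumes "h \<in> LIPb UNIV" "k \<in> LIPb UNIV"
  shows "(\<integral>x. (exp (- slope h x / 2) - exp (- slope k x / 2))\<^sup>2 \<partial>M) \<le>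
    energy (slope h) + energy (slope k) - 2 * energy (slope (\<lambda>x. (h x + k x) / 2))"
proof -
  define d where "d x = (exp (- slope h x / 2) - exp (- slope k x / 2))\<^sup>2" for x
  note i = assms[THEN cvx_slope_integrable]
  note [measurable] = assms[THEN slope_measurable, folded measurable_M]
  have d: "d x \<le> cvx (slope h x) + cvx (slope k x) - 2 * cvx (slope (\<lambda>x. (h x + k x) / 2) x)" for x
  proof -
    have *: "D \<le> a + b - 2 * c" if "c \<le> e" "e = (a + b) / 2 - D / 2" for a b c D e :: real
      using that by (simp add: field_simps)
    show ?thesis
      unfolding d_def
      by (rule *[OF cvx_mono(1)[OF slope_nonneg slope_midpoint[OF assms]] cvx_midpoint])
  qed
  have di: "integrable M d"
  proof (rule integrable_const_bound[where B = 1])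
    have "d x \<le> 1" for x
    proof -
      have "\<bar>exp (- slope h x / 2) - exp (- slope k x / 2)\<bar> \<le> 1"
      proof -
        have "0 < exp (- slope g x / 2)" "exp (- slope g x / 2) \<le> 1" for g
          using slope_nonneg[of g x] by auto
        from this[of h] this[of k] show ?thesis by linarith
      qed
      then show ?thesis unfolding d_def by (simp add: abs_square_le_1)
    qed
    then show "AE x in M. norm (d x) \<le> 1" by (simp add: d_def)
  qed (simp add: d_def[abs_def])
  have "(\<integral>x. d x \<partial>M) \<le> (\<integral>x. cvx (slope h x) + cvx (slope k x) - 2 * cvx (slope (\<lambda>x. (h x + k x) / 2) x) \<partial>M)"
    using di i cvx_slope_integrable[OF LIPb_midpoint[OF assms]] d by (intro integral_mono) auto
  also have "\<dots> = energy (slope h) + energy (slope k) - 2 * energy (slope (\<lambda>x. (h x + k x) / 2))"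
    unfolding energy_def using i cvx_slope_integrable[OF LIPb_midpoint[OF assms]] by simp
  finally show ?thesis by (simp add: d_def)
qed

lemma near_tendsto:
  assumes "\<And>n. h n \<in> near n"
  shows near_tendsto_f: "(\<lambda>n. \<integral>x. \<bar>h n x - f x\<bar> powr p \<partial>M) \<longlonglongrightarrow> 0"
    and near_tendsto_excess: "(\<lambda>n. \<integral>x. \<bar>excess (h n) x\<bar> powr p \<partial>M) \<longlonglongrightarrow> 0"
proof -
  have 0: "(\<lambda>n. 1 / real (Suc n)) \<longlonglongrightarrow> 0" using LIMSEQ_inverse_real_of_nat by (simp add: inverse_eq_divide)
  have le: "(\<integral>x. \<bar>h n x - f x\<bar> powr p \<partial>M) \<le> 1 / Suc n" "(\<integral>x. \<bar>excess (h n) x\<bar> powr p \<partial>M) \<le> 1 / Suc n" for n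
    using assms[of n] by (auto simp: near_def)
  have nn: "0 \<le> (\<integral>x. \<bar>g x\<bar> powr p \<partial>M)" for g :: "'a \<Rightarrow> real"
    by (rule integral_nonneg_AE) simp
  show "(\<lambda>n. \<integral>x. \<bar>h n x - f x\<bar> powr p \<partial>M) \<longlonglongrightarrow> 0"
    "(\<lambda>n. \<integral>x. \<bar>excess (h n) x\<bar> powr p \<partial>M) \<longlonglongrightarrow> 0"
    by (rule tendsto_sandwich[OF _ _ tendsto_const 0]; intro always_eventually allI nn le)+
qed

lemma near_Lp_tendsto_f:
  assumes "\<And>n. h n \<in> near n"
  shows "Lp_tendsto p M h f"
  using near_tendsto_f[OF assms] LIPb_Lp[OF near_LIPb[OF assms]] f by (simp add: Lp_tendsto_def)

lemma near_tendsto_excess_L1: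
  assumes "\<And>n. h n \<in> near n"
  shows "(\<lambda>n. \<integral>x. \<bar>excess (h n) x\<bar> \<partial>M) \<longlonglongrightarrow> 0"
  by (rule integral_abs_tendsto_0[OF p excess_Lp[OF near_LIPb[OF assms]] near_tendsto_excess[OF assms]])

lemma energy_le_excess:
  assumes "h \<in> LIPb UNIV"
  shows "energy (slope h) \<le> energy G + (\<integral>x. \<bar>excess h x\<bar> \<partial>M)"
proof -
  have i: "integrable M (excess h)" by (rule Lp_integrable[OF p excess_Lp[OF assms]])
  have "energy (slope h) \<le> (\<integral>x. cvx (G x) + \<bar>excess h x\<bar> \<partial>M)"
    unfolding energy_def
  proof (rule integral_mono_AE)
    show "AE x in M. cvx (slope h x) \<le> cvx (G x) + \<bar>excess h x\<bar>"
      using G_nonneg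
    proof eventually_elim
      case (elim x)
      show ?case
      proof (cases "slope h x \<le> G x")
        case True
        then show ?thesis using cvx_mono(1)[OF slope_nonneg True] by simp
      next
        case False
        then show ?thesis using cvx_mono(2)[of "G x" "slope h x"] elim by (simp add: excess_def)
      qed
    qed
  qed (use cvx_slope_integrable[OF assms] cvx_integrable[OF G_Lp G_nonneg] i in auto)
  also have "\<dots> = energy G + (\<integral>x. \<bar>excess h x\<bar> \<partial>M)"
    unfolding energy_def using cvx_integrable[OF G_Lp G_nonneg] i by simp
  finally show ?thesis .
qed

lemma energy_slope_nonneg: "0 \<le> energy (slope h)"
  unfolding energy_def by (rule integral_nonneg_AE) (simp add: cvx_nonneg slope_nonneg)

lemma near_nonempty: "near n \<noteq> {}"
proof -
  obtain fs where fs: "\<And>n. fs n \<in> LIPb UNIV" "Lp_tendsto p M fs f"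
    "Lp_tendsto p M (\<lambda>n x. enn2real (lip_a UNIV (fs n) x)) G"
    using minimal by (auto simp: minimal_relaxed_slope_def relaxed_slope_def)
  have "\<forall>\<^sub>F k in sequentially. (\<integral>x. \<bar>fs k x - f x\<bar> powr p \<partial>M) < 1 / Suc n"
    using fs(2) by (intro order_tendstoD(2)[where y = 0]) (auto simp: Lp_tendsto_def)
  moreover have "\<forall>\<^sub>F k in sequentially. (\<integral>x. \<bar>slope (fs k) x - G x\<bar> powr p \<partial>M) < 1 / Suc n"
    using fs(3) by (intro order_tendstoD(2)[where y = 0]) (auto simp: Lp_tendsto_def slope_def)
  ultimately have "\<forall>\<^sub>F k in sequentially. fs k \<in> near n"
  proof eventually_elim
    case (elim k)
    have "(\<integral>x. \<bar>excess (fs k) x\<bar> powr p \<partial>M) \<le> (\<integral>x. \<bar>slope (fs k) x - G x\<bar> powr p \<partial>M)"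
    proof (rule integral_mono)
      show "integrable M (\<lambda>x. \<bar>excess (fs k) x\<bar> powr p)"
        using excess_Lp[OF fs(1)] by (simp add: Lp_def)
      show "integrable M (\<lambda>x. \<bar>slope (fs k) x - G x\<bar> powr p)"
        using Lp_integrable_diff[OF slope_Lp[OF fs(1)] G_Lp] p by simp
      show "\<bar>excess (fs k) x\<bar> powr p \<le> \<bar>slope (fs k) x - G x\<bar> powr p" for x
        using p by (intro powr_mono2) (auto simp: excess_def)
    qed
    then show ?case using elim fs(1) by (simp add: near_def)
  qed
  then show ?thesis using eventually_happens'[OF sequentially_bot] by blast
qed

lemma exp_slope_Cauchy_subseq:
  assumes h: "\<And>n. h n \<in> near n"
    and energy: "(\<lambda>n. energy (slope (h n))) \<longlonglongrightarrow> m"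
    and lower: "\<And>n k. k \<in> near n \<Longrightarrow> c n \<le> energy (slope k)" "c \<longlonglongrightarrow> m"
  obtains r where "strict_mono r" "AE x in M. Cauchy (\<lambda>i. exp (- slope (h (r i)) x / 2))"
proof -
  define u where "u n x = exp (- slope (h n) x / 2)" for n x
  have L: "h n \<in> LIPb UNIV" for n using h near_LIPb by blast
  have [measurable]: "slope (h n) \<in> borel_measurable M" for n
    using slope_Lp[OF L] by (simp add: Lp_def)
  have u_meas [measurable]: "u n \<in> borel_measurable M" for n unfolding u_def[abs_def] by simp
  have u01: "0 \<le> u n x" "u n x \<le> 1" for n x using slope_nonneg[of "h n" x] by (auto simp: u_def)
  have iu: "integrable M (u n)" for n
    by (rule integrable_const_bound[where B = 1]) (use u01 in auto)
  have "\<exists>N. \<forall>i\<ge>N. \<forall>j\<ge>N. (LINT x|M. norm (u i x - u j x)) < e" if "0 < e" for e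
  proof -
    define \<eta> where "\<eta> = e / (2 * (measure M (space M) + 1))"
    have \<eta>: "0 < \<eta>" using \<open>0 < e\<close> by (simp add: \<eta>_def add_nonneg_pos)
    have \<eta>m: "\<eta> * measure M (space M) \<le> e / 2"
    proof -
      have "\<eta> * measure M (space M) \<le> \<eta> * (measure M (space M) + 1)" using \<eta> by simp
      also have "\<dots> = e / 2"
      proof -
        have "measure M (space M) + 1 \<noteq> 0"
          using add_nonneg_pos[OF measure_nonneg[of M "space M"] zero_less_one] by simp
        then show ?thesis by (simp add: \<eta>_def divide_eq_eq)
      qed
      finally show ?thesis .
    qed
    define \<delta> where "\<delta> = \<eta> * e / 16"
    have \<delta>: "0 < \<delta>" using \<eta> \<open>0 < e\<close> by (simp add: \<delta>_def)
    have "\<forall>\<^sub>F n in sequentially. energy (slope (h n)) < m + \<delta>" "\<forall>\<^sub>F n in sequentially. m - \<delta> < c n"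
      using \<delta> by (auto intro: order_tendstoD[OF energy] order_tendstoD[OF lower(2)])
    then have "\<forall>\<^sub>F n in sequentially. energy (slope (h n)) < m + \<delta> \<and> m - \<delta> < c n"
      by (rule eventually_conj)
    then obtain N where N: "\<And>n. n \<ge> N \<Longrightarrow> energy (slope (h n)) < m + \<delta>" "m - \<delta> < c N"
      by (auto simp: eventually_sequentially)
    have "(LINT x|M. norm (u i x - u j x)) < e" if ij: "i \<ge> N" "j \<ge> N" for i j
    proof -
      have isq: "integrable M (\<lambda>x. (u i x - u j x)\<^sup>2)"
      proof (rule integrable_const_bound[where B = 1])
        have "\<bar>u i x - u j x\<bar> \<le> 1" for x using u01[of i x] u01[of j x] by linarith
        then show "AE x in M. norm ((u i x - u j x)\<^sup>2) \<le> 1" by (simp add: abs_square_le_1)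
      qed simp
      have "c N \<le> energy (slope (\<lambda>x. (h i x + h j x) / 2))"
        using near_antimono[OF ij(1)] near_antimono[OF ij(2)] h by (intro lower near_midpoint) auto
      then have "(LINT x|M. (u i x - u j x)\<^sup>2) \<le> 4 * \<delta>"
        using energy_gap[OF L L, of i j] N(1)[OF ij(1)] N(1)[OF ij(2)] N(2) unfolding u_def by linarith
      moreover have "(LINT x|M. norm (u i x - u j x)) \<le> (LINT x|M. \<eta> + (1 / \<eta>) * (u i x - u j x)\<^sup>2)"
      proof (rule integral_mono)
        show "norm (u i x - u j x) \<le> \<eta> + (1 / \<eta>) * (u i x - u j x)\<^sup>2" for x
        proof (cases "\<bar>u i x - u j x\<bar> \<le> \<eta>")
          case False
          then have "\<eta> * \<bar>u i x - u j x\<bar> \<le> \<bar>u i x - u j x\<bar> * \<bar>u i x - u j x\<bar>"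
            by (intro mult_right_mono) auto
          then have "\<bar>u i x - u j x\<bar> \<le> (1 / \<eta>) * (u i x - u j x)\<^sup>2"
            using \<eta> by (simp add: field_simps power2_eq_square abs_mult_self_eq)
          then show ?thesis using \<eta> by simp
        qed (use \<eta> in \<open>simp add: add_increasing2\<close>)
      qed (use iu isq in auto)
      moreover have "\<dots> = \<eta> * measure M (space M) + (1 / \<eta>) * (LINT x|M. (u i x - u j x)\<^sup>2)"
        using isq by (simp add: mult.commute)
      moreover have "(1 / \<eta>) * (LINT x|M. (u i x - u j x)\<^sup>2) \<le> (1 / \<eta>) * (4 * \<delta>)"
        using calculation(1) \<eta> by (intro mult_left_mono) auto
      moreover have "(1 / \<eta>) * (4 * \<delta>) = e / 4" using \<eta> by (simp add: \<delta>_def)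
      ultimately show ?thesis using \<eta>m \<open>0 < e\<close> by linarith
    qed
    then show ?thesis by blast
  qed
  from cauchy_L1_AE_cauchy_subseq[of M u, OF iu this] show ?thesis
    using that unfolding u_def by blast
qed

lemma minimizing_tendsto_G:
  assumes h: "\<And>n. h n \<in> near n"
    and energy: "(\<lambda>n. energy (slope (h n))) \<longlonglongrightarrow> m"
    and lower: "\<And>n k. k \<in> near n \<Longrightarrow> c n \<le> energy (slope k)" "c \<longlonglongrightarrow> m"
  obtains r where "strict_mono r" "Lp_tendsto p M (\<lambda>n. slope (h (r n))) G"
proof -
  have p0: "0 < p" "0 \<le> p" using p by auto
  obtain r1 where r1: "strict_mono r1" "AE x in M. Cauchy (\<lambda>i. exp (- slope (h (r1 i)) x / 2))"
    using exp_slope_Cauchy_subseq[OF assms] .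
  have L: "h n \<in> LIPb UNIV" for n using h near_LIPb by blast
  have ex_i: "integrable M (\<lambda>x. \<bar>excess (h n) x\<bar> powr p)" for n
    using excess_Lp[OF L] by (simp add: Lp_def)
  have "(\<lambda>n. LINT x|M. norm (\<bar>excess (h (r1 n)) x\<bar> powr p)) \<longlonglongrightarrow> 0"
    using LIMSEQ_subseq_LIMSEQ[OF near_tendsto_excess[OF h] r1(1)] by (simp add: o_def)
  then obtain r2 where r2: "strict_mono r2" "AE x in M. (\<lambda>n. \<bar>excess (h (r1 (r2 n))) x\<bar> powr p) \<longlonglongrightarrow> 0"
    using tendsto_L1_AE_subseq[of M "\<lambda>n x. \<bar>excess (h (r1 n)) x\<bar> powr p", OF ex_i] by auto
  define r where "r n = r1 (r2 n)" for n
  have r: "strict_mono r" using strict_mono_o[OF r1(1) r2(1)] by (simp add: o_def r_def[abs_def])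
  define s where "s n = slope (h (r n))" for n
  have s_Lp: "s n \<in> Lp p M" for n unfolding s_def by (rule slope_Lp[OF L])
  then have s_meas [measurable]: "s n \<in> borel_measurable M" for n by (simp add: Lp_def)
  have s0: "0 \<le> s n x" for n x by (simp add: s_def slope_nonneg)
  have ex: "excess (h (r n)) x = s n x - min (s n x) (G x)" for n x
    by (auto simp: excess_def s_def)
  define G' where "G' x = lim (\<lambda>n. s n x)" for x
  have [measurable]: "G' \<in> borel_measurable M" unfolding G'_def[abs_def] by simp
  have AE_lim: "AE x in M. (\<lambda>n. s n x) \<longlonglongrightarrow> G' x \<and> (\<lambda>n. s n x - min (s n x) (G x)) \<longlonglongrightarrow> 0"
    using r1(2) r2(2)
  proof eventually_elim
    case (elim x)
    have "(\<lambda>n. (\<bar>excess (h (r n)) x\<bar> powr p) powr (1 / p)) \<longlonglongrightarrow> 0"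
      by (rule tendsto_zero_powrI[OF elim(2)[folded r_def] tendsto_const]) (use p0 in auto)
    then have ex0: "(\<lambda>n. s n x - min (s n x) (G x)) \<longlonglongrightarrow> 0"
      using p0 by (simp add: powr_powr ex[symmetric] excess_def)
    have "Cauchy (\<lambda>n. exp (- s n x / 2))"
      using Cauchy_subseq_Cauchy[OF elim(1) r2(1)] by (simp add: o_def s_def r_def)
    then obtain v where v: "(\<lambda>n. exp (- s n x / 2)) \<longlonglongrightarrow> v"
      by (auto simp: Cauchy_convergent_iff convergent_def)
    have "\<forall>\<^sub>F n in sequentially. s n x - min (s n x) (G x) < 1"
      using ex0 by (rule order_tendstoD) simp
    then have "\<forall>\<^sub>F n in sequentially. exp (- (G x + 1) / 2) \<le> exp (- s n x / 2)"
      by eventually_elim simp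
    then have "exp (- (G x + 1) / 2) \<le> v" using v by (intro tendsto_lowerbound) auto
    then have "0 < v" using less_le_trans[OF exp_gt_zero] by blast
    then have "(\<lambda>n. - 2 * ln (exp (- s n x / 2))) \<longlonglongrightarrow> - 2 * ln v"
      using v by (intro tendsto_intros) auto
    then have "(\<lambda>n. s n x) \<longlonglongrightarrow> - 2 * ln v" by simp
    then show ?case using ex0 by (simp add: G'_def limI)
  qed
  have G'_bounds: "AE x in M. 0 \<le> G' x \<and> G' x \<le> G x"
    using AE_lim
  proof eventually_elim
    case (elim x)
    then have lim: "(\<lambda>n. s n x) \<longlonglongrightarrow> G' x" and ex0: "(\<lambda>n. s n x - min (s n x) (G x)) \<longlonglongrightarrow> 0" by auto
    have "0 \<le> G' x" using s0 by (intro tendsto_lowerbound[OF lim]) auto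
    moreover have "(\<lambda>n. s n x - (s n x - min (s n x) (G x))) \<longlonglongrightarrow> G' x - 0"
      by (intro tendsto_diff lim ex0)
    then have "G' x \<le> G x" by (intro tendsto_upperbound[where F = sequentially]) auto
    ultimately show ?case by simp
  qed
  have G'_Lp: "G' \<in> Lp p M"
    by (rule Lp_bound[OF G_Lp]) (use G'_bounds p0 in auto)
  have min_Lp: "(\<lambda>x. min (s n x) (G x)) \<in> Lp p M" for n
    by (rule Lp_bound[OF s_Lp[of n]]) (use G_nonneg s0 p0 in auto)
  have "(\<lambda>n. \<integral>x. \<bar>min (s n x) (G x) - G' x\<bar> powr p \<partial>M) \<longlonglongrightarrow> (\<integral>x. 0 \<partial>M)"
  proof (rule integral_dominated_convergence[where w = "\<lambda>x. \<bar>G x\<bar> powr p"])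
    show "integrable M (\<lambda>x. \<bar>G x\<bar> powr p)" using G_Lp by (simp add: Lp_def)
    show "AE x in M. (\<lambda>n. \<bar>min (s n x) (G x) - G' x\<bar> powr p) \<longlonglongrightarrow> 0"
      using AE_lim
    proof eventually_elim
      case (elim x)
      then have "(\<lambda>n. s n x - (s n x - min (s n x) (G x)) - G' x) \<longlonglongrightarrow> G' x - 0 - G' x"
        by (intro tendsto_diff tendsto_const) auto
      then have "(\<lambda>n. \<bar>min (s n x) (G x) - G' x\<bar>) \<longlonglongrightarrow> 0" by (simp add: tendsto_rabs_zero_iff)
      then show ?case using p0 by (intro tendsto_zero_powrI[OF _ tendsto_const]) auto
    qed
    show "AE x in M. norm (\<bar>min (s n x) (G x) - G' x\<bar> powr p) \<le> \<bar>G x\<bar> powr p" for n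
      using G'_bounds
    proof eventually_elim
      case (elim x)
      then have "\<bar>min (s n x) (G x) - G' x\<bar> \<le> \<bar>G x\<bar>" using s0[of n x] by (auto simp: min_def)
      then show ?case using p0 by (simp add: powr_mono2)
    qed
  qed auto
  then have "Lp_tendsto p M (\<lambda>n x. min (s n x) (G x)) G'"
    using min_Lp G'_Lp by (simp add: Lp_tendsto_def)
  moreover have "(\<lambda>n. \<integral>x. \<bar>s n x - min (s n x) (G x)\<bar> powr p \<partial>M) \<longlonglongrightarrow> 0"
    using LIMSEQ_subseq_LIMSEQ[OF near_tendsto_excess[OF h] r] by (simp add: o_def ex)
  ultimately have sG': "Lp_tendsto p M s G'"
    by (intro Lp_tendsto_trans[of s p M "\<lambda>n x. min (s n x) (G x)" G'] s_Lp p0(2))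
  have "relaxed_slope p M f G'"
    unfolding relaxed_slope_def
  proof (intro conjI exI[of _ "\<lambda>n. h (r n)"] allI)
    show "AE x in M. 0 \<le> G' x" using G'_bounds by auto
    show "Lp_tendsto p M (\<lambda>n. h (r n)) f"
      using near_Lp_tendsto_f[OF h] LIMSEQ_subseq_LIMSEQ[OF near_tendsto_f[OF h] r]
      by (simp add: Lp_tendsto_def o_def)
    show "Lp_tendsto p M (\<lambda>n x. enn2real (lip_a UNIV (h (r n)) x)) G'"
      using sG' by (simp add: s_def[abs_def] slope_def[abs_def])
  qed (use G'_Lp L in auto)
  then have "AE x in M. G x \<le> G' x" using minimal by (simp add: minimal_relaxed_slope_def)
  with G'_bounds have eq: "AE x in M. G' x = G x" by eventually_elim simp
  have "(\<integral>x. \<bar>s n x - G x\<bar> powr p \<partial>M) = (\<integral>x. \<bar>s n x - G' x\<bar> powr p \<partial>M)" for n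
    by (rule integral_cong_AE) (use eq in auto)
  then have "Lp_tendsto p M s G" using sG' G_Lp by (simp add: Lp_tendsto_def)
  then show ?thesis using that[OF r] by (simp add: s_def[abs_def])
qed

lemma energy_tendsto:
  assumes s: "Lp_tendsto p M s G" and s0: "\<And>n x. 0 \<le> s n x"
  shows "(\<lambda>n. energy (s n)) \<longlonglongrightarrow> energy G"
proof (rule LIM_zero_cancel, rule Lim_null_comparison)
  have sL: "s n \<in> Lp p M" for n using s by (simp add: Lp_tendsto_def)
  have dL: "(\<lambda>x. s n x - G x) \<in> Lp p M" for n using p by (intro Lp_diff sL G_Lp) auto
  show "(\<lambda>n. \<integral>x. \<bar>s n x - G x\<bar> \<partial>M) \<longlonglongrightarrow> 0"
    using s by (intro integral_abs_tendsto_0[OF p dL]) (simp add: Lp_tendsto_def)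
  show "\<forall>\<^sub>F n in sequentially. norm (energy (s n) - energy G) \<le> (\<integral>x. \<bar>s n x - G x\<bar> \<partial>M)"
  proof (intro always_eventually allI)
    fix n
    have i: "integrable M (\<lambda>x. cvx (s n x))" "integrable M (\<lambda>x. cvx (G x))"
      using cvx_integrable[OF sL] s0 cvx_integrable[OF G_Lp G_nonneg] by auto
    have id: "integrable M (\<lambda>x. s n x - G x)" by (rule Lp_integrable[OF p dL])
    have "norm (energy (s n) - energy G) = norm (\<integral>x. cvx (s n x) - cvx (G x) \<partial>M)"
      unfolding energy_def using i by simp
    also have "\<dots> \<le> (\<integral>x. norm (cvx (s n x) - cvx (G x)) \<partial>M)" by (rule integral_norm_bound)
    also have "\<dots> \<le> (\<integral>x. \<bar>s n x - G x\<bar> \<partial>M)"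
    proof (rule integral_mono_AE)
      show "AE x in M. norm (cvx (s n x) - cvx (G x)) \<le> \<bar>s n x - G x\<bar>"
        using G_nonneg
      proof eventually_elim
        case (elim x)
        show ?case
        proof (cases "s n x \<le> G x")
          case True
          then show ?thesis using cvx_mono[OF s0 True] by simp
        next
          case False
          then show ?thesis using cvx_mono[OF elim, of "s n x"] by simp
        qed
      qed
    qed (use i id in auto)
    finally show "norm (energy (s n) - energy G) \<le> (\<integral>x. \<bar>s n x - G x\<bar> \<partial>M)" .
  qed
qed

lemma near_slope_tendsto_G:
  assumes g: "\<And>n. g n \<in> near n"
  obtains r where "strict_mono r" "Lp_tendsto p M (\<lambda>n. slope (g (r n))) G"
proof -
  define c where "c n = (INF k\<in>near n. energy (slope k))" for n
  have bdd: "bdd_below ((\<lambda>k. energy (slope k)) ` near n)" for n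
    using energy_slope_nonneg by (intro bdd_belowI2)
  have c_le: "c n \<le> energy (slope k)" if "k \<in> near n" for n k
    unfolding c_def using bdd that by (rule cINF_lower)
  have up: "(\<lambda>n. energy G + (\<integral>x. \<bar>excess (g n) x\<bar> \<partial>M)) \<longlonglongrightarrow> energy G"
    using tendsto_add[OF tendsto_const near_tendsto_excess_L1[OF g], of "energy G"] by simp
  have g_up: "energy (slope (g n)) \<le> energy G + (\<integral>x. \<bar>excess (g n) x\<bar> \<partial>M)" for n
    by (rule energy_le_excess[OF near_LIPb[OF g]])
  have "incseq c"
    unfolding incseq_def c_def using near_nonempty near_antimono bdd
    by (intro allI impI cINF_superset_mono) auto
  moreover obtain B where "\<And>n. energy G + (\<integral>x. \<bar>excess (g n) x\<bar> \<partial>M) \<le> B"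
    using convergent_imp_Bseq[OF convergentI[OF up]] unfolding Bseq_def by (auto simp: abs_le_iff)
  then have "c n \<le> B" for n using c_le[OF g] g_up order_trans by meson
  ultimately obtain m where m: "c \<longlonglongrightarrow> m" using incseq_convergent[of c B] by blast
  have "\<exists>k\<in>near n. energy (slope k) < c n + 1 / Suc n" for n
    using cINF_less_iff[OF near_nonempty bdd, of n "c n + 1 / Suc n"] by (simp add: c_def)
  then obtain h where h: "\<And>n. h n \<in> near n" "\<And>n. energy (slope (h n)) < c n + 1 / Suc n" by metis
  have "(\<lambda>n. energy (slope (h n))) \<longlonglongrightarrow> m"
  proof (rule tendsto_sandwich[OF _ _ m])
    show "(\<lambda>n. c n + 1 / Suc n) \<longlonglongrightarrow> m"
      using tendsto_add[OF m LIMSEQ_inverse_real_of_nat] by (simp add: inverse_eq_divide)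
  qed (use h c_le in \<open>auto intro!: always_eventually less_imp_le\<close>)
  then obtain r where r: "strict_mono r" "Lp_tendsto p M (\<lambda>n. slope (h (r n))) G"
    and hm: "(\<lambda>n. energy (slope (h n))) \<longlonglongrightarrow> m"
    using minimizing_tendsto_G[OF h(1) _ c_le m] by metis
  have "(\<lambda>n. energy (slope (h (r n)))) \<longlonglongrightarrow> m"
    using LIMSEQ_subseq_LIMSEQ[OF hm r(1)] by (simp add: o_def)
  then have mG: "m = energy G"
    using energy_tendsto[OF r(2)] slope_nonneg LIMSEQ_unique by blast
  have "(\<lambda>n. energy (slope (g n))) \<longlonglongrightarrow> m"
    by (rule tendsto_sandwich[OF _ _ m up[folded mG]]; intro always_eventually allI)
      (simp_all only: c_le[OF g] g_up mG)
  from minimizing_tendsto_G[OF g this c_le m] show ?thesis using that by blast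
qed

lemma Cyl_near: "\<exists>u \<in> Cyl \<inter> near n. slope u = dual_norm_diff u"
proof -
  have p0: "0 < p" "0 \<le> p" using p by auto
  define K where "K = 2 powr p * (2 * real (Suc n))"
  obtain N where N: "K < real (Suc N)" using reals_Archimedean2[of K] by (metis less_SucI of_nat_less_iff order_less_trans lessI)
  obtain h where h: "h \<in> near N" using near_nonempty by blast
  have hL: "h \<in> LIPb UNIV" by (rule near_LIPb[OF h])
  obtain u where u: "u \<in> Cyl" "slope u = dual_norm_diff u"
    "(\<integral>x. \<bar>u x - h x\<bar> powr p \<partial>M) < 1 / Suc N"
    "(\<integral>x. \<bar>max 0 (slope u x - slope h x)\<bar> powr p \<partial>M) < 1 / Suc N"
    using Cyl_approx_Lp[OF sets_M finite_measure_axioms hL p0(1), of "1 / Suc N"] by auto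
  have uL: "u \<in> LIPb UNIV" using u(1) Cyl_subset_LIPb by blast
  have small: "(\<integral>x. \<bar>c x\<bar> powr p \<partial>M) < 1 / Suc n"
    if "a \<in> Lp p M" "b \<in> Lp p M" "c \<in> Lp p M" "\<And>x. \<bar>c x\<bar> \<le> \<bar>a x + b x\<bar>"
      "(\<integral>x. \<bar>a x\<bar> powr p \<partial>M) < 1 / Suc N" "(\<integral>x. \<bar>b x\<bar> powr p \<partial>M) < 1 / Suc N" for a b c :: "'a \<Rightarrow> real"
  proof -
    have i: "integrable M (\<lambda>x. \<bar>a x\<bar> powr p)" "integrable M (\<lambda>x. \<bar>b x\<bar> powr p)"
      "integrable M (\<lambda>x. \<bar>c x\<bar> powr p)"
      using that by (auto simp: Lp_def)
    have "(\<integral>x. \<bar>c x\<bar> powr p \<partial>M) \<le> (\<integral>x. 2 powr p * (\<bar>a x\<bar> powr p + \<bar>b x\<bar> powr p) \<partial>M)"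
    proof (rule integral_mono)
      show "\<bar>c x\<bar> powr p \<le> 2 powr p * (\<bar>a x\<bar> powr p + \<bar>b x\<bar> powr p)" for x
        using powr_mono2[OF p0(2) abs_ge_zero that(4)] powr_abs_add_le[OF p0(2), of "a x" "b x"]
        by (rule order_trans)
    qed (use i in auto)
    also have "\<dots> = 2 powr p * ((\<integral>x. \<bar>a x\<bar> powr p \<partial>M) + (\<integral>x. \<bar>b x\<bar> powr p \<partial>M))"
      using i by simp
    also have "\<dots> < 2 powr p * (1 / Suc N + 1 / Suc N)"
      using that by (intro mult_strict_left_mono add_strict_mono) auto
    also have "\<dots> \<le> 1 / Suc n"
      using N by (simp add: K_def field_simps)
    finally show ?thesis .
  qed
  have "(\<integral>x. \<bar>u x - f x\<bar> powr p \<partial>M) < 1 / Suc n"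
    by (rule small[of "\<lambda>x. u x - h x" "\<lambda>x. h x - f x"])
      (use u h p0 in \<open>auto simp: near_def intro!: Lp_diff LIPb_Lp[OF uL] LIPb_Lp[OF hL] f\<close>)
  moreover have "(\<integral>x. \<bar>excess u x\<bar> powr p \<partial>M) < 1 / Suc n"
    by (rule small[of "\<lambda>x. max 0 (slope u x - slope h x)" "excess h"])
      (use u(3,4) h p0 in \<open>auto simp: near_def excess_def intro!: Lp_max_0 Lp_diff slope_Lp uL hL excess_Lp G_Lp\<close>)
  ultimately have "u \<in> near n" using uL by (simp add: near_def)
  then show ?thesis using u by blast
qed

lemma Cyl_tendsto_minimal_slope:
  "\<exists>fs. (\<forall>n. fs n \<in> Cyl) \<and> Lp_tendsto p M fs f \<and> Lp_tendsto p M (\<lambda>n. dual_norm_diff (fs n)) G"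
proof -
  have "\<forall>n. \<exists>u. u \<in> Cyl \<and> u \<in> near n \<and> slope u = dual_norm_diff u" using Cyl_near by blast
  then obtain u where u: "\<And>n. u n \<in> Cyl" "\<And>n. u n \<in> near n" "\<And>n. slope (u n) = dual_norm_diff (u n)"
    by metis
  obtain r where r: "strict_mono r" "Lp_tendsto p M (\<lambda>n. slope (u (r n))) G"
    using near_slope_tendsto_G[OF u(2)] .
  have "Lp_tendsto p M (\<lambda>n. u (r n)) f"
    using near_Lp_tendsto_f[OF u(2)] LIMSEQ_subseq_LIMSEQ[OF near_tendsto_f[OF u(2)] r(1)]
    by (simp add: Lp_tendsto_def o_def)
  then show ?thesis using u r(2) by (intro exI[of _ "\<lambda>n. u (r n)"]) simp
qed

end

section \<open>Total variation\<close>

lemma nn_integral_layer_cake: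
  fixes \<phi> :: "'a \<Rightarrow> real"
  assumes "sigma_finite_measure N" and [measurable]: "\<phi> \<in> borel_measurable N" and \<phi>: "\<And>x. 0 \<le> \<phi> x"
  shows "(\<integral>\<^sup>+x. ennreal (\<phi> x) \<partial>N) =
    (\<integral>\<^sup>+t. indicator {0..} t * emeasure N {x \<in> space N. t < \<phi> x} \<partial>lborel)"
    and "(\<lambda>t. emeasure N {x \<in> space N. t < \<phi> x}) \<in> borel_measurable lborel"
proof -
  interpret sigma_finite_measure N by fact
  interpret pair_sigma_finite N lborel ..
  define F :: "'a \<Rightarrow> real \<Rightarrow> ennreal" where "F x t = (if 0 \<le> t \<and> t < \<phi> x then 1 else 0)" for x t
  have F [measurable]: "case_prod F \<in> borel_measurable (N \<Otimes>\<^sub>M lborel)"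
    unfolding F_def[abs_def] by measurable
  have "(\<integral>\<^sup>+t. F x t \<partial>lborel) = ennreal (\<phi> x)" for x
  proof -
    have "(\<integral>\<^sup>+t. F x t \<partial>lborel) = (\<integral>\<^sup>+t. indicator {0..<\<phi> x} t \<partial>lborel)"
      by (rule nn_integral_cong) (auto simp: F_def indicator_def)
    then show ?thesis using \<phi>[of x] by simp
  qed
  then have "(\<integral>\<^sup>+x. ennreal (\<phi> x) \<partial>N) = (\<integral>\<^sup>+x. (\<integral>\<^sup>+t. F x t \<partial>lborel) \<partial>N)" by simp
  also have "\<dots> = (\<integral>\<^sup>+t. (\<integral>\<^sup>+x. F x t \<partial>N) \<partial>lborel)" by (rule Fubini'[OF F, symmetric])
  also have "\<dots> = (\<integral>\<^sup>+t. indicator {0..} t * emeasure N {x \<in> space N. t < \<phi> x} \<partial>lborel)"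
  proof (rule nn_integral_cong)
    fix t :: real
    have "(\<integral>\<^sup>+x. F x t \<partial>N) = (\<integral>\<^sup>+x. indicator {0..} t * indicator {x \<in> space N. t < \<phi> x} x \<partial>N)"
      by (rule nn_integral_cong) (auto simp: F_def indicator_def)
    then show "(\<integral>\<^sup>+x. F x t \<partial>N) = indicator {0..} t * emeasure N {x \<in> space N. t < \<phi> x}"
      by (simp add: nn_integral_cmult)
  qed
  finally show "(\<integral>\<^sup>+x. ennreal (\<phi> x) \<partial>N) =
    (\<integral>\<^sup>+t. indicator {0..} t * emeasure N {x \<in> space N. t < \<phi> x} \<partial>lborel)" .
  have "(\<lambda>t. \<integral>\<^sup>+x. (if t < \<phi> x then 1 else 0) \<partial>N) \<in> borel_measurable lborel"
    by measurable
  moreover have "(\<integral>\<^sup>+x. (if t < \<phi> x then 1 else 0) \<partial>N) = emeasure N {x \<in> space N. t < \<phi> x}" for t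
  proof -
    have "(\<integral>\<^sup>+x. (if t < \<phi> x then 1 else 0) \<partial>N) = (\<integral>\<^sup>+x. indicator {x \<in> space N. t < \<phi> x} x \<partial>N)"
      by (rule nn_integral_cong) (auto simp: indicator_def)
    then show ?thesis by simp
  qed
  ultimately show "(\<lambda>t. emeasure N {x \<in> space N. t < \<phi> x}) \<in> borel_measurable lborel" by simp
qed

lemma liminf_nn_integral_of_open:
  fixes N :: "nat \<Rightarrow> 'a::topological_space measure" and \<phi> :: "'a \<Rightarrow> real"
  assumes sets: "\<And>n. sets (N n) = sets borel" "sets \<nu> = sets borel"
    and fin: "\<And>n. finite_measure (N n)" "finite_measure \<nu>"
    and lower: "\<And>\<Omega>. open \<Omega> \<Longrightarrow> emeasure \<nu> \<Omega> \<le> liminf (\<lambda>n. emeasure (N n) \<Omega>)"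
    and \<phi>: "continuous_on UNIV \<phi>" "\<And>x. 0 \<le> \<phi> x"
  shows "(\<integral>\<^sup>+x. ennreal (\<phi> x) \<partial>\<nu>) \<le> liminf (\<lambda>n. \<integral>\<^sup>+x. ennreal (\<phi> x) \<partial>N n)"
proof -
  have meas: "\<phi> \<in> borel_measurable (N n)" "\<phi> \<in> borel_measurable \<nu>" for n
    using borel_measurable_continuous_onI[OF \<phi>(1)]
    by (simp_all add: measurable_cong_sets[OF sets(1) refl] measurable_cong_sets[OF sets(2) refl])
  have sf: "sigma_finite_measure (N n)" "sigma_finite_measure \<nu>" for n
    using fin by (simp_all add: finite_measure.axioms(1))
  have space: "space (N n) = UNIV" "space \<nu> = UNIV" for n
    using sets_eq_imp_space_eq[OF sets(1)] sets_eq_imp_space_eq[OF sets(2)] by simp_all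
  note cake = nn_integral_layer_cake[OF sf(1) meas(1) \<phi>(2), unfolded space, simplified]
    nn_integral_layer_cake[OF sf(2) meas(2) \<phi>(2), unfolded space, simplified]
  have "(\<integral>\<^sup>+x. ennreal (\<phi> x) \<partial>\<nu>) = (\<integral>\<^sup>+t. indicator {0..} t * emeasure \<nu> {x. t < \<phi> x} \<partial>lborel)"
    by (rule cake(3))
  also have "\<dots> \<le> (\<integral>\<^sup>+t. liminf (\<lambda>n. indicator {0..} t * emeasure (N n) {x. t < \<phi> x}) \<partial>lborel)"
  proof (rule nn_integral_mono)
    fix t :: real
    have "open {x. t < \<phi> x}" using \<phi>(1) by (intro open_Collect_less) auto
    from lower[OF this]
    show "indicator {0..} t * emeasure \<nu> {x. t < \<phi> x}
        \<le> liminf (\<lambda>n. indicator {0..} t * emeasure (N n) {x. t < \<phi> x})"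
      by (cases "0 \<le> t") auto
  qed
  also have "\<dots> \<le> liminf (\<lambda>n. \<integral>\<^sup>+t. indicator {0..} t * emeasure (N n) {x. t < \<phi> x} \<partial>lborel)"
    using cake(2) by (intro nn_integral_liminf borel_measurable_times_ennreal) auto
  finally show ?thesis by (simp add: cake(1))
qed

lemma tendsto_integral_of_open:
  fixes N :: "nat \<Rightarrow> 'a::topological_space measure" and \<phi> :: "'a \<Rightarrow> real"
  assumes sets: "\<And>n. sets (N n) = sets borel" "sets \<nu> = sets borel"
    and fin: "\<And>n. finite_measure (N n)" "finite_measure \<nu>"
    and lower: "\<And>\<Omega>. open \<Omega> \<Longrightarrow> emeasure \<nu> \<Omega> \<le> liminf (\<lambda>n. emeasure (N n) \<Omega>)"
    and mass: "(\<lambda>n. emeasure (N n) UNIV) \<longlonglongrightarrow> emeasure \<nu> UNIV"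
    and \<phi>: "continuous_on UNIV \<phi>" "bounded (range \<phi>)"
  shows "(\<lambda>n. \<integral>x. \<phi> x \<partial>N n) \<longlonglongrightarrow> (\<integral>x. \<phi> x \<partial>\<nu>)"
proof -
  have space: "space (N n) = UNIV" "space \<nu> = UNIV" for n
    using sets_eq_imp_space_eq[OF sets(1)] sets_eq_imp_space_eq[OF sets(2)] by simp_all
  have m: "(\<lambda>n. measure (N n) UNIV) \<longlonglongrightarrow> measure \<nu> UNIV"
    unfolding measure_def
    using mass finite_measure.emeasure_finite[OF fin(2)] by (intro tendsto_enn2real) (auto simp: ennreal_enn2real_if)
  have less: "\<forall>\<^sub>F n in sequentially. a < (\<integral>x. \<psi> x \<partial>N n)"
    if \<psi>: "continuous_on UNIV \<psi>" "\<And>x. \<bar>\<psi> x\<bar> \<le> C" and a: "a < (\<integral>x. \<psi> x \<partial>\<nu>)" for a C and \<psi> :: "'a \<Rightarrow> real"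
  proof -
    have meas: "\<psi> \<in> borel_measurable (N n)" "\<psi> \<in> borel_measurable \<nu>" for n
      using borel_measurable_continuous_onI[OF \<psi>(1)]
      by (simp_all add: measurable_cong_sets[OF sets(1) refl] measurable_cong_sets[OF sets(2) refl])
    have int: "integrable (N n) \<psi>" "integrable \<nu> \<psi>" for n
      by (rule finite_measure.integrable_const_bound[OF fin(1), where B = C]
          finite_measure.integrable_const_bound[OF fin(2), where B = C]; use \<psi>(2) meas in simp)+
    have const: "integrable (N n) (\<lambda>x. C)" "integrable \<nu> (\<lambda>x. C)" for n
      using finite_measure.integrable_const[OF fin(1)] finite_measure.integrable_const[OF fin(2)] by auto
    have nn: "0 \<le> \<psi> x + C" for x using \<psi>(2)[of x] by linarith
    have shift: "(\<integral>x. \<psi> x + C \<partial>N n) = (\<integral>x. \<psi> x \<partial>N n) + C * measure (N n) UNIV"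
      "(\<integral>x. \<psi> x + C \<partial>\<nu>) = (\<integral>x. \<psi> x \<partial>\<nu>) + C * measure \<nu> UNIV" for n
      using int const by (simp_all add: space mult.commute)
    have to_nn: "(\<integral>\<^sup>+x. ennreal (\<psi> x + C) \<partial>N n) = ennreal (\<integral>x. \<psi> x + C \<partial>N n)"
      "(\<integral>\<^sup>+x. ennreal (\<psi> x + C) \<partial>\<nu>) = ennreal (\<integral>x. \<psi> x + C \<partial>\<nu>)" for n
      using int const nn by (simp_all add: nn_integral_eq_integral)
    define e where "e = ((\<integral>x. \<psi> x \<partial>\<nu>) - a) / 2"
    have e: "0 < e" using a by (simp add: e_def)
    have "\<forall>\<^sub>F n in sequentially. (\<integral>x. \<psi> x + C \<partial>\<nu>) - e < (\<integral>x. \<psi> x + C \<partial>N n)"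
    proof (cases "(\<integral>x. \<psi> x + C \<partial>\<nu>) - e < 0")
      case True
      have "0 \<le> (\<integral>x. \<psi> x + C \<partial>N n)" for n by (rule integral_nonneg_AE) (use nn in simp)
      then show ?thesis using True by (intro always_eventually allI) (meson less_le_trans)
    next
      case False
      then have "ennreal ((\<integral>x. \<psi> x + C \<partial>\<nu>) - e) < (\<integral>\<^sup>+x. ennreal (\<psi> x + C) \<partial>\<nu>)"
        unfolding to_nn using e by (intro ennreal_lessI) auto
      also have "\<dots> \<le> liminf (\<lambda>n. \<integral>\<^sup>+x. ennreal (\<psi> x + C) \<partial>N n)"
        by (rule liminf_nn_integral_of_open[OF sets fin lower])
          (use nn \<psi>(1) in \<open>auto intro: continuous_on_add\<close>)
      finally have "\<forall>\<^sub>F n in sequentially. ennreal ((\<integral>x. \<psi> x + C \<partial>\<nu>) - e) < (\<integral>\<^sup>+x. ennreal (\<psi> x + C) \<partial>N n)"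
        by (rule less_LiminfD)
      then show ?thesis
        unfolding to_nn by eventually_elim (use False in \<open>simp add: ennreal_less_iff\<close>)
    qed
    moreover have "\<forall>\<^sub>F n in sequentially. C * measure (N n) UNIV < C * measure \<nu> UNIV + e"
      using tendsto_mult[OF tendsto_const m, of C] e by (intro order_tendstoD(2)) auto
    ultimately show ?thesis
    proof eventually_elim
      case (elim n)
      have "2 * e = (\<integral>x. \<psi> x \<partial>\<nu>) - a" by (simp add: e_def)
      then show ?case using elim unfolding shift by linarith
    qed
  qed
  obtain C where C: "\<And>x. \<bar>\<phi> x\<bar> \<le> C" using \<phi>(2) by (auto simp: bounded_iff)
  show ?thesis
  proof (rule order_tendstoI)
    fix a assume "a < (\<integral>x. \<phi> x \<partial>\<nu>)"
    then show "\<forall>\<^sub>F n in sequentially. a < (\<integral>x. \<phi> x \<partial>N n)" by (rule less[OF \<phi>(1) C])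
  next
    fix a assume "(\<integral>x. \<phi> x \<partial>\<nu>) < a"
    then have "\<forall>\<^sub>F n in sequentially. - a < (\<integral>x. - \<phi> x \<partial>N n)"
      by (intro less[where C = C]) (use \<phi>(1) C in \<open>auto intro: continuous_on_minus\<close>)
    then show "\<forall>\<^sub>F n in sequentially. (\<integral>x. \<phi> x \<partial>N n) < a" by simp
  qed
qed

lemma Lp_tendsto_restrict_space:
  assumes "Lp_tendsto p M fs f" "\<Omega> \<in> sets M" "0 \<le> p"
  shows "Lp_tendsto p (restrict_space M \<Omega>) fs f"
proof -
  have Lp: "g \<in> Lp p (restrict_space M \<Omega>)" if "g \<in> Lp p M" for g
    using that assms(2) integrable_mult_indicator[of \<Omega> M "\<lambda>x. \<bar>g x\<bar> powr p"]
    by (simp add: Lp_def measurable_restrict_space1 integrable_restrict_space sets.Int_space_eq2)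
  have L: "fs n \<in> Lp p M" "f \<in> Lp p M" for n using assms(1) by (auto simp: Lp_tendsto_def)
  have [measurable]: "fs n \<in> borel_measurable M" "f \<in> borel_measurable M" for n using L by (auto simp: Lp_def)
  have "(\<lambda>n. \<integral>x. \<bar>fs n x - f x\<bar> powr p \<partial>restrict_space M \<Omega>) \<longlonglongrightarrow> 0"
  proof (rule tendsto_sandwich[OF _ _ tendsto_const])
    show "(\<lambda>n. \<integral>x. \<bar>fs n x - f x\<bar> powr p \<partial>M) \<longlonglongrightarrow> 0" using assms(1) by (simp add: Lp_tendsto_def)
    show "\<forall>\<^sub>F n in sequentially. (\<integral>x. \<bar>fs n x - f x\<bar> powr p \<partial>restrict_space M \<Omega>) \<le> (\<integral>x. \<bar>fs n x - f x\<bar> powr p \<partial>M)"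
    proof (intro always_eventually allI)
      fix n
      have i: "integrable M (\<lambda>x. \<bar>fs n x - f x\<bar> powr p)" by (rule Lp_integrable_diff[OF L assms(3)])
      have "(\<integral>x. \<bar>fs n x - f x\<bar> powr p \<partial>restrict_space M \<Omega>)
          = (\<integral>x. indicator \<Omega> x *\<^sub>R (\<bar>fs n x - f x\<bar> powr p) \<partial>M)"
        using assms(2) by (intro integral_restrict_space) simp
      also have "\<dots> \<le> (\<integral>x. \<bar>fs n x - f x\<bar> powr p \<partial>M)"
        using i assms(2)
        by (intro integral_mono integrable_mult_indicator) (auto simp: indicator_def)
      finally show "(\<integral>x. \<bar>fs n x - f x\<bar> powr p \<partial>restrict_space M \<Omega>) \<le> (\<integral>x. \<bar>fs n x - f x\<bar> powr p \<partial>M)" .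
    qed
    show "\<forall>\<^sub>F n in sequentially. 0 \<le> (\<integral>x. \<bar>fs n x - f x\<bar> powr p \<partial>restrict_space M \<Omega>)"
      by (intro always_eventually allI integral_nonneg_AE) simp
  qed
  then show ?thesis using Lp L by (simp add: Lp_tendsto_def)
qed

lemma frequently_less_of_liminf_less:
  fixes X :: "nat \<Rightarrow> 'b::complete_linorder"
  assumes "liminf X < a"
  shows "\<exists>\<^sub>F n in sequentially. X n < a"
proof (rule ccontr)
  assume "\<not> (\<exists>\<^sub>F n in sequentially. X n < a)"
  then have "\<forall>\<^sub>F n in sequentially. a \<le> X n" by (simp add: not_frequently not_less)
  then have "a \<le> liminf X" by (rule Liminf_bounded)
  then show False using assms by simp
qed

lemma LIPb_recovery:
  assumes "BV_energy M f < \<infinity>" "0 < e"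
  obtains h where "h \<in> LIPb UNIV" "(\<integral>x. \<bar>h x - f x\<bar> powr 1 \<partial>M) < e"
    "(\<integral>\<^sup>+x. lip_a UNIV h x \<partial>M) < BV_energy M f + ennreal e"
proof -
  have "BV_energy M f < BV_energy M f + ennreal e"
    using assms by (cases "BV_energy M f") (auto simp: ennreal_plus[symmetric] ennreal_less_iff simp del: ennreal_plus)
  then obtain fs where fs: "\<And>n. fs n \<in> LIPb UNIV" "Lp_tendsto 1 M fs f"
    "liminf (\<lambda>n. \<integral>\<^sup>+x. lip_a UNIV (fs n) x \<partial>M) < BV_energy M f + ennreal e"
    unfolding BV_energy_def[of M f] INF_less_iff by auto
  have "\<exists>\<^sub>F n in sequentially. (\<integral>\<^sup>+x. lip_a UNIV (fs n) x \<partial>M) < BV_energy M f + ennreal e"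
    using fs(3) by (rule frequently_less_of_liminf_less)
  moreover have "\<forall>\<^sub>F n in sequentially. (\<integral>x. \<bar>fs n x - f x\<bar> powr 1 \<partial>M) < e"
    using fs(2) assms(2) by (intro order_tendstoD(2)) (auto simp: Lp_tendsto_def)
  ultimately have "\<exists>\<^sub>F n in sequentially. (\<integral>\<^sup>+x. lip_a UNIV (fs n) x \<partial>M) < BV_energy M f + ennreal e \<and>
      (\<integral>x. \<bar>fs n x - f x\<bar> powr 1 \<partial>M) < e"
    by (rule frequently_eventually_frequently)
  then obtain n where "(\<integral>\<^sup>+x. lip_a UNIV (fs n) x \<partial>M) < BV_energy M f + ennreal e"
      "(\<integral>x. \<bar>fs n x - f x\<bar> powr 1 \<partial>M) < e"
    using frequently_ex by blast
  then show ?thesis using that[of "fs n"] fs(1) by simp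
qed

lemma Cyl_tendsto_energy:
  fixes M :: "'a::{real_normed_vector, second_countable_topology} measure"
  assumes M: "sets M = sets borel" "finite_measure M" and E: "BV_energy M f < \<infinity>" and f: "f \<in> Lp 1 M"
  obtains u where "\<And>n. u n \<in> Cyl" "\<And>n. slope (u n) = dual_norm_diff (u n)" "Lp_tendsto 1 M u f"
    "(\<lambda>n. \<integral>\<^sup>+x. ennreal (slope (u n) x) \<partial>M) \<longlonglongrightarrow> BV_energy M f"
proof -
  interpret finite_measure M by fact
  have meas: "g \<in> borel_measurable M" "slope g \<in> borel_measurable M" if "g \<in> LIPb UNIV" for g
    using LIPb_measurable[OF that] slope_measurable[OF that] by (simp_all add: measurable_cong_sets[OF M(1) refl])
  have Lp: "g \<in> Lp 1 M" "slope g \<in> Lp 1 M" if g: "g \<in> LIPb UNIV" for g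
  proof -
    obtain B L where BL: "\<And>x. \<bar>g x\<bar> \<le> B" "L-lipschitz_on UNIV g"
      using g by (auto simp: LIPb_def bounded_iff)
    then show "g \<in> Lp 1 M" using meas[OF g] by (intro Lp_bounded[where B = B]) auto
    have "\<bar>slope g x\<bar> \<le> L" for x using slope_nonneg[of g x] slope_le[OF BL(2)] by simp
    then show "slope g \<in> Lp 1 M" using meas[OF g] by (intro Lp_bounded[where B = L]) auto
  qed
  have "\<forall>n. \<exists>h u. h \<in> LIPb UNIV \<and> (\<integral>x. \<bar>h x - f x\<bar> powr 1 \<partial>M) < 1 / Suc n \<and>
    (\<integral>\<^sup>+x. lip_a UNIV h x \<partial>M) < BV_energy M f + ennreal (1 / Suc n) \<and>
    u \<in> Cyl \<and> slope u = dual_norm_diff u \<and> (\<integral>x. \<bar>u x - h x\<bar> powr 1 \<partial>M) < 1 / Suc n \<and>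
    (\<integral>x. \<bar>max 0 (slope u x - slope h x)\<bar> powr 1 \<partial>M) < 1 / Suc n"
  proof
    fix n
    obtain h where h: "h \<in> LIPb UNIV" "(\<integral>x. \<bar>h x - f x\<bar> powr 1 \<partial>M) < 1 / Suc n"
      "(\<integral>\<^sup>+x. lip_a UNIV h x \<partial>M) < BV_energy M f + ennreal (1 / Suc n)"
      by (rule LIPb_recovery[OF E, of "1 / Suc n"]) simp_all
    obtain u where "u \<in> Cyl" "slope u = dual_norm_diff u" "(\<integral>x. \<bar>u x - h x\<bar> powr 1 \<partial>M) < 1 / Suc n"
      "(\<integral>x. \<bar>max 0 (slope u x - slope h x)\<bar> powr 1 \<partial>M) < 1 / Suc n"
      by (rule Cyl_approx_Lp[OF M h(1), of 1 "1 / Suc n"]) simp_all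
    with h show "\<exists>h u. h \<in> LIPb UNIV \<and> (\<integral>x. \<bar>h x - f x\<bar> powr 1 \<partial>M) < 1 / Suc n \<and>
      (\<integral>\<^sup>+x. lip_a UNIV h x \<partial>M) < BV_energy M f + ennreal (1 / Suc n) \<and>
      u \<in> Cyl \<and> slope u = dual_norm_diff u \<and> (\<integral>x. \<bar>u x - h x\<bar> powr 1 \<partial>M) < 1 / Suc n \<and>
      (\<integral>x. \<bar>max 0 (slope u x - slope h x)\<bar> powr 1 \<partial>M) < 1 / Suc n"
      by blast
  qed
  then obtain h u where h: "\<And>n. h n \<in> LIPb UNIV" "\<And>n. (\<integral>x. \<bar>h n x - f x\<bar> powr 1 \<partial>M) < 1 / Suc n"
    "\<And>n. (\<integral>\<^sup>+x. lip_a UNIV (h n) x \<partial>M) < BV_energy M f + ennreal (1 / Suc n)"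
    and u: "\<And>n. u n \<in> Cyl" "\<And>n. slope (u n) = dual_norm_diff (u n)"
    "\<And>n. (\<integral>x. \<bar>u n x - h n x\<bar> powr 1 \<partial>M) < 1 / Suc n"
    "\<And>n. (\<integral>x. \<bar>max 0 (slope (u n) x - slope (h n) x)\<bar> powr 1 \<partial>M) < 1 / Suc n"
    unfolding choice_iff by blast
  have uL: "u n \<in> LIPb UNIV" for n using u(1) Cyl_subset_LIPb by blast
  have inv0: "(\<lambda>n. 1 / real (Suc n)) \<longlonglongrightarrow> 0"
    using LIMSEQ_inverse_real_of_nat by (simp add: inverse_eq_divide)
  have to0: "(\<lambda>n. \<integral>x. \<bar>g n x\<bar> powr 1 \<partial>M) \<longlonglongrightarrow> 0"
    if "\<And>n. (\<integral>x. \<bar>g n x\<bar> powr 1 \<partial>M) < 1 / Suc n" for g :: "nat \<Rightarrow> 'a \<Rightarrow> real"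
  proof (rule tendsto_sandwich[OF _ _ tendsto_const inv0]; intro always_eventually allI)
    show "0 \<le> (\<integral>x. \<bar>g n x\<bar> powr 1 \<partial>M)" for n by (rule integral_nonneg_AE) simp
    show "(\<integral>x. \<bar>g n x\<bar> powr 1 \<partial>M) \<le> 1 / Suc n" for n using that[of n] by (rule less_imp_le)
  qed
  have "Lp_tendsto 1 M h f" unfolding Lp_tendsto_def using Lp h(1) f to0[OF h(2)] by blast
  then have uf: "Lp_tendsto 1 M u f"
    by (rule Lp_tendsto_trans[OF Lp(1)[OF uL] to0[OF u(3)]]) simp
  define X where "X n = (\<integral>\<^sup>+x. ennreal (slope (u n) x) \<partial>M)" for n
  have X_le: "X n \<le> BV_energy M f + ennreal (2 * (1 / Suc n))" for n
  proof -
    note [measurable] = meas(2)[OF uL[of n]] meas(2)[OF h(1)[of n]]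
    define e where "e x = max 0 (slope (u n) x - slope (h n) x)" for x
    have i: "integrable M e"
      unfolding e_def[abs_def]
      using Lp_integrable[OF order_refl Lp(2)[OF uL[of n]]] Lp_integrable[OF order_refl Lp(2)[OF h(1)[of n]]]
      by (intro integrable_max) auto
    have "X n \<le> (\<integral>\<^sup>+x. lip_a UNIV (h n) x + ennreal (e x) \<partial>M)"
      unfolding X_def
    proof (rule nn_integral_mono)
      fix x
      have "ennreal (slope (u n) x) \<le> ennreal (slope (h n) x + e x)" by (rule ennreal_leI) (simp add: e_def)
      also have "\<dots> = lip_a UNIV (h n) x + ennreal (e x)"
        using slope_nonneg[of "h n" x] by (simp add: ennreal_plus e_def ennreal_slope[OF h(1)])
      finally show "ennreal (slope (u n) x) \<le> lip_a UNIV (h n) x + ennreal (e x)" .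
    qed
    also have "\<dots> = (\<integral>\<^sup>+x. lip_a UNIV (h n) x \<partial>M) + (\<integral>\<^sup>+x. ennreal (e x) \<partial>M)"
      unfolding ennreal_slope[OF h(1), symmetric] e_def by (intro nn_integral_add) auto
    also have "(\<integral>\<^sup>+x. ennreal (e x) \<partial>M) = ennreal (\<integral>x. e x \<partial>M)"
      by (rule nn_integral_eq_integral[OF i]) (simp add: e_def)
    also have "(\<integral>x. e x \<partial>M) = (\<integral>x. \<bar>max 0 (slope (u n) x - slope (h n) x)\<bar> powr 1 \<partial>M)"
      by (simp add: e_def[abs_def])
    also have "(\<integral>\<^sup>+x. lip_a UNIV (h n) x \<partial>M) + ennreal \<dots>
        \<le> (BV_energy M f + ennreal (1 / Suc n)) + ennreal (1 / Suc n)"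
      using h(3)[of n] u(4)[of n] by (intro add_mono ennreal_leI) auto
    also have "\<dots> = BV_energy M f + ennreal (2 * (1 / Suc n))"
      by (simp add: add.assoc ennreal_plus[symmetric] del: ennreal_plus)
    finally show ?thesis .
  qed
  have "BV_energy M f \<le> liminf X"
  proof -
    have "(\<lambda>n. \<integral>\<^sup>+x. lip_a UNIV (u n) x \<partial>M) = X"
      by (simp add: X_def[abs_def] ennreal_slope[OF uL])
    then show ?thesis
      unfolding BV_energy_def using uL uf by (intro INF_lower2[of u]) auto
  qed
  moreover have "limsup X \<le> BV_energy M f"
  proof -
    have "(\<lambda>n. 2 * (1 / real (Suc n))) \<longlonglongrightarrow> 2 * 0" by (intro tendsto_mult tendsto_const inv0)
    then have "(\<lambda>n. BV_energy M f + ennreal (2 * (1 / real (Suc n)))) \<longlonglongrightarrow> BV_energy M f + ennreal 0"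
      by (intro tendsto_add tendsto_const tendsto_ennrealI) simp
    then have "limsup (\<lambda>n. BV_energy M f + ennreal (2 * (1 / real (Suc n)))) = BV_energy M f"
      by (intro lim_imp_Limsup) auto
    moreover have "limsup X \<le> limsup (\<lambda>n. BV_energy M f + ennreal (2 * (1 / real (Suc n))))"
      by (intro Limsup_mono always_eventually allI X_le)
    ultimately show ?thesis by simp
  qed
  moreover have "liminf X \<le> limsup X" by (rule Liminf_le_Limsup) simp
  ultimately have "X \<longlonglongrightarrow> BV_energy M f"
    by (intro Liminf_eq_Limsup) auto
  then show ?thesis using that[OF u(1,2) uf] by (simp add: X_def[abs_def])
qed

lemma liminf_energy_open:
  fixes M :: "'a::{real_normed_vector, second_countable_topology} measure"
  assumes M: "sets M = sets borel" and u: "\<And>n. u n \<in> LIPb UNIV" "Lp_tendsto 1 M u f"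
    and \<Omega>: "open \<Omega>"
  shows "BV_energy_loc M f \<Omega> \<le> liminf (\<lambda>n. emeasure (density M (\<lambda>x. ennreal (slope (u n) x))) \<Omega>)"
proof -
  have \<Omega>M: "\<Omega> \<in> sets M" using \<Omega> by (simp add: M borel_open)
  have meas [measurable]: "slope (u n) \<in> borel_measurable M" for n
    using slope_measurable[OF u(1)] by (simp add: measurable_cong_sets[OF M refl])
  have loc: "u n \<in> LIPloc \<Omega>" for n
  proof -
    obtain L where "L-lipschitz_on UNIV (u n)" using u(1)[of n] by (auto simp: LIPb_def)
    then have "L-lipschitz_on (ball x 1 \<inter> \<Omega>) (u n)" for x by (rule lipschitz_on_subset) simp
    then show ?thesis unfolding LIPloc_def mem_Collect_eq using zero_less_one by blast
  qed
  have "BV_energy_loc M f \<Omega> \<le> liminf (\<lambda>n. \<integral>\<^sup>+x. lip_a \<Omega> (u n) x \<partial>restrict_space M \<Omega>)"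
    unfolding BV_energy_loc_def
    using loc Lp_tendsto_restrict_space[OF u(2) \<Omega>M] by (intro INF_lower2[of u]) auto
  also have "\<dots> \<le> liminf (\<lambda>n. emeasure (density M (\<lambda>x. ennreal (slope (u n) x))) \<Omega>)"
  proof (intro Liminf_mono always_eventually allI)
    fix n
    have "(\<integral>\<^sup>+x. lip_a \<Omega> (u n) x \<partial>restrict_space M \<Omega>) \<le> (\<integral>\<^sup>+x. lip_a UNIV (u n) x \<partial>restrict_space M \<Omega>)"
      unfolding lip_a_def by (intro nn_integral_mono INF_mono' Lip_mono) auto
    also have "\<dots> = (\<integral>\<^sup>+x. ennreal (slope (u n) x) * indicator \<Omega> x \<partial>M)"
      using \<Omega>M by (simp add: nn_integral_restrict_space ennreal_slope[OF u(1)])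
    also have "\<dots> = emeasure (density M (\<lambda>x. ennreal (slope (u n) x))) \<Omega>"
      using \<Omega>M by (simp add: emeasure_density)
    finally show "(\<integral>\<^sup>+x. lip_a \<Omega> (u n) x \<partial>restrict_space M \<Omega>)
        \<le> emeasure (density M (\<lambda>x. ennreal (slope (u n) x))) \<Omega>" .
  qed
  finally show ?thesis .
qed

lemma Cyl_tendsto_total_variation:
  fixes M :: "'a::{real_normed_vector, second_countable_topology} measure"
  assumes M: "sets M = sets borel" "finite_measure M" and f: "f \<in> BV M"
    and \<nu>: "total_variation_measure M f \<nu>"
  shows "\<exists>fs. (\<forall>n. fs n \<in> Cyl) \<and> Lp_tendsto 1 M fs f \<and>
    (\<lambda>n. \<integral>\<^sup>+x. ennreal (dual_norm_diff (fs n) x) \<partial>M) \<longlonglongrightarrow> emeasure \<nu> UNIV \<and>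
    (\<forall>\<phi> :: 'a \<Rightarrow> real. continuous_on UNIV \<phi> \<longrightarrow> bounded (range \<phi>) \<longrightarrow>
       (\<lambda>n. \<integral>x. \<phi> x \<partial>density M (\<lambda>x. ennreal (dual_norm_diff (fs n) x))) \<longlonglongrightarrow> (\<integral>x. \<phi> x \<partial>\<nu>))"
proof -
  have \<nu>': "sets \<nu> = sets borel" "finite_measure \<nu>" "\<And>\<Omega>. open \<Omega> \<Longrightarrow> emeasure \<nu> \<Omega> = BV_energy_loc M f \<Omega>"
    "emeasure \<nu> UNIV = BV_energy M f"
    using \<nu> by (auto simp: total_variation_measure_def)
  have fin: "emeasure \<nu> UNIV < \<infinity>"
    using finite_measure.emeasure_finite[OF \<nu>'(2), of UNIV] by (simp add: less_top)
  obtain u where u: "\<And>n. u n \<in> Cyl" "\<And>n. slope (u n) = dual_norm_diff (u n)" "Lp_tendsto 1 M u f"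
    "(\<lambda>n. \<integral>\<^sup>+x. ennreal (slope (u n) x) \<partial>M) \<longlonglongrightarrow> BV_energy M f"
    using Cyl_tendsto_energy[OF M, of f] fin f by (auto simp: \<nu>'(4) BV_def)
  have uL: "u n \<in> LIPb UNIV" for n using u(1) Cyl_subset_LIPb by blast
  define N where "N n = density M (\<lambda>x. ennreal (slope (u n) x))" for n
  have meas [measurable]: "slope (u n) \<in> borel_measurable M" for n
    using slope_measurable[OF uL] by (simp add: measurable_cong_sets[OF M(1) refl])
  have space: "space M = UNIV" using sets_eq_imp_space_eq[OF M(1)] by simp
  have mass: "emeasure (N n) UNIV = (\<integral>\<^sup>+x. ennreal (slope (u n) x) \<partial>M)" for n
    using sets.top[of M] by (simp add: N_def emeasure_density space)
  have "finite_measure (N n)" for n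
  proof (rule finite_measureI)
    obtain L where L: "L-lipschitz_on UNIV (u n)" using uL[of n] by (auto simp: LIPb_def)
    have "(\<integral>\<^sup>+x. ennreal (slope (u n) x) \<partial>M) \<le> (\<integral>\<^sup>+x. ennreal L \<partial>M)"
      by (intro nn_integral_mono ennreal_leI slope_le[OF L])
    also have "\<dots> < \<infinity>"
      using finite_measure.emeasure_finite[OF M(2), of "space M"] by (simp add: ennreal_mult_less_top less_top)
    finally show "emeasure (N n) (space (N n)) \<noteq> \<infinity>" using mass[of n] by (simp add: N_def space)
  qed
  moreover have "sets (N n) = sets borel" for n by (simp add: N_def M(1))
  ultimately have "(\<lambda>n. \<integral>x. \<phi> x \<partial>N n) \<longlonglongrightarrow> (\<integral>x. \<phi> x \<partial>\<nu>)"
    if "continuous_on UNIV \<phi>" "bounded (range \<phi>)" for \<phi> :: "'a \<Rightarrow> real"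
    using u(4) that liminf_energy_open[OF M(1) uL u(3)]
    by (intro tendsto_integral_of_open) (auto simp: \<nu>' mass N_def[symmetric])
  then show ?thesis
    using u by (intro exI[of _ u]) (simp add: N_def \<nu>'(4))
qed

theorem theorem4p1:
  fixes M :: "'a::{banach, second_countable_topology} measure"
  assumes "sets M = sets borel" and "finite_measure M"
  shows
    "(\<forall>p f G. 1 \<le> p \<longrightarrow> f \<in> Sobolev p M \<longrightarrow> minimal_relaxed_slope p M f G \<longrightarrow>
        (\<exists>fs. (\<forall>n. fs n \<in> Cyl) \<and> Lp_tendsto p M fs f \<and>
              Lp_tendsto p M (\<lambda>n. dual_norm_diff (fs n)) G)) \<and>
     (\<forall>f \<nu>. f \<in> BV M \<longrightarrow> total_variation_measure M f \<nu> \<longrightarrow>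
        (\<exists>fs. (\<forall>n. fs n \<in> Cyl) \<and> Lp_tendsto 1 M fs f \<and>
              (\<lambda>n. \<integral>\<^sup>+x. ennreal (dual_norm_diff (fs n) x) \<partial>M) \<longlonglongrightarrow> emeasure \<nu> UNIV \<and>
              (\<forall>\<phi> :: 'a \<Rightarrow> real. continuous_on UNIV \<phi> \<longrightarrow> bounded (range \<phi>) \<longrightarrow>
                 (\<lambda>n. \<integral>x. \<phi> x \<partial>density M (\<lambda>x. ennreal (dual_norm_diff (fs n) x)))
                   \<longlonglongrightarrow> (\<integral>x. \<phi> x \<partial>\<nu>))))"
proof (intro conjI allI impI)
  fix p f G
  assume "1 \<le> p" "f \<in> Sobolev p M" "minimal_relaxed_slope p M f G"
  then have "minimal_slope M p f G"
    using assms
    by (intro minimal_slope.intro minimal_slope_axioms.intro) (auto simp: Sobolev_def)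
  then show "\<exists>fs. (\<forall>n. fs n \<in> Cyl) \<and> Lp_tendsto p M fs f \<and>
      Lp_tendsto p M (\<lambda>n. dual_norm_diff (fs n)) G"
    by (rule minimal_slope.Cyl_tendsto_minimal_slope)
qed (rule Cyl_tendsto_total_variation[OF assms])

end
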